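(* Consider the model in the context with $\mathcal L(Z_1)$ and $\mathcal L(Z_2)$ each chosen from the four families C, E, G, L (with arbitrary scale parameters $\sigma_1$ for $Z_1$ and $\sigma_2$ for $Z_2$, and arbitrary $\beta>2$ for L), and any observed $y$. Write U, G, N for "uniformly ergodic", "geometrically ergodic", and "not geometrically ergodic" respectively. Then: For $\mathcal P_0=(X,\Theta)$: - if $Z_2$ is C: U for $Z_1\in\{$C, E, G, L$\}$; - if $Z_2$ is E: N for $Z_1=$C; for $Z_1=$E it is geometrically ergodic, and uniformly ergodic when $\sigma_2>\sigma_1$; U for $Z_1\in\{$G, L$\}$; - if $Z_2$ is G: N for $Z_1=$C; G for $Z_1\in\{$E, G, L$\}$; - if $Z_2$ is L: N for $Z_1=$C; G for $Z_1\in\{$E, G, L$\}$. For $\mathcal P_1=(\tilde X,\Theta)$: - if $Z_2$ is C: U for $Z_1=$C; N for $Z_1\in\{$E, G, L$\}$; - if $Z_2$ is E: U for $Z_1=$C; for $Z_1=$E it is geometrically ergodic, and uniformly ergodic when $\sigma_1>\sigma_2$; G for $Z_1\in\{$G, L$\}$; - if $Z_2$ is G: U for $Z_1\in\{$C, E$\}$; G for $Z_1\in\{$G, L$\}$; - if $Z_2$ is L: U for $Z_1\in\{$C, E$\}$; G for $Z_1\in\{$G, L$\}$.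
   Context: Fix an observed value $y\in\mathbb R$. Consider the model $Y=X+Z_1$, $X=\Theta+Z_2$, where $Z_1,Z_2$ are independent real random variables, independent of $\Theta$, and $\Theta$ is given the improper flat (Lebesgue) prior on $\mathbb R$. The error distributions are taken from the following families, with densities given up to proportionality and scale parameter $\sigma>0$: C (Cauchy) $g(x)\propto 1/(1+(x/\sigma)^2)$; E (double exponential) $g(x)\propto\exp\{-|x|/\sigma\}$; G (Gaussian) $g(x)\propto\exp\{-(x/\sigma)^2/2\}$; L (exponential power, lighter than Gaussian) $g(x)\propto\exp\{-|x/\sigma|^\beta\}$ with $\beta>2$. The scale of $Z_i$ is $\sigma_i$, $i=1,2$. Write $\tilde X=X-\Theta$. For a parametrisation $\mathcal P=(U,\Theta)$ with $U\in\{X,\tilde X\}$, the Gibbs sampler started at $\Theta_0$ iterates, for $n\ge1$: draw $U_n\sim\mathcal L(U\mid Y=y,\Theta=\Theta_{n-1})$, then $\Theta_n\sim\mathcal L(\Theta\mid Y=y,U=U_n)$. The centred parametrisation is $\mathcal P_0=(X,\Theta)$ and the non-centred one is $\mathcal P_1=(\tilde X,\Theta)$. A parametrisation is called geometrically ergodic if its marginal chain $\{\Theta_n\}$ satisfies $\|\mathcal L(\Theta_n\mid Y=y,\Theta_0)-\mathcal L(\Theta\mid Y=y)\|_{TV}\le M(\Theta_0)r^n$ for all $n$, for some $r<1$ and some function $M$; it is called uniformly ergodic if in addition $M$ can be taken bounded. *)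

theory Defs
  imports "HOL-Probability.Probability"
begin

text \<open>Error families C, E, G, L (exponential power with exponent beta), given by
  unnormalised densities with scale sigma.\<close>

datatype fam = FamC | FamE | FamG | FamL real

fun fam_dens :: "fam \<Rightarrow> real \<Rightarrow> real \<Rightarrow> real" where
  "fam_dens FamC \<sigma> x = 1 / (1 + (x / \<sigma>)^2)"
| "fam_dens FamE \<sigma> x = exp (- \<bar>x\<bar> / \<sigma>)"
| "fam_dens FamG \<sigma> x = exp (- ((x / \<sigma>)^2) / 2)"
| "fam_dens (FamL \<beta>) \<sigma> x = exp (- (\<bar>x / \<sigma>\<bar> powr \<beta>))"

fun fam_ok :: "fam \<Rightarrow> bool" where
  "fam_ok (FamL \<beta>) = (\<beta> > 2)"
| "fam_ok _ = True"

definition is_L :: "fam \<Rightarrow> bool" where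
  "is_L f = (\<exists>\<beta>. f = FamL \<beta>)"

definition normalized :: "(real \<Rightarrow> real) \<Rightarrow> real measure" where
  "normalized h = density lborel (\<lambda>t. ennreal (h t / (LINT s|lborel. h s)))"

datatype param = Centred | NonCentred

text \<open>Model: Y = X + Z1, X = Theta + Z2, flat prior on Theta.
  Joint density of (Theta, X) given Y = y is proportional to g1(y - x) g2(x - theta);
  in the non-centred parametrisation (Theta, Xt) with Xt = X - Theta it is
  proportional to g1(y - theta - xt) g2(xt).\<close>

definition update_U :: "param \<Rightarrow> fam \<Rightarrow> real \<Rightarrow> fam \<Rightarrow> real \<Rightarrow> real \<Rightarrow> real \<Rightarrow> real measure" where
  "update_U P f1 s1 f2 s2 y \<theta> = (case P of
      Centred \<Rightarrow> normalized (\<lambda>x. fam_dens f1 s1 (y - x) * fam_dens f2 s2 (x - \<theta>))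
    | NonCentred \<Rightarrow> normalized (\<lambda>u. fam_dens f1 s1 (y - \<theta> - u) * fam_dens f2 s2 u))"

definition update_Theta :: "param \<Rightarrow> fam \<Rightarrow> real \<Rightarrow> fam \<Rightarrow> real \<Rightarrow> real \<Rightarrow> real \<Rightarrow> real measure" where
  "update_Theta P f1 s1 f2 s2 y u = (case P of
      Centred \<Rightarrow> normalized (\<lambda>t. fam_dens f2 s2 (u - t))
    | NonCentred \<Rightarrow> normalized (\<lambda>t. fam_dens f1 s1 (y - u - t)))"

definition gibbs_kernel :: "param \<Rightarrow> fam \<Rightarrow> real \<Rightarrow> fam \<Rightarrow> real \<Rightarrow> real \<Rightarrow> real \<Rightarrow> real measure" where
  "gibbs_kernel P f1 s1 f2 s2 y \<theta> =
     Giry_Monad.bind (update_U P f1 s1 f2 s2 y \<theta>) (update_Theta P f1 s1 f2 s2 y)"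

primrec chain_law :: "(real \<Rightarrow> real measure) \<Rightarrow> nat \<Rightarrow> real \<Rightarrow> real measure" where
  "chain_law K 0 \<theta>0 = return borel \<theta>0"
| "chain_law K (Suc n) \<theta>0 = Giry_Monad.bind (chain_law K n \<theta>0) K"

definition posterior :: "fam \<Rightarrow> real \<Rightarrow> fam \<Rightarrow> real \<Rightarrow> real \<Rightarrow> real measure" where
  "posterior f1 s1 f2 s2 y =
     normalized (\<lambda>t. LINT x|lborel. fam_dens f1 s1 (y - x) * fam_dens f2 s2 (x - t))"

definition tv_dist :: "real measure \<Rightarrow> real measure \<Rightarrow> real" where
  "tv_dist M N = (SUP A \<in> sets borel. \<bar>measure M A - measure N A\<bar>)"

definition geom_ergodic :: "param \<Rightarrow> fam \<Rightarrow> real \<Rightarrow> fam \<Rightarrow> real \<Rightarrow> real \<Rightarrow> bool" where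
  "geom_ergodic P f1 s1 f2 s2 y \<longleftrightarrow>
     (\<exists>r M. 0 \<le> r \<and> r < 1 \<and>
        (\<forall>\<theta>0 n. tv_dist (chain_law (gibbs_kernel P f1 s1 f2 s2 y) n \<theta>0) (posterior f1 s1 f2 s2 y)
                  \<le> M \<theta>0 * r ^ n))"

definition unif_ergodic :: "param \<Rightarrow> fam \<Rightarrow> real \<Rightarrow> fam \<Rightarrow> real \<Rightarrow> real \<Rightarrow> bool" where
  "unif_ergodic P f1 s1 f2 s2 y \<longleftrightarrow>
     (\<exists>r M. 0 \<le> r \<and> r < 1 \<and> bdd_above (range M) \<and>
        (\<forall>\<theta>0 n. tv_dist (chain_law (gibbs_kernel P f1 s1 f2 s2 y) n \<theta>0) (posterior f1 s1 f2 s2 y)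
                  \<le> M \<theta>0 * r ^ n))"

end

theory Submission
  imports Defs
begin

text \<open>The substitution \<open>u = y - x\<close> turns the non-centred sampler for \<open>(f1, f2)\<close> into the centred
  sampler for \<open>(f2, f1)\<close> with the same posterior, so only centred chains need to be studied. Such a
  chain has a transition density, reversible for the posterior, and it is minorised on bounded sets.

  If \<open>\<integral>h(x) g(x - \<theta>) dx \<le> C g(y - \<theta>)\<close>, the conditional law of \<open>X\<close> charges a fixed bounded set
  uniformly in \<open>\<theta>\<close>, and Doeblin's condition holds; this is the uniform case. If both errors
  have at least exponentially light tails, \<open>exp (s (\<theta> - y)) + exp (- s (\<theta> - y))\<close> is a drift function for
  small \<open>s\<close>: pairing \<open>x = \<theta> + z\<close> with \<open>x = \<theta> - z\<close>, the weight \<open>H\<close> favours the inner point and gives a gain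
  of order \<open>s\<close>, while the symmetric second step costs only \<open>O(s\<^sup>2)\<close>. If \<open>Z\<^sub>1\<close> is Cauchy and \<open>Z\<^sub>2\<close>
  is not, the chain moves like a light-tailed random walk and cannot reach the polynomial tails of
  the posterior at a geometric rate.\<close>

section \<open>Harris' theorem for kernels with a density\<close>

text \<open>One convergence theorem serves both positive cases: with \<open>V = 0\<close> it is
  Doeblin's theorem, with the exponential \<open>V\<close> the bound depends on the start.
  Minorisation is asked on every sublevel set of \<open>V\<close>, so no level has to be matched
  with the drift constants. In the geometric case the law of X given \<theta> has no closed form,
  and neither error need dominate the other. Of \<open>H\<close> only exponential decay past some
  point and an exponential moment are used, of \<open>g\<close> only symmetry, monotonicity and an
  exponential bound. The pairing gains nothing for z near 0, and takes another form once \<theta> -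
  z crosses the origin. The first region is compared, with a constant free of \<theta>, with the
  region 1 \<le> |z| \<le> \<theta>, where the gain is proportional to s; the second contributes
  only an additive constant. The resulting \<open>rate\<close> does not depend on s, which is what
  allows s to be taken so small that the linear gain beats the quadratic cost. In the negative case
  the point is that a Cauchy density changes over a step by a factor at most quadratic in the step,
  so increments have exponential moments bounded uniformly in the position.\<close>

locale markov_density =
  fixes k :: "real \<Rightarrow> real \<Rightarrow> real"
  assumes k_measurable [measurable]: "case_prod k \<in> borel_measurable (borel \<Otimes>\<^sub>M borel)"
    and k_nonneg: "0 \<le> k x t"
    and k_mass: "(\<integral>\<^sup>+t. ennreal (k x t) \<partial>lborel) = 1"
begin

definition K :: "real \<Rightarrow> real measure" where
  "K x = density lborel (\<lambda>t. ennreal (k x t))"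

lemma k_measurable' [measurable]: "k x \<in> borel_measurable borel"
  by measurable

lemma k_integrable: "integrable lborel (k x)"
  by (rule integrableI_nonneg) (auto simp: k_nonneg k_mass)

lemma k_integral: "(\<integral>t. k x t \<partial>lborel) = 1"
  by (subst integral_eq_nn_integral) (auto simp: k_nonneg k_mass)

lemma sets_K [simp, measurable_cong]: "sets (K x) = sets borel"
  by (simp add: K_def)

lemma prob_space_K: "prob_space (K x)"
  by (rule prob_spaceI) (simp add: K_def emeasure_density k_mass)

lemma K_kernel [measurable]: "K \<in> measurable borel (subprob_algebra borel)"
proof (rule measurable_subprob_algebra)
  fix A :: "real set" assume A [measurable]: "A \<in> sets borel"
  have "(\<lambda>a. emeasure (K a) A) = (\<lambda>a. \<integral>\<^sup>+t. ennreal (k a t) * indicator A t \<partial>lborel)"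
    by (simp add: K_def emeasure_density)
  then show "(\<lambda>a. emeasure (K a) A) \<in> borel_measurable borel"
    by simp
qed (auto simp: prob_space_K prob_space_imp_subprob_space)

lemma chain_sets [simp]: "sets (chain_law K n \<theta>) = sets borel"
proof (induction n)
  case (Suc n)
  then have "space (chain_law K n \<theta>) \<noteq> {}"
    using sets_eq_imp_space_eq[OF Suc] by simp
  then show ?case by (simp add: sets_bind[where N=borel])
qed simp

lemma chain_space [simp]: "space (chain_law K n \<theta>) = UNIV"
  using sets_eq_imp_space_eq[OF chain_sets] by simp

lemma K_kernel_chain: "K \<in> measurable (chain_law K n \<theta>) (subprob_algebra borel)"
  using K_kernel by (simp cong: measurable_cong_sets)

lemma prob_space_chain: "prob_space (chain_law K n \<theta>)"
proof (induction n)
  case 0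
  show ?case by (simp add: prob_space_return)
next
  case (Suc n)
  then interpret prob_space "chain_law K n \<theta>" .
  show ?case
    using K_kernel_chain by (auto intro!: prob_space_bind prob_space_K)
qed

lemma K_integrable_bounded:
  fixes \<psi> :: "real \<Rightarrow> real"
  assumes [measurable]: "\<psi> \<in> borel_measurable borel" and "\<And>t. 0 \<le> \<psi> t \<and> \<psi> t \<le> 1"
  shows "integrable lborel (\<lambda>t. \<psi> t * k x t)"
  by (rule Bochner_Integration.integrable_bound[OF k_integrable[of x]])
     (use assms(2) in \<open>auto simp: abs_mult k_nonneg mult_left_le_one_le\<close>)

lemma K_integral_bounded:
  fixes \<psi> :: "real \<Rightarrow> real"
  assumes [measurable]: "\<psi> \<in> borel_measurable borel" and b: "\<And>t. 0 \<le> \<psi> t \<and> \<psi> t \<le> 1"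
  shows "0 \<le> (\<integral>t. \<psi> t * k x t \<partial>lborel) \<and> (\<integral>t. \<psi> t * k x t \<partial>lborel) \<le> 1"
proof
  show "0 \<le> (\<integral>t. \<psi> t * k x t \<partial>lborel)"
    using b by (simp add: k_nonneg)
  have "(\<integral>t. \<psi> t * k x t \<partial>lborel) \<le> (\<integral>t. k x t \<partial>lborel)"
    by (rule integral_mono[OF K_integrable_bounded[OF assms] k_integrable])
       (use b in \<open>auto simp: k_nonneg mult_left_le_one_le\<close>)
  then show "(\<integral>t. \<psi> t * k x t \<partial>lborel) \<le> 1"
    by (simp add: k_integral)
qed

text \<open>The step peeled off is the last one, which acts on the test function: bounds along the
  chain can then be iterated by replacing a function by its image under the kernel.\<close>

lemma chain_integral_Suc:
  fixes \<psi> :: "real \<Rightarrow> real"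
  assumes [measurable]: "\<psi> \<in> borel_measurable borel" and b: "\<And>t. 0 \<le> \<psi> t \<and> \<psi> t \<le> 1"
  shows "(\<integral>t. \<psi> t \<partial>chain_law K (Suc n) \<theta>)
    = (\<integral>x. (\<integral>t. \<psi> t * k x t \<partial>lborel) \<partial>chain_law K n \<theta>)"
proof -
  interpret prob_space "chain_law K n \<theta>" by (rule prob_space_chain)
  have "(\<integral>t. \<psi> t \<partial>chain_law K (Suc n) \<theta>) = (\<integral>x. (\<integral>t. \<psi> t \<partial>K x) \<partial>chain_law K n \<theta>)"
    unfolding chain_law.simps
  proof (rule integral_bind[where K=borel and B=1 and B'=1])
    show "AE x in chain_law K n \<theta>. emeasure (K x) (space (K x)) \<le> ennreal 1"
      using prob_space.emeasure_space_1[OF prob_space_K] by simp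
  qed (use K_kernel_chain b in \<open>auto simp: finite_measure_axioms\<close>)
  also have "(\<lambda>x. \<integral>t. \<psi> t \<partial>K x) = (\<lambda>x. \<integral>t. \<psi> t * k x t \<partial>lborel)"
    by (auto simp: K_def integral_density k_nonneg mult.commute)
  finally show ?thesis .
qed

text \<open>Hairer and Mattingly's form of Harris' theorem: in the metric
  \<open>d(x, y) = 2 + \<beta> V(x) + \<beta> V(y)\<close> (for \<open>x \<noteq> y\<close>) the kernel is a strict contraction on
  Lipschitz functions, by the drift when \<open>V x + V y\<close> is large and by the minorisation otherwise.\<close>

lemma weighted_contraction:
  fixes V :: "real \<Rightarrow> real"
  assumes V_meas [measurable]: "V \<in> borel_measurable borel" and V_nonneg: "\<And>x. 0 \<le> V x"
    and V_int: "\<And>x. integrable lborel (\<lambda>t. V t * k x t)"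
    and drift: "\<And>x. (\<integral>t. V t * k x t \<partial>lborel) \<le> \<gamma> * V x + b"
    and \<gamma>: "0 \<le> \<gamma>" "\<gamma> < 1" and b: "0 \<le> b"
    and minor: "\<And>R. \<exists>\<epsilon>>0. \<forall>x. V x \<le> R \<longrightarrow> (\<forall>t\<in>{0..1}. \<epsilon> \<le> k x t)"
  obtains \<alpha> \<beta> where "0 \<le> \<alpha>" "\<alpha> < 1" "0 < \<beta>"
    "\<And>\<psi> L x y. \<psi> \<in> borel_measurable borel \<Longrightarrow> (\<And>t. 0 \<le> \<psi> t \<and> \<psi> t \<le> 1) \<Longrightarrow> 0 \<le> L \<Longrightarrow>
       (\<And>x y. \<bar>\<psi> x - \<psi> y\<bar> \<le> L * (2 + \<beta> * V x + \<beta> * V y)) \<Longrightarrow>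
       \<bar>(\<integral>t. \<psi> t * k x t \<partial>lborel) - (\<integral>t. \<psi> t * k y t \<partial>lborel)\<bar>
         \<le> \<alpha> * L * (2 + \<beta> * V x + \<beta> * V y)"
proof -
  \<comment> \<open>Beyond level \<open>R\<close>, half of the drift,
    \<open>(1 - \<gamma>) * S / 2\<close>, exceeds the additive terms \<open>2 * b\<close> by at
    least 1.\<close>
  define R where "R = (4 * b + 2) / (1 - \<gamma>)"
  obtain \<epsilon> where \<epsilon>: "\<epsilon> > 0" "\<And>x t. V x \<le> R \<Longrightarrow> t \<in> {0..1} \<Longrightarrow> \<epsilon> \<le> k x t"
    using minor[of R] by blast
  \<comment> \<open>Small enough that the additive drift terms of both points,
    \<open>2 * \<beta> * b\<close>, cost at most \<open>\<epsilon>\<close>, half of what the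
    minorisation returns.\<close>
  define \<beta> where "\<beta> = \<epsilon> / (2 * b + 1)"
  have \<beta>: "\<beta> > 0" "2 * \<beta> * b \<le> \<epsilon>"
    using \<epsilon> b by (auto simp: \<beta>_def field_simps)
  \<comment> \<open>\<open>\<beta> / 2\<close> is used beyond level \<open>R\<close>,
    \<open>\<epsilon> / 2\<close> below it, and \<open>(1 - \<gamma>) / 2\<close> absorbs
    \<open>\<eta> * \<beta> * S\<close> in both cases.\<close>
  define \<eta> where "\<eta> = Min {\<beta> / 2, (1 - \<gamma>) / 2, \<epsilon> / 2}"
  have \<eta>: "\<eta> > 0" "\<eta> \<le> \<beta> / 2" "\<eta> \<le> (1 - \<gamma>) / 2" "\<eta> \<le> \<epsilon> / 2"
    using \<beta> \<gamma> \<epsilon> by (auto simp: \<eta>_def min_def)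
  define \<alpha> where "\<alpha> = 1 - \<eta>"
  have contr: "\<bar>(\<integral>t. \<psi> t * k x t \<partial>lborel) - (\<integral>t. \<psi> t * k y t \<partial>lborel)\<bar>
         \<le> \<alpha> * L * (2 + \<beta> * V x + \<beta> * V y)"
    if [measurable]: "\<psi> \<in> borel_measurable borel" and \<psi>: "\<And>t. 0 \<le> \<psi> t \<and> \<psi> t \<le> 1" and L: "0 \<le> L"
      and lip: "\<And>x y. \<bar>\<psi> x - \<psi> y\<bar> \<le> L * (2 + \<beta> * V x + \<beta> * V y)" for \<psi> L x y
  proof -
    \<comment> \<open>The Lipschitz bound controls only differences of \<open>\<psi>\<close>.
      Shifting by this infimum turns it into the pointwise bound \<open>\<phi>_bd\<close>, and the
      constant drops out of the difference of integrals because the kernel has mass 1.\<close>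
    define c where "c = (INF z. L * (1 + \<beta> * V z) - \<psi> z)"
    have bdd: "bdd_below (range (\<lambda>z. L * (1 + \<beta> * V z) - \<psi> z))"
    proof (rule bdd_belowI2)
      fix z
      have "0 \<le> L * (1 + \<beta> * V z)" using L \<beta> V_nonneg by auto
      then show "-1 \<le> L * (1 + \<beta> * V z) - \<psi> z" using \<psi>[of z] by linarith
    qed
    define \<phi> where "\<phi> = (\<lambda>t. \<psi> t + c)"
    have [measurable]: "\<phi> \<in> borel_measurable borel" unfolding \<phi>_def by measurable
    have \<phi>_bd: "\<bar>\<phi> t\<bar> \<le> L * (1 + \<beta> * V t)" for t
    proof -
      have "c \<le> L * (1 + \<beta> * V t) - \<psi> t"
        unfolding c_def by (rule cINF_lower[OF bdd]) auto
      moreover have "- \<psi> t - L * (1 + \<beta> * V t) \<le> c"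
        unfolding c_def
      proof (rule cINF_greatest)
        fix z
        show "- \<psi> t - L * (1 + \<beta> * V t) \<le> L * (1 + \<beta> * V z) - \<psi> z"
          using lip[of z t] by (auto simp: algebra_simps)
      qed auto
      ultimately show ?thesis by (auto simp: \<phi>_def)
    qed
    have \<phi>_int: "integrable lborel (\<lambda>t. \<phi> t * k x t)" for x
      unfolding \<phi>_def distrib_right
      using K_integrable_bounded[OF _ \<psi>] k_integrable by simp
    have W_int: "integrable lborel (\<lambda>t. L * (1 + \<beta> * V t) * k x t)" for x
    proof -
      have "(\<lambda>t. L * (1 + \<beta> * V t) * k x t) = (\<lambda>t. L * k x t + L * \<beta> * (V t * k x t))"
        by (auto simp: algebra_simps)
      then show ?thesis using k_integrable V_int by simp
    qed
    have W: "(\<integral>t. L * (1 + \<beta> * V t) * k x t \<partial>lborel) \<le> L * (1 + \<beta> * (\<gamma> * V x + b))" for x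
    proof -
      have "(\<integral>t. L * (1 + \<beta> * V t) * k x t \<partial>lborel)
          = (\<integral>t. L * k x t + L * \<beta> * (V t * k x t) \<partial>lborel)"
        by (auto simp: algebra_simps)
      also have "\<dots> = L + L * \<beta> * (\<integral>t. V t * k x t \<partial>lborel)"
        using k_integrable V_int by (simp add: k_integral)
      also have "\<dots> \<le> L + L * \<beta> * (\<gamma> * V x + b)"
        using drift[of x] L \<beta> by (intro add_left_mono mult_left_mono) auto
      finally show ?thesis by (simp add: algebra_simps)
    qed
    have \<phi>\<psi>: "(\<integral>t. \<phi> t * k x t \<partial>lborel) = (\<integral>t. \<psi> t * k x t \<partial>lborel) + c" for x
      unfolding \<phi>_def distrib_right
      using K_integrable_bounded[OF _ \<psi>] k_integrable by (simp add: k_integral)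
    define S where "S = V x + V y"
    have S: "0 \<le> S" using V_nonneg by (simp add: S_def)
    have main: "\<bar>(\<integral>t. \<phi> t * k x t \<partial>lborel) - (\<integral>t. \<phi> t * k y t \<partial>lborel)\<bar> \<le> \<alpha> * L * (2 + \<beta> * S)"
    proof (cases "S \<le> R")
      case False
      have ab: "\<bar>(\<integral>t. \<phi> t * k x t \<partial>lborel)\<bar> \<le> L * (1 + \<beta> * (\<gamma> * V x + b))" for x
      proof -
        have "\<bar>(\<integral>t. \<phi> t * k x t \<partial>lborel)\<bar> \<le> (\<integral>t. \<bar>\<phi> t * k x t\<bar> \<partial>lborel)"
          by (rule integral_abs_bound)
        also have "\<dots> \<le> (\<integral>t. L * (1 + \<beta> * V t) * k x t \<partial>lborel)"
        proof (rule integral_mono)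
          show "\<bar>\<phi> t * k x t\<bar> \<le> L * (1 + \<beta> * V t) * k x t" for t
            using mult_right_mono[OF \<phi>_bd k_nonneg] by (simp add: abs_mult k_nonneg)
        qed (intro integrable_abs \<phi>_int W_int)+
        finally show ?thesis using W[of x] by linarith
      qed
      have "\<bar>(\<integral>t. \<phi> t * k x t \<partial>lborel) - (\<integral>t. \<phi> t * k y t \<partial>lborel)\<bar>
          \<le> L * (2 + \<beta> * (\<gamma> * S + 2 * b))"
        using ab[of x] ab[of y] by (auto simp: S_def algebra_simps)
      also have "\<dots> \<le> L * (\<alpha> * (2 + \<beta> * S))"
      proof (rule mult_left_mono[OF _ L])
        have "R * (1 - \<gamma>) = 4 * b + 2" using \<gamma> by (simp add: R_def)
        moreover have "R * (1 - \<gamma>) \<le> S * (1 - \<gamma>)" using False \<gamma> by (intro mult_right_mono) auto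
        ultimately have "4 * b + 2 \<le> (1 - \<gamma>) * S" by (simp add: mult.commute)
        then have "\<beta> * (2 * b + 1) \<le> \<beta> * ((1 - \<gamma>) * S / 2)" using \<beta> by (intro mult_left_mono) auto
        moreover have "\<eta> * (\<beta> * S) \<le> (1 - \<gamma>) / 2 * (\<beta> * S)" using \<eta> \<beta> S by (intro mult_right_mono) auto
        ultimately show "2 + \<beta> * (\<gamma> * S + 2 * b) \<le> \<alpha> * (2 + \<beta> * S)"
          using \<eta> unfolding \<alpha>_def by (simp add: algebra_simps)
      qed
      finally show ?thesis by (simp add: mult_ac)
    next
      case True
      then have VR: "V x \<le> R" "V y \<le> R" using V_nonneg[of x] V_nonneg[of y] by (auto simp: S_def)
      \<comment> \<open>\<open>n\<close> lies below both \<open>k x\<close> and \<open>k y\<close>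
        and cancels in their difference. As the weight is at least \<open>L\<close>, removing it
        saves \<open>L * \<epsilon>\<close> at each of the two points.\<close>
      define n where "n = (\<lambda>t::real. \<epsilon> * indicator {0..1} t)"
      have [measurable]: "n \<in> borel_measurable borel" unfolding n_def by measurable
      have n_int: "integrable lborel n"
        unfolding n_def by (intro integrable_mult_right) auto
      have n_k: "n t \<le> k z t" if "V z \<le> R" for z t
        using \<epsilon> that k_nonneg[of z t] by (auto simp: n_def indicator_def)
      have n_nonneg: "0 \<le> n t" for t using \<epsilon> by (auto simp: n_def)
      have n_I: "(\<integral>t. n t \<partial>lborel) = \<epsilon>" by (simp add: n_def)
      have \<phi>n_int: "integrable lborel (\<lambda>t. \<phi> t * n t)"
        by (rule Bochner_Integration.integrable_bound[OF \<phi>_int[of x]])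
           (auto simp: abs_mult k_nonneg n_nonneg intro!: mult_left_mono n_k VR)
      have Wn_int: "integrable lborel (\<lambda>t. L * (1 + \<beta> * V t) * n t)"
        using L \<beta> V_nonneg by (intro Bochner_Integration.integrable_bound[OF W_int[of x]])
           (auto simp: abs_mult k_nonneg n_nonneg intro!: mult_left_mono n_k VR)
      have Wn: "L * \<epsilon> \<le> (\<integral>t. L * (1 + \<beta> * V t) * n t \<partial>lborel)"
      proof -
        have "L * \<epsilon> = (\<integral>t. L * n t \<partial>lborel)" using n_I by simp
        also have "\<dots> \<le> (\<integral>t. L * (1 + \<beta> * V t) * n t \<partial>lborel)"
          using n_int Wn_int L \<beta> V_nonneg n_nonneg
          by (intro integral_mono) (auto intro!: mult_right_mono simp: algebra_simps)
        finally show ?thesis .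
      qed
      have ab: "\<bar>(\<integral>t. \<phi> t * k z t \<partial>lborel) - (\<integral>t. \<phi> t * n t \<partial>lborel)\<bar>
          \<le> L * (1 + \<beta> * (\<gamma> * V z + b)) - L * \<epsilon>" if z: "V z \<le> R" for z
      proof -
        have "\<bar>(\<integral>t. \<phi> t * k z t \<partial>lborel) - (\<integral>t. \<phi> t * n t \<partial>lborel)\<bar>
            = \<bar>\<integral>t. \<phi> t * k z t - \<phi> t * n t \<partial>lborel\<bar>"
          using \<phi>_int \<phi>n_int by simp
        also have "\<dots> \<le> (\<integral>t. \<bar>\<phi> t * k z t - \<phi> t * n t\<bar> \<partial>lborel)"
          by (rule integral_abs_bound)
        also have "\<dots> \<le> (\<integral>t. L * (1 + \<beta> * V t) * k z t - L * (1 + \<beta> * V t) * n t \<partial>lborel)"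
        proof (rule integral_mono)
          fix t
          have "\<bar>\<phi> t * k z t - \<phi> t * n t\<bar> = \<bar>\<phi> t\<bar> * (k z t - n t)"
            using n_k[OF z, of t] by (simp add: right_diff_distrib[symmetric] abs_mult)
          also have "\<dots> \<le> L * (1 + \<beta> * V t) * (k z t - n t)"
            using n_k[OF z, of t] by (intro mult_right_mono \<phi>_bd) auto
          finally show "\<bar>\<phi> t * k z t - \<phi> t * n t\<bar> \<le> L * (1 + \<beta> * V t) * k z t - L * (1 + \<beta> * V t) * n t"
            by (simp add: algebra_simps)
        qed (intro integrable_abs Bochner_Integration.integrable_diff \<phi>_int \<phi>n_int W_int Wn_int)+
        also have "\<dots> = (\<integral>t. L * (1 + \<beta> * V t) * k z t \<partial>lborel) - (\<integral>t. L * (1 + \<beta> * V t) * n t \<partial>lborel)"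
          using W_int Wn_int by (rule Bochner_Integration.integral_diff)
        finally show ?thesis using W[of z] Wn by linarith
      qed
      have "\<bar>(\<integral>t. \<phi> t * k x t \<partial>lborel) - (\<integral>t. \<phi> t * k y t \<partial>lborel)\<bar>
          \<le> L * (2 + \<beta> * (\<gamma> * S + 2 * b) - 2 * \<epsilon>)"
        using ab[OF VR(1)] ab[OF VR(2)] by (auto simp: S_def algebra_simps)
      also have "\<dots> \<le> L * (\<alpha> * (2 + \<beta> * S))"
      proof (rule mult_left_mono[OF _ L])
        have "\<eta> * (\<beta> * S) \<le> (1 - \<gamma>) * (\<beta> * S)" using \<eta> \<gamma> \<beta> S by (intro mult_right_mono) auto
        then show "2 + \<beta> * (\<gamma> * S + 2 * b) - 2 * \<epsilon> \<le> \<alpha> * (2 + \<beta> * S)"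
          using \<eta> \<beta> unfolding \<alpha>_def by (simp add: algebra_simps)
      qed
      finally show ?thesis by (simp add: mult_ac)
    qed
    then show ?thesis by (simp add: \<phi>\<psi> S_def algebra_simps)
  qed
  show thesis
    by (rule that[of \<alpha> \<beta>]) (use \<eta> \<gamma> \<beta> contr in \<open>auto simp: \<alpha>_def\<close>)
qed

text \<open>Detailed balance moves the kernel to the variable that Tonelli then integrates first,
  where its total mass is 1.\<close>

lemma reversible_stationary:
  fixes p \<psi> :: "real \<Rightarrow> real"
  assumes [measurable]: "p \<in> borel_measurable borel" and p_nonneg: "\<And>x. 0 \<le> p x"
    and p_mass: "(\<integral>\<^sup>+x. ennreal (p x) \<partial>lborel) = 1"
    and rev: "\<And>x t. p x * k x t = p t * k t x"
    and [measurable]: "\<psi> \<in> borel_measurable borel" and \<psi>: "\<And>t. 0 \<le> \<psi> t \<and> \<psi> t \<le> 1"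
  shows "(\<integral>x. (\<integral>t. \<psi> t * k x t \<partial>lborel) * p x \<partial>lborel) = (\<integral>x. \<psi> x * p x \<partial>lborel)"
proof -
  have "(\<integral>\<^sup>+x. ennreal ((\<integral>t. \<psi> t * k x t \<partial>lborel) * p x) \<partial>lborel)
      = (\<integral>\<^sup>+x. (\<integral>\<^sup>+t. ennreal (\<psi> t * k x t) \<partial>lborel) * ennreal (p x) \<partial>lborel)"
    using \<psi> by (intro nn_integral_cong, subst nn_integral_eq_integral[OF K_integrable_bounded])
       (auto simp: k_nonneg p_nonneg ennreal_mult)
  also have "\<dots> = (\<integral>\<^sup>+x. (\<integral>\<^sup>+t. ennreal (\<psi> t * p t * k t x) \<partial>lborel) \<partial>lborel)"
  proof (rule nn_integral_cong)
    fix x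
    have "(\<integral>\<^sup>+t. ennreal (\<psi> t * k x t) \<partial>lborel) * ennreal (p x)
        = (\<integral>\<^sup>+t. ennreal (\<psi> t * k x t) * ennreal (p x) \<partial>lborel)"
      by (simp add: nn_integral_multc)
    also have "\<dots> = (\<integral>\<^sup>+t. ennreal (\<psi> t * p t * k t x) \<partial>lborel)"
    proof (rule nn_integral_cong)
      fix t
      have "\<psi> t * k x t * p x = \<psi> t * p t * k t x"
        using rev[of x t] by (simp add: mult_ac)
      then show "ennreal (\<psi> t * k x t) * ennreal (p x) = ennreal (\<psi> t * p t * k t x)"
        using \<psi> by (simp add: ennreal_mult[symmetric] k_nonneg p_nonneg)
    qed
    finally show "(\<integral>\<^sup>+t. ennreal (\<psi> t * k x t) \<partial>lborel) * ennreal (p x)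
        = (\<integral>\<^sup>+t. ennreal (\<psi> t * p t * k t x) \<partial>lborel)" .
  qed
  also have "\<dots> = (\<integral>\<^sup>+t. (\<integral>\<^sup>+x. ennreal (\<psi> t * p t * k t x) \<partial>lborel) \<partial>lborel)"
    by (rule lborel_pair.Fubini') measurable
  also have "\<dots> = (\<integral>\<^sup>+t. ennreal (\<psi> t * p t) \<partial>lborel)"
    using \<psi> by (intro nn_integral_cong)
      (simp add: ennreal_mult k_nonneg p_nonneg nn_integral_cmult k_mass)
  finally show ?thesis
    using \<psi> by (subst (1 2) integral_eq_nn_integral) (auto simp: p_nonneg k_nonneg)
qed

text \<open>Iterating the contraction on test functions gives the rate. Integrability of
  \<open>V\<close> under \<open>p\<close> makes the initial distance between a point mass and the
  stationary law finite, of order \<open>1 + V \<theta>\<close>.\<close>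

theorem harris:
  fixes V p :: "real \<Rightarrow> real"
  assumes V_meas [measurable]: "V \<in> borel_measurable borel" and V_nonneg: "\<And>x. 0 \<le> V x"
    and V_int: "\<And>x. integrable lborel (\<lambda>t. V t * k x t)"
    and drift: "\<And>x. (\<integral>t. V t * k x t \<partial>lborel) \<le> \<gamma> * V x + b"
    and \<gamma>: "0 \<le> \<gamma>" "\<gamma> < 1" and b: "0 \<le> b"
    and minor: "\<And>R. \<exists>\<epsilon>>0. \<forall>x. V x \<le> R \<longrightarrow> (\<forall>t\<in>{0..1}. \<epsilon> \<le> k x t)"
    and p_meas [measurable]: "p \<in> borel_measurable borel" and p_nonneg: "\<And>x. 0 \<le> p x"
    and p_mass: "(\<integral>\<^sup>+x. ennreal (p x) \<partial>lborel) = 1"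
    and rev: "\<And>x t. p x * k x t = p t * k t x"
    and pV: "integrable lborel (\<lambda>t. V t * p t)"
  shows "\<exists>C r. 0 \<le> r \<and> r < 1 \<and>
    (\<forall>\<theta> n. tv_dist (chain_law K n \<theta>) (density lborel (\<lambda>t. ennreal (p t))) \<le> C * (1 + V \<theta>) * r ^ n)"
proof (rule weighted_contraction[OF V_meas V_nonneg V_int drift \<gamma> b minor])
  fix \<alpha> \<beta> :: real
  assume \<alpha>: "0 \<le> \<alpha>" "\<alpha> < 1" and \<beta>: "0 < \<beta>" and
    contr: "\<And>\<psi> L x y. \<psi> \<in> borel_measurable borel \<Longrightarrow> (\<And>t. 0 \<le> \<psi> t \<and> \<psi> t \<le> 1) \<Longrightarrow> 0 \<le> L \<Longrightarrow>
       (\<And>x y. \<bar>\<psi> x - \<psi> y\<bar> \<le> L * (2 + \<beta> * V x + \<beta> * V y)) \<Longrightarrow>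
       \<bar>(\<integral>t. \<psi> t * k x t \<partial>lborel) - (\<integral>t. \<psi> t * k y t \<partial>lborel)\<bar>
         \<le> \<alpha> * L * (2 + \<beta> * V x + \<beta> * V y)"
  have p_int: "integrable lborel p"
    by (rule integrableI_nonneg) (auto simp: p_nonneg p_mass)
  have p_I: "(\<integral>t. p t \<partial>lborel) = 1"
    by (subst integral_eq_nn_integral) (auto simp: p_nonneg p_mass)
  define D where "D = (\<lambda>\<theta>. 2 + \<beta> * V \<theta> + \<beta> * (\<integral>t. V t * p t \<partial>lborel))"
  have \<psi>p_int: "integrable lborel (\<lambda>t. \<psi> t * p t)"
    if [measurable]: "\<psi> \<in> borel_measurable borel" and "\<And>t. 0 \<le> \<psi> t \<and> \<psi> t \<le> 1" for \<psi>
    by (rule Bochner_Integration.integrable_bound[OF p_int])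
       (use that(2) in \<open>auto simp: abs_mult p_nonneg mult_left_le_one_le\<close>)
  \<comment> \<open>Induction over test functions: a step replaces \<open>\<psi>\<close> by its
    image under the kernel and \<open>L\<close> by \<open>\<alpha> * L\<close>, while stationarity
    leaves the second integral unchanged.\<close>
  have conv: "\<bar>(\<integral>t. \<psi> t \<partial>chain_law K n \<theta>) - (\<integral>t. \<psi> t * p t \<partial>lborel)\<bar> \<le> \<alpha> ^ n * L * D \<theta>"
    if "\<psi> \<in> borel_measurable borel" "\<And>t. 0 \<le> \<psi> t \<and> \<psi> t \<le> 1" "0 \<le> L"
      "\<And>x y. \<bar>\<psi> x - \<psi> y\<bar> \<le> L * (2 + \<beta> * V x + \<beta> * V y)" for \<psi> L n \<theta>
    using that
  proof (induction n arbitrary: \<psi> L)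
    case 0
    note [measurable] = 0(1)
    have "\<bar>\<psi> \<theta> - (\<integral>t. \<psi> t * p t \<partial>lborel)\<bar> = \<bar>\<integral>t. \<psi> \<theta> * p t - \<psi> t * p t \<partial>lborel\<bar>"
      using \<psi>p_int[OF 0(1,2)] p_int by (simp add: p_I)
    also have "\<dots> \<le> (\<integral>t. \<bar>\<psi> \<theta> * p t - \<psi> t * p t\<bar> \<partial>lborel)"
      by (rule integral_abs_bound)
    also have "\<dots> \<le> (\<integral>t. L * (2 + \<beta> * V \<theta>) * p t + L * \<beta> * (V t * p t) \<partial>lborel)"
    proof (rule integral_mono)
      fix t
      have "\<bar>\<psi> \<theta> * p t - \<psi> t * p t\<bar> = \<bar>\<psi> \<theta> - \<psi> t\<bar> * p t"
        using p_nonneg[of t] by (simp add: left_diff_distrib[symmetric] abs_mult)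
      also have "\<dots> \<le> L * (2 + \<beta> * V \<theta> + \<beta> * V t) * p t"
        using p_nonneg[of t] by (intro mult_right_mono 0)
      finally show "\<bar>\<psi> \<theta> * p t - \<psi> t * p t\<bar> \<le> L * (2 + \<beta> * V \<theta>) * p t + L * \<beta> * (V t * p t)"
        by (simp add: algebra_simps)
    qed (use \<psi>p_int[OF 0(1,2)] p_int pV in \<open>auto intro!: integrable_abs\<close>)
    also have "\<dots> = L * D \<theta>"
      using p_int pV by (simp add: p_I D_def algebra_simps)
    finally show ?case by (simp add: integral_return)
  next
    case (Suc n)
    note [measurable] = Suc.prems(1)
    let ?K\<psi> = "\<lambda>x. \<integral>t. \<psi> t * k x t \<partial>lborel"
    have "\<bar>(\<integral>x. ?K\<psi> x \<partial>chain_law K n \<theta>) - (\<integral>x. ?K\<psi> x * p x \<partial>lborel)\<bar> \<le> \<alpha> ^ n * (\<alpha> * L) * D \<theta>"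
      using contr[OF Suc.prems] \<alpha> Suc.prems(3)
      by (intro Suc.IH K_integral_bounded[OF Suc.prems(1,2)]) auto
    then show ?case
      unfolding chain_integral_Suc[OF Suc.prems(1,2)]
        reversible_stationary[OF p_meas p_nonneg p_mass rev Suc.prems(1,2)]
      by (simp add: mult_ac)
  qed
  have D_le: "D \<theta> \<le> (2 + \<beta> + \<beta> * (\<integral>t. V t * p t \<partial>lborel)) * (1 + V \<theta>)" for \<theta>
  proof -
    have "0 \<le> (\<integral>t. V t * p t \<partial>lborel)" using V_nonneg p_nonneg by simp
    then have "0 \<le> \<beta> * (\<integral>t. V t * p t \<partial>lborel) * V \<theta>"
      using V_nonneg[of \<theta>] \<beta> by simp
    then show ?thesis
      using \<beta> V_nonneg[of \<theta>] by (simp add: D_def algebra_simps)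
  qed
  define C where "C = 2 + \<beta> + \<beta> * (\<integral>t. V t * p t \<partial>lborel)"
  have "tv_dist (chain_law K n \<theta>) (density lborel (\<lambda>t. ennreal (p t))) \<le> C * (1 + V \<theta>) * \<alpha> ^ n" for \<theta> n
    unfolding tv_dist_def
  proof (rule cSUP_least)
    fix A :: "real set" assume A [measurable]: "A \<in> sets borel"
    interpret chain: prob_space "chain_law K n \<theta>" by (rule prob_space_chain)
    have 1: "measure (chain_law K n \<theta>) A = (\<integral>t. indicator A t \<partial>chain_law K n \<theta>)"
      using A by simp
    have 2: "measure (density lborel (\<lambda>t. ennreal (p t))) A = (\<integral>t. indicator A t * p t \<partial>lborel)"
    proof -
      have "measure (density lborel (\<lambda>t. ennreal (p t))) A
          = (\<integral>t. indicator A t \<partial>density lborel (\<lambda>t. ennreal (p t)))"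
        by simp
      also have "\<dots> = (\<integral>t. indicator A t * p t \<partial>lborel)"
        by (subst integral_density) (auto simp: p_nonneg mult.commute)
      finally show ?thesis .
    qed
    \<comment> \<open>\<open>L = 1\<close> suffices for an indicator: its oscillation is at most 1
      and the metric is at least 2.\<close>
    have "\<bar>(\<integral>t. indicator A t \<partial>chain_law K n \<theta>) - (\<integral>t. indicator A t * p t \<partial>lborel)\<bar> \<le> \<alpha> ^ n * 1 * D \<theta>"
    proof (rule conv)
      fix x y
      have "0 \<le> \<beta> * V x" "0 \<le> \<beta> * V y" using \<beta> V_nonneg by auto
      then show "\<bar>indicator A x - indicator A y\<bar> \<le> 1 * (2 + \<beta> * V x + \<beta> * V y)"
        by (auto simp: indicator_def)
    qed auto
    also have "\<dots> \<le> \<alpha> ^ n * (C * (1 + V \<theta>))"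
      using D_le[of \<theta>] \<alpha> by (auto simp: C_def intro: mult_left_mono)
    finally show "\<bar>measure (chain_law K n \<theta>) A - measure (density lborel (\<lambda>t. ennreal (p t))) A\<bar>
        \<le> C * (1 + V \<theta>) * \<alpha> ^ n"
      unfolding 1 2 by (simp add: mult_ac)
  qed auto
  then show ?thesis using \<alpha> by blast
qed

end

section \<open>The Gibbs kernel and its density\<close>

lemma lborel_integral_pos:
  fixes w :: "real \<Rightarrow> real"
  assumes "integrable lborel w" "\<And>x. 0 < w x"
  shows "0 < (\<integral>x. w x \<partial>lborel)"
proof -
  have "(\<integral>x. w x \<partial>lborel) \<noteq> 0"
  proof
    assume "(\<integral>x. w x \<partial>lborel) = 0"
    then have "AE x in lborel. w x = 0"
      using assms by (subst (asm) integral_nonneg_eq_0_iff_AE) (auto intro: less_imp_le)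
    then have "AE x in (lborel :: real measure). False"
      by eventually_elim (use assms in \<open>auto simp: less_le\<close>)
    then show False by (simp add: AE_iff_measurable[OF _ refl])
  qed
  moreover have "0 \<le> (\<integral>x. w x \<partial>lborel)" using assms by (simp add: less_imp_le)
  ultimately show ?thesis by simp
qed

lemma nn_integral_lborel_reflect:
  fixes f :: "real \<Rightarrow> ennreal"
  assumes [measurable]: "f \<in> borel_measurable borel"
  shows "(\<integral>\<^sup>+t. f (x - t) \<partial>lborel) = (\<integral>\<^sup>+t. f t \<partial>lborel)"
  using nn_integral_real_affine[of f "-1" x] by simp

text \<open>Densities stay unnormalised, as the families are given up to proportionality;
  \<open>mass\<close> is the missing constant. Monotonicity in the absolute value includes
  symmetry.\<close>

locale error_density =
  fixes g :: "real \<Rightarrow> real"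
  assumes measurable_dens [measurable]: "g \<in> borel_measurable borel"
    and pos: "0 < g x"
    and antimono: "\<bar>x\<bar> \<le> \<bar>x'\<bar> \<Longrightarrow> g x' \<le> g x"
    and integrable: "integrable lborel g"
begin

lemma nonneg [simp]: "0 \<le> g x"
  using pos[of x] by simp

lemma even: "g (- x) = g x"
  using antimono[of x "-x"] antimono[of "-x" x] by simp

lemma le_max: "g x \<le> g 0"
  by (rule antimono) simp

lemma minus_commute: "g (x - t) = g (t - x)"
  using even[of "x - t"] by simp

definition mass :: real where "mass = (\<integral>x. g x \<partial>lborel)"

lemma mass_pos: "0 < mass"
  unfolding mass_def using integrable pos by (rule lborel_integral_pos)

lemma nn_integral_dens: "(\<integral>\<^sup>+x. ennreal (g x) \<partial>lborel) = ennreal mass"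
  unfolding mass_def by (rule nn_integral_eq_integral[OF integrable]) simp

end

text \<open>For the centred sampler \<open>H\<close> is the density of the observation error
  \<open>y - x\<close> and \<open>g\<close> that of \<open>x - \<theta>\<close>; the non-centred
  sampler is the same locale with the two exchanged.\<close>

locale gibbs_model = H: error_density H + G: error_density g for H g +
  fixes y :: real
begin

definition joint :: "real \<Rightarrow> real \<Rightarrow> real" where
  "joint \<theta> x = H (y - x) * g (x - \<theta>)"

definition marg :: "real \<Rightarrow> real" where
  "marg \<theta> = (\<integral>x. joint \<theta> x \<partial>lborel)"

definition k :: "real \<Rightarrow> real \<Rightarrow> real" where
  "k \<theta> t = (\<integral>x. joint \<theta> x * g (x - t) \<partial>lborel) / (marg \<theta> * G.mass)"

lemma joint_measurable [measurable]: "case_prod joint \<in> borel_measurable (borel \<Otimes>\<^sub>M borel)"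
  unfolding joint_def by measurable

lemma joint_measurable' [measurable]: "joint \<theta> \<in> borel_measurable borel"
  by measurable

lemma joint_pos: "0 < joint \<theta> x"
  by (simp add: joint_def H.pos G.pos)

lemma joint_nonneg [simp]: "0 \<le> joint \<theta> x"
  using joint_pos[of \<theta> x] by simp

lemma H_integrable: "integrable lborel (\<lambda>x. H (y - x))"
  using lborel_integrable_real_affine[OF H.integrable, of "-1" y] by simp

lemma g_integrable: "integrable lborel (\<lambda>x. g (x - \<theta>))"
  using lborel_integrable_real_affine[OF G.integrable, of 1 "-\<theta>"] by simp

lemma integral_g: "(\<integral>x. g (x - \<theta>) \<partial>lborel) = G.mass"
  using lborel_integral_real_affine[of 1 g "-\<theta>"] by (simp add: G.mass_def)

lemma joint_integrable: "integrable lborel (joint \<theta>)"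
proof (rule Bochner_Integration.integrable_bound)
  show "integrable lborel (\<lambda>x. g 0 * H (y - x))" using H_integrable by simp
  show "AE x in lborel. norm (joint \<theta> x) \<le> norm (g 0 * H (y - x))"
    unfolding joint_def
    by (intro AE_I2) (simp add: abs_mult mult.commute[of "g 0"] mult_left_mono G.le_max)
qed simp

lemma joint2_integrable: "integrable lborel (\<lambda>x. joint \<theta> x * g (x - t))"
proof (rule Bochner_Integration.integrable_bound)
  show "integrable lborel (\<lambda>x. g 0 * joint \<theta> x)" using joint_integrable by simp
  show "AE x in lborel. norm (joint \<theta> x * g (x - t)) \<le> norm (g 0 * joint \<theta> x)"
    using G.le_max by (auto simp: abs_mult mult.commute intro!: mult_right_mono)
qed simp

lemma marg_pos: "0 < marg \<theta>"
  unfolding marg_def using joint_integrable joint_pos by (rule lborel_integral_pos)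

lemma marg_measurable [measurable]: "marg \<in> borel_measurable borel"
  unfolding marg_def by measurable

lemma nn_marg: "(\<integral>\<^sup>+x. ennreal (joint \<theta> x) \<partial>lborel) = ennreal (marg \<theta>)"
  unfolding marg_def by (rule nn_integral_eq_integral[OF joint_integrable]) simp

lemma k_measurable [measurable]: "case_prod k \<in> borel_measurable (borel \<Otimes>\<^sub>M borel)"
  unfolding k_def by measurable

lemma k_nonneg: "0 \<le> k \<theta> t"
  using marg_pos[of \<theta>] G.mass_pos by (auto simp: k_def intro!: divide_nonneg_nonneg)

lemma nn_k: "ennreal (k \<theta> t)
    = (\<integral>\<^sup>+x. ennreal (joint \<theta> x / marg \<theta>) * ennreal (g (x - t) / G.mass) \<partial>lborel)"
proof -
  have "(\<integral>\<^sup>+x. ennreal (joint \<theta> x / marg \<theta>) * ennreal (g (x - t) / G.mass) \<partial>lborel)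
      = (\<integral>\<^sup>+x. ennreal (joint \<theta> x * g (x - t) / (marg \<theta> * G.mass)) \<partial>lborel)"
    using marg_pos[of \<theta>] G.mass_pos by (simp add: ennreal_mult[symmetric])
  also have "\<dots> = ennreal (\<integral>x. joint \<theta> x * g (x - t) / (marg \<theta> * G.mass) \<partial>lborel)"
    using marg_pos[of \<theta>] G.mass_pos joint2_integrable
    by (intro nn_integral_eq_integral) (auto intro!: divide_nonneg_nonneg)
  finally show ?thesis by (simp add: k_def)
qed

text \<open>Tonelli over the intermediate draw of X. With an arbitrary non-negative \<phi> it serves
  for the mass of the kernel, for its identification with the two-stage draw and for exponential
  moments.\<close>

lemma nn_integral_k:
  fixes \<phi> :: "real \<Rightarrow> ennreal"
  assumes [measurable]: "\<phi> \<in> borel_measurable borel"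
  shows "(\<integral>\<^sup>+t. \<phi> t * ennreal (k \<theta> t) \<partial>lborel)
    = (\<integral>\<^sup>+x. ennreal (joint \<theta> x / marg \<theta>)
         * (\<integral>\<^sup>+t. \<phi> t * ennreal (g (x - t) / G.mass) \<partial>lborel) \<partial>lborel)"
proof -
  have "(\<integral>\<^sup>+t. \<phi> t * ennreal (k \<theta> t) \<partial>lborel)
      = (\<integral>\<^sup>+t. (\<integral>\<^sup>+x. \<phi> t * (ennreal (joint \<theta> x / marg \<theta>) * ennreal (g (x - t) / G.mass)) \<partial>lborel) \<partial>lborel)"
    by (simp add: nn_k nn_integral_cmult)
  also have "\<dots> = (\<integral>\<^sup>+x. (\<integral>\<^sup>+t. \<phi> t * (ennreal (joint \<theta> x / marg \<theta>) * ennreal (g (x - t) / G.mass)) \<partial>lborel) \<partial>lborel)"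
    by (rule lborel_pair.Fubini') measurable
  also have "\<dots> = (\<integral>\<^sup>+x. (\<integral>\<^sup>+t. ennreal (joint \<theta> x / marg \<theta>) * (\<phi> t * ennreal (g (x - t) / G.mass)) \<partial>lborel) \<partial>lborel)"
    by (simp add: mult_ac)
  also have "\<dots> = (\<integral>\<^sup>+x. ennreal (joint \<theta> x / marg \<theta>)
         * (\<integral>\<^sup>+t. \<phi> t * ennreal (g (x - t) / G.mass) \<partial>lborel) \<partial>lborel)"
    by (simp add: nn_integral_cmult)
  finally show ?thesis .
qed

lemma joint_mass: "(\<integral>\<^sup>+x. ennreal (joint \<theta> x / marg \<theta>) \<partial>lborel) = 1"
proof -
  have "(\<integral>\<^sup>+x. ennreal (joint \<theta> x / marg \<theta>) \<partial>lborel)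
      = ennreal (\<integral>x. joint \<theta> x / marg \<theta> \<partial>lborel)"
    using marg_pos[of \<theta>] joint_integrable
    by (intro nn_integral_eq_integral) (auto intro!: divide_nonneg_nonneg)
  then show ?thesis using marg_pos[of \<theta>] by (simp add: marg_def)
qed

lemma g_mass: "(\<integral>\<^sup>+t. ennreal (g (x - t) / G.mass) \<partial>lborel) = 1"
proof -
  have "(\<integral>\<^sup>+t. ennreal (g (x - t) / G.mass) \<partial>lborel) = (\<integral>\<^sup>+t. ennreal (g t / G.mass) \<partial>lborel)"
    using nn_integral_lborel_reflect[of "\<lambda>u. ennreal (g u / G.mass)" x] by simp
  also have "\<dots> = ennreal (\<integral>t. g t / G.mass \<partial>lborel)"
    using G.mass_pos G.integrable
    by (intro nn_integral_eq_integral) (auto intro!: divide_nonneg_nonneg)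
  finally show ?thesis using G.mass_pos by (simp add: G.mass_def)
qed

sublocale markov_density k
proof
  fix \<theta>
  show "(\<integral>\<^sup>+t. ennreal (k \<theta> t) \<partial>lborel) = 1"
    using nn_integral_k[of "\<lambda>_. 1" \<theta>] by (simp add: g_mass joint_mass)
qed (use k_measurable k_nonneg in auto)

lemma dens_kernel: "(\<lambda>x. density lborel (\<lambda>t. ennreal (g (x - t) / G.mass))) \<in> measurable borel (subprob_algebra borel)"
    (is "?N \<in> _")
proof (rule measurable_subprob_algebra)
  fix x
  show "subprob_space (?N x)"
    by (intro prob_space_imp_subprob_space prob_spaceI) (simp add: emeasure_density g_mass)
next
  fix A :: "real set" assume [measurable]: "A \<in> sets borel"
  have "(\<lambda>x. emeasure (?N x) A) = (\<lambda>x. \<integral>\<^sup>+t. ennreal (g (x - t) / G.mass) * indicator A t \<partial>lborel)"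
    by (simp add: emeasure_density)
  then show "(\<lambda>x. emeasure (?N x) A) \<in> borel_measurable borel" by simp
qed simp

lemma K_eq_bind: "Giry_Monad.bind (density lborel (\<lambda>x. ennreal (joint \<theta> x / marg \<theta>)))
    (\<lambda>x. density lborel (\<lambda>t. ennreal (g (x - t) / G.mass))) = K \<theta>"
  (is "Giry_Monad.bind ?M ?N = _")
proof (rule measure_eqI)
  have N': "?N \<in> measurable ?M (subprob_algebra borel)"
    using dens_kernel by (simp cong: measurable_cong_sets)
  show "sets (?M \<bind> ?N) = sets (K \<theta>)"
    by (simp add: sets_bind[where N=borel])
  fix A assume "A \<in> sets (?M \<bind> ?N)"
  then have A [measurable]: "A \<in> sets borel" by (simp add: sets_bind[where N=borel])
  have "emeasure (?M \<bind> ?N) A = (\<integral>\<^sup>+x. emeasure (?N x) A \<partial>?M)"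
    by (rule emeasure_bind[OF _ N' A]) simp
  also have "\<dots> = (\<integral>\<^sup>+x. (\<integral>\<^sup>+t. indicator A t * ennreal (g (x - t) / G.mass) \<partial>lborel) \<partial>?M)"
    by (simp add: emeasure_density mult.commute)
  also have "\<dots> = (\<integral>\<^sup>+t. indicator A t * ennreal (k \<theta> t) \<partial>lborel)"
    by (simp add: nn_integral_density nn_integral_k)
  also have "\<dots> = emeasure (K \<theta>) A"
    by (simp add: K_def emeasure_density mult.commute)
  finally show "emeasure (?M \<bind> ?N) A = emeasure (K \<theta>) A" .
qed

text \<open>Integrating out \<theta> before x leaves a product of two masses; in particular the
  posterior is proper although the prior is flat.\<close>

lemma nn_integral_marg: "(\<integral>\<^sup>+\<theta>. ennreal (marg \<theta>) \<partial>lborel) = ennreal (H.mass * G.mass)"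
proof -
  have "(\<integral>\<^sup>+\<theta>. ennreal (marg \<theta>) \<partial>lborel) = (\<integral>\<^sup>+\<theta>. (\<integral>\<^sup>+x. ennreal (joint \<theta> x) \<partial>lborel) \<partial>lborel)"
    by (simp add: nn_marg)
  also have "\<dots> = (\<integral>\<^sup>+x. (\<integral>\<^sup>+\<theta>. ennreal (joint \<theta> x) \<partial>lborel) \<partial>lborel)"
    by (rule lborel_pair.Fubini') measurable
  also have "\<dots> = (\<integral>\<^sup>+x. ennreal (H (y - x)) * (\<integral>\<^sup>+\<theta>. ennreal (g (x - \<theta>)) \<partial>lborel) \<partial>lborel)"
    by (simp add: joint_def ennreal_mult nn_integral_cmult)
  also have "\<dots> = ennreal (H.mass * G.mass)"
    using nn_integral_lborel_reflect[of "\<lambda>u. ennreal (g u)"] nn_integral_lborel_reflect[of "\<lambda>u. ennreal (H u)" y]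
      G.mass_pos H.mass_pos
    by (simp add: G.nn_integral_dens H.nn_integral_dens nn_integral_multc ennreal_mult)
  finally show ?thesis .
qed

lemma marg_integrable: "integrable lborel marg"
  by (rule integrableI_nonneg) (auto simp: nn_integral_marg marg_pos less_imp_le)

lemma integral_marg: "(\<integral>\<theta>. marg \<theta> \<partial>lborel) = H.mass * G.mass"
  using H.mass_pos G.mass_pos marg_pos
  by (subst integral_eq_nn_integral) (auto simp: nn_integral_marg less_imp_le)

definition post :: "real \<Rightarrow> real" where
  "post \<theta> = marg \<theta> / (H.mass * G.mass)"

lemma post_measurable [measurable]: "post \<in> borel_measurable borel"
  unfolding post_def by measurable

lemma post_nonneg: "0 \<le> post \<theta>"
  using marg_pos[of \<theta>] G.mass_pos H.mass_pos by (simp add: post_def)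

lemma post_mass: "(\<integral>\<^sup>+\<theta>. ennreal (post \<theta>) \<partial>lborel) = 1"
proof -
  have "(\<integral>\<^sup>+\<theta>. ennreal (post \<theta>) \<partial>lborel) = ennreal (\<integral>\<theta>. post \<theta> \<partial>lborel)"
    using marg_integrable post_nonneg by (intro nn_integral_eq_integral) (auto simp: post_def)
  then show ?thesis using G.mass_pos H.mass_pos by (simp add: post_def integral_marg)
qed

text \<open>\<open>marg\<close> in the denominator of \<open>k\<close> cancels the posterior
  density. What remains on both sides is the integral of
  \<open>H (y - x) * g (x - \<theta>) * g (x - t)\<close>, symmetric in \<theta> and t.\<close>

lemma reversible: "post \<theta> * k \<theta> t = post t * k t \<theta>"
proof -
  have "(\<integral>x. joint \<theta> x * g (x - t) \<partial>lborel) = (\<integral>x. joint t x * g (x - \<theta>) \<partial>lborel)"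
    by (simp add: joint_def mult_ac)
  then show ?thesis
    using marg_pos[of \<theta>] marg_pos[of t] by (simp add: k_def post_def)
qed

text \<open>Only intermediate draws in \<open>{y..y+1}\<close> are kept. The window has length 1, so
  no extra factor appears, and it sits at the observation because \<open>H (y - x)\<close> is at
  least \<open>H 1\<close> there, whatever \<theta> is.\<close>

lemma k_lower:
  assumes "\<And>x. x \<in> {y..y+1} \<Longrightarrow> m \<le> joint \<theta> x" "\<And>x. x \<in> {y..y+1} \<Longrightarrow> m' \<le> g (x - t)"
    and "0 \<le> m" "0 \<le> m'"
  shows "m * m' / (marg \<theta> * G.mass) \<le> k \<theta> t"
proof -
  have "m * m' = (\<integral>x. m * m' * indicator {y..y+1} x \<partial>lborel)" by simp
  also have "\<dots> \<le> (\<integral>x. joint \<theta> x * g (x - t) \<partial>lborel)"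
  proof (rule integral_mono)
    show "m * m' * indicator {y..y+1} x \<le> joint \<theta> x * g (x - t)" for x
      using assms by (auto simp: indicator_def intro!: mult_mono)
  qed (use joint2_integrable in auto)
  finally show ?thesis
    using marg_pos[of \<theta>] G.mass_pos by (simp add: k_def divide_right_mono)
qed

definition gibbs_rate_bound :: "(real \<Rightarrow> real) \<Rightarrow> bool" where
  "gibbs_rate_bound M \<longleftrightarrow> (\<exists>r. 0 \<le> r \<and> r < 1 \<and>
    (\<forall>\<theta> n. tv_dist (chain_law K n \<theta>) (density lborel (\<lambda>t. ennreal (post t))) \<le> M \<theta> * r ^ n))"

lemma local_minorisation: "\<exists>\<epsilon>>0. \<forall>\<theta>. \<bar>\<theta>\<bar> \<le> B \<longrightarrow> (\<forall>t\<in>{0..1}. \<epsilon> \<le> k \<theta> t)"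
proof (cases "0 \<le> B")
  case True
  define m where "m = H 1 * g (\<bar>y\<bar> + 1 + B)"
  define m' where "m' = g (\<bar>y\<bar> + 2)"
  have m: "m > 0" "m' > 0" by (auto simp: m_def m'_def H.pos G.pos)
  define c where "c = H.mass * g 0"
  have c: "0 < c" using H.mass_pos G.pos by (simp add: c_def)
  have marg_le: "marg \<theta> \<le> c" for \<theta>
  proof -
    have "marg \<theta> \<le> (\<integral>x. H (y - x) * g 0 \<partial>lborel)"
      unfolding marg_def using joint_integrable H_integrable G.le_max
      by (intro integral_mono) (auto simp: joint_def intro!: mult_left_mono)
    also have "(\<integral>x. H (y - x) * g 0 \<partial>lborel) = c"
      using lborel_integral_real_affine[of "-1" H y] by (simp add: c_def H.mass_def)
    finally show ?thesis .
  qed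
  have "m * m' / (c * G.mass) \<le> k \<theta> t" if "\<bar>\<theta>\<bar> \<le> B" "t \<in> {0..1}" for \<theta> t
  proof -
    have "m * m' / (marg \<theta> * G.mass) \<le> k \<theta> t"
    proof (rule k_lower)
      show "m \<le> joint \<theta> x" if "x \<in> {y..y+1}" for x
        using that \<open>\<bar>\<theta>\<bar> \<le> B\<close> unfolding m_def joint_def
        by (intro mult_mono H.antimono G.antimono) (auto simp: abs_if split: if_splits)
      show "m' \<le> g (x - t)" if "x \<in> {y..y+1}" for x
        using that \<open>t \<in> _\<close> unfolding m'_def
        by (intro G.antimono) (auto simp: abs_if split: if_splits)
    qed (use m in auto)
    moreover have "m * m' / (c * G.mass) \<le> m * m' / (marg \<theta> * G.mass)"
      using m marg_le[of \<theta>] marg_pos[of \<theta>] G.mass_pos c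
      by (intro divide_left_mono) (auto intro!: mult_right_mono)
    ultimately show ?thesis by linarith
  qed
  moreover have "0 < m * m' / (c * G.mass)" using m c G.mass_pos by simp
  ultimately show ?thesis by blast
next
  case False
  then show ?thesis by (intro exI[of _ 1]) auto
qed

text \<open>Given \<theta>, the density of X on the window \<open>{y..y+1}\<close> is at least a
  constant times \<open>g (y - \<theta>) / marg \<theta>\<close>, and the bound on
  \<open>marg\<close> cancels \<theta>. That a unit shift costs a bounded factor holds for Cauchy
  and Laplace tails but fails for Gaussian ones.\<close>

lemma uniform_if_marg_le:
  assumes C: "0 < C" "\<And>\<theta>. marg \<theta> \<le> C * g (y - \<theta>)"
    and c: "0 < c" "\<And>z d. \<bar>d\<bar> \<le> 1 \<Longrightarrow> c * g z \<le> g (z + d)"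
  shows "\<exists>C. gibbs_rate_bound (\<lambda>_. C)"
proof -
  define m' where "m' = g (\<bar>y\<bar> + 2)"
  define \<epsilon> where "\<epsilon> = H 1 * c * m' / (C * G.mass)"
  have \<epsilon>: "\<epsilon> > 0" using H.pos G.pos C c G.mass_pos by (auto simp: \<epsilon>_def m'_def)
  have minor: "\<epsilon> \<le> k \<theta> t" if t: "t \<in> {0..1}" for \<theta> t
  proof -
    have "(H 1 * c * g (y - \<theta>)) * m' / (marg \<theta> * G.mass) \<le> k \<theta> t"
    proof (rule k_lower)
      fix x assume x: "x \<in> {y..y+1}"
      have "c * g (y - \<theta>) \<le> g (x - \<theta>)" using c(2)[of "x - y" "y - \<theta>"] x by simp
      moreover have "H 1 \<le> H (y - x)" using x by (intro H.antimono) auto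
      ultimately have "H 1 * (c * g (y - \<theta>)) \<le> joint \<theta> x"
        unfolding joint_def using c by (intro mult_mono) auto
      then show "H 1 * c * g (y - \<theta>) \<le> joint \<theta> x" by (simp add: mult_ac)
      show "m' \<le> g (x - t)"
        using x t unfolding m'_def by (intro G.antimono) (auto simp: abs_if split: if_splits)
    qed (use c in \<open>auto simp: m'_def\<close>)
    moreover have "\<epsilon> = (H 1 * c * g (y - \<theta>)) * m' / (C * g (y - \<theta>) * G.mass)"
      using G.pos[of "y - \<theta>"] C G.mass_pos by (simp add: \<epsilon>_def)
    moreover have "(H 1 * c * g (y - \<theta>)) * m' / (C * g (y - \<theta>) * G.mass)
        \<le> (H 1 * c * g (y - \<theta>)) * m' / (marg \<theta> * G.mass)"
      using c C G.pos G.mass_pos marg_pos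
      by (intro divide_left_mono mult_right_mono) (auto simp: m'_def)
    ultimately show ?thesis by linarith
  qed
  \<comment> \<open>Doeblin's condition as a drift condition with \<open>V = 0\<close>: every
    non-empty sublevel set is the whole line.\<close>
  have "\<exists>\<epsilon>>0. \<forall>\<theta>. (0::real) \<le> R \<longrightarrow> (\<forall>t\<in>{0..1}. \<epsilon> \<le> k \<theta> t)" for R
    using minor \<epsilon> by blast
  then have "\<exists>C r. 0 \<le> r \<and> r < 1 \<and> (\<forall>\<theta> n. tv_dist (chain_law K n \<theta>)
      (density lborel (\<lambda>t. ennreal (post t))) \<le> C * (1 + 0) * r ^ n)"
    using post_nonneg post_mass reversible
    by (intro harris[where V="\<lambda>_. 0" and \<gamma>=0 and b=0]) auto
  then show ?thesis unfolding gibbs_rate_bound_def by auto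
qed

end

section \<open>Reflection x = y - u: the non-centred sampler in centred form\<close>

lemma density_lborel_reflect:
  fixes f :: "real \<Rightarrow> ennreal"
  assumes [measurable]: "f \<in> borel_measurable borel"
  shows "density lborel (\<lambda>u. f (y - u)) = distr (density lborel f) borel (\<lambda>x. y - x)"
proof (rule measure_eqI)
  fix A assume "A \<in> sets (density lborel (\<lambda>u. f (y - u)))"
  then have A [measurable]: "A \<in> sets borel" by simp
  have "emeasure (density lborel (\<lambda>u. f (y - u))) A = (\<integral>\<^sup>+u. f (y - u) * indicator A (y - (y - u)) \<partial>lborel)"
    by (simp add: emeasure_density)
  also have "\<dots> = (\<integral>\<^sup>+x. f x * indicator A (y - x) \<partial>lborel)"
    by (rule nn_integral_lborel_reflect) measurable
  also have "\<dots> = emeasure (distr (density lborel f) borel (\<lambda>x. y - x)) A"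
    by (simp add: nn_integral_indicator[symmetric] nn_integral_distr nn_integral_density
        del: nn_integral_indicator)
  finally show "emeasure (density lborel (\<lambda>u. f (y - u))) A
      = emeasure (distr (density lborel f) borel (\<lambda>x. y - x)) A" .
qed simp

lemma integral_lborel_reflect:
  fixes f :: "real \<Rightarrow> real"
  shows "(\<integral>x. f (y - x) \<partial>lborel) = (\<integral>x. f x \<partial>lborel)"
  using lborel_integral_real_affine[of "-1" f y] by simp

context gibbs_model
begin

text \<open>The intermediate variable is integrated out, so relabelling it leaves the kernel from
  \<theta> to t unchanged.\<close>

lemma K_eq_bind_reflect: "Giry_Monad.bind (density lborel (\<lambda>u. ennreal (joint \<theta> (y - u) / marg \<theta>)))
    (\<lambda>u. density lborel (\<lambda>t. ennreal (g (y - u - t) / G.mass))) = K \<theta>"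
  (is "?L = _")
proof -
  let ?N = "\<lambda>x. density lborel (\<lambda>t. ennreal (g (x - t) / G.mass))"
  let ?M = "density lborel (\<lambda>x. ennreal (joint \<theta> x / marg \<theta>))"
  have "?L = distr ?M borel (\<lambda>x. y - x) \<bind> (\<lambda>u. ?N (y - u))"
    by (subst density_lborel_reflect[where f="\<lambda>x. ennreal (joint \<theta> x / marg \<theta>)"]) simp_all
  also have "\<dots> = ?M \<bind> (\<lambda>x. ?N (y - (y - x)))"
    by (rule bind_distr[where K=borel]) (use measurable_compose[OF _ dens_kernel, of "\<lambda>u. y - u" borel] in auto)
  also have "\<dots> = K \<theta>" using K_eq_bind by simp
  finally show ?thesis .
qed

end

lemma gibbs_kernel_Centred:
  assumes "gibbs_model (fam_dens f1 s1) (fam_dens f2 s2)"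
  shows "gibbs_kernel Centred f1 s1 f2 s2 y = markov_density.K (gibbs_model.k (fam_dens f1 s1) (fam_dens f2 s2) y)"
proof
  fix \<theta>
  interpret gibbs_model "fam_dens f1 s1" "fam_dens f2 s2" y by fact
  have "update_U Centred f1 s1 f2 s2 y \<theta> = density lborel (\<lambda>x. ennreal (joint \<theta> x / marg \<theta>))"
    by (simp add: update_U_def normalized_def joint_def marg_def)
  moreover have "update_Theta Centred f1 s1 f2 s2 y = (\<lambda>x. density lborel (\<lambda>t. ennreal (fam_dens f2 s2 (x - t) / G.mass)))"
    by (rule ext) (simp add: update_Theta_def normalized_def G.mass_def integral_lborel_reflect[of "fam_dens f2 s2"])
  ultimately show "gibbs_kernel Centred f1 s1 f2 s2 y \<theta> = K \<theta>"
    unfolding gibbs_kernel_def using K_eq_bind by simp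
qed

text \<open>With \<open>u = y - x\<close>, the density \<open>fam_dens f2 s2\<close> is evaluated at
  \<open>y - x\<close>, the place of \<open>H\<close>, and \<open>fam_dens f1 s1\<close> at
  \<open>y - \<theta> - u = x - \<theta>\<close>, the place of \<open>g\<close>.\<close>

lemma gibbs_kernel_NonCentred:
  assumes "gibbs_model (fam_dens f2 s2) (fam_dens f1 s1)"
  shows "gibbs_kernel NonCentred f1 s1 f2 s2 y = markov_density.K (gibbs_model.k (fam_dens f2 s2) (fam_dens f1 s1) y)"
proof
  fix \<theta>
  interpret gibbs_model "fam_dens f2 s2" "fam_dens f1 s1" y by fact
  have "(\<lambda>u. fam_dens f1 s1 (y - \<theta> - u) * fam_dens f2 s2 u) = (\<lambda>u. joint \<theta> (y - u))"
    by (simp add: joint_def mult.commute algebra_simps)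
  then have "update_U NonCentred f1 s1 f2 s2 y \<theta> = density lborel (\<lambda>u. ennreal (joint \<theta> (y - u) / marg \<theta>))"
    by (simp add: update_U_def normalized_def marg_def integral_lborel_reflect)
  moreover have "update_Theta NonCentred f1 s1 f2 s2 y = (\<lambda>u. density lborel (\<lambda>t. ennreal (fam_dens f1 s1 (y - u - t) / G.mass)))"
    by (rule ext) (simp add: update_Theta_def normalized_def G.mass_def integral_lborel_reflect[of "fam_dens f1 s1"])
  ultimately show "gibbs_kernel NonCentred f1 s1 f2 s2 y \<theta> = K \<theta>"
    unfolding gibbs_kernel_def using K_eq_bind_reflect by simp
qed

lemma posterior_eq:
  assumes "gibbs_model (fam_dens f1 s1) (fam_dens f2 s2)"
  shows "posterior f1 s1 f2 s2 y = density lborel (\<lambda>t. ennreal (gibbs_model.post (fam_dens f1 s1) (fam_dens f2 s2) y t))"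
proof -
  interpret gibbs_model "fam_dens f1 s1" "fam_dens f2 s2" y by fact
  show ?thesis
    by (simp add: posterior_def normalized_def post_def marg_def[symmetric] joint_def[symmetric] integral_marg)
qed

text \<open>Convolution is commutative: x is replaced by \<open>y + t - x\<close>.\<close>

lemma posterior_swap:
  assumes "gibbs_model (fam_dens f2 s2) (fam_dens f1 s1)"
  shows "posterior f1 s1 f2 s2 y = posterior f2 s2 f1 s1 y"
proof -
  interpret gibbs_model "fam_dens f2 s2" "fam_dens f1 s1" y by fact
  have "(\<integral>x. fam_dens f1 s1 (y - x) * fam_dens f2 s2 (x - t) \<partial>lborel)
      = (\<integral>x. fam_dens f2 s2 (y - x) * fam_dens f1 s1 (x - t) \<partial>lborel)" for t
  proof -
    have "(\<integral>x. fam_dens f2 s2 (y - x) * fam_dens f1 s1 (x - t) \<partial>lborel)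
        = (\<integral>x. fam_dens f2 s2 (y - (y + t - x)) * fam_dens f1 s1 (y + t - x - t) \<partial>lborel)"
      by (rule integral_lborel_reflect[symmetric])
    also have "\<dots> = (\<integral>x. fam_dens f1 s1 (y - x) * fam_dens f2 s2 (x - t) \<partial>lborel)"
      by (simp add: mult.commute)
    finally show ?thesis by simp
  qed
  then show ?thesis by (simp add: posterior_def)
qed

lemma geom_ergodic_iff:
  assumes "gibbs_model (fam_dens f1 s1) (fam_dens f2 s2)"
  shows "geom_ergodic Centred f1 s1 f2 s2 y \<longleftrightarrow> (\<exists>M. gibbs_model.gibbs_rate_bound (fam_dens f1 s1) (fam_dens f2 s2) y M)"
    and "geom_ergodic NonCentred f2 s2 f1 s1 y \<longleftrightarrow> (\<exists>M. gibbs_model.gibbs_rate_bound (fam_dens f1 s1) (fam_dens f2 s2) y M)"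
  unfolding geom_ergodic_def gibbs_model.gibbs_rate_bound_def[OF assms] posterior_swap[OF assms]
    posterior_eq[OF assms] gibbs_kernel_Centred[OF assms] gibbs_kernel_NonCentred[OF assms]
  by blast+

lemma unif_ergodic_iff:
  assumes "gibbs_model (fam_dens f1 s1) (fam_dens f2 s2)"
  shows "unif_ergodic Centred f1 s1 f2 s2 y \<longleftrightarrow>
      (\<exists>M. bdd_above (range M) \<and> gibbs_model.gibbs_rate_bound (fam_dens f1 s1) (fam_dens f2 s2) y M)"
    and "unif_ergodic NonCentred f2 s2 f1 s1 y \<longleftrightarrow>
      (\<exists>M. bdd_above (range M) \<and> gibbs_model.gibbs_rate_bound (fam_dens f1 s1) (fam_dens f2 s2) y M)"
  unfolding unif_ergodic_def gibbs_model.gibbs_rate_bound_def[OF assms] posterior_swap[OF assms]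
    posterior_eq[OF assms] gibbs_kernel_Centred[OF assms] gibbs_kernel_NonCentred[OF assms]
  by blast+

section \<open>The error families and uniform ergodicity\<close>

definition cauchy :: "real \<Rightarrow> real \<Rightarrow> real" where
  "cauchy \<sigma> x = 1 / (1 + (x / \<sigma>)\<^sup>2)"

text \<open>One family covers E (exponent 1), G (exponent 2, scale \<open>sqrt 2 * \<sigma>\<close>)
  and L, so that only Cauchy errors need separate treatment.\<close>

definition exp_power :: "real \<Rightarrow> real \<Rightarrow> real \<Rightarrow> real" where
  "exp_power \<beta> \<sigma> x = exp (- ((\<bar>x\<bar> / \<sigma>) powr \<beta>))"

lemma cauchy_measurable [measurable]: "cauchy \<sigma> \<in> borel_measurable borel"
  unfolding cauchy_def[abs_def] by measurable

lemma cauchy_integrable_1: "integrable lborel (cauchy 1)"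
proof (rule integrableI_nonneg)
  have *: "(\<integral>\<^sup>+x. ennreal (1 / (1 + x\<^sup>2)) * indicator {0..} x \<partial>lborel) = ennreal (pi / 2 - arctan 0)"
  proof (rule nn_integral_FTC_atLeast)
    show "(arctan has_real_derivative 1 / (1 + x\<^sup>2)) (at x)" for x :: real
      using DERIV_arctan[of x] by (simp add: inverse_eq_divide)
    show "(arctan \<longlongrightarrow> pi / 2) at_top" by (rule tendsto_arctan_at_top)
  qed auto
  have "(\<integral>\<^sup>+x. ennreal (cauchy 1 x) \<partial>lborel)
      \<le> (\<integral>\<^sup>+x. ennreal (1 / (1 + x\<^sup>2)) * indicator {0..} x
           + ennreal (1 / (1 + (0 - x)\<^sup>2)) * indicator {0..} (0 - x) \<partial>lborel)"
    by (intro nn_integral_mono) (auto simp: cauchy_def indicator_def)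
  also have "\<dots> = (\<integral>\<^sup>+x. ennreal (1 / (1 + x\<^sup>2)) * indicator {0..} x \<partial>lborel)
        + (\<integral>\<^sup>+x. ennreal (1 / (1 + (0 - x)\<^sup>2)) * indicator {0..} (0 - x) \<partial>lborel)"
    by (rule nn_integral_add) auto
  also have "(\<integral>\<^sup>+x. ennreal (1 / (1 + (0 - x)\<^sup>2)) * indicator {0..} (0 - x) \<partial>lborel)
      = (\<integral>\<^sup>+x. ennreal (1 / (1 + x\<^sup>2)) * indicator {0..} x \<partial>lborel)"
    by (rule nn_integral_lborel_reflect[of "\<lambda>x. ennreal (1 / (1 + x\<^sup>2)) * indicator {0..} x" 0]) auto
  finally show "(\<integral>\<^sup>+x. ennreal (cauchy 1 x) \<partial>lborel) < \<infinity>"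
    unfolding * by (auto simp: top_unique less_top[symmetric])
qed (auto simp: cauchy_def)

lemma cauchy_integrable:
  assumes "\<sigma> > 0" shows "integrable lborel (cauchy \<sigma>)"
proof -
  have "integrable lborel (\<lambda>x. cauchy 1 (0 + (1 / \<sigma>) * x))"
    using assms by (intro lborel_integrable_real_affine cauchy_integrable_1) auto
  then show ?thesis by (simp add: cauchy_def[abs_def])
qed

text \<open>From \<open>1 + u + u\<^sup>2 / 2 \<le> exp u\<close>. The comparison makes two-sided
  exponentials integrable and later puts every family below a Cauchy density.\<close>

lemma laplace_le_cauchy:
  fixes b x :: real
  assumes "b > 0" shows "exp (- b * \<bar>x\<bar>) \<le> 2 * cauchy (1 / b) x"
proof -
  define u where "u = b * \<bar>x\<bar>"
  have u: "0 \<le> u" using assms by (simp add: u_def)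
  have "1 + u\<^sup>2 \<le> 2 * exp u"
    using exp_lower_Taylor_quadratic[OF u] u by (simp add: field_simps)
  then have "exp (- u) \<le> 2 / (1 + u\<^sup>2)"
    by (simp add: exp_minus field_simps add_pos_nonneg)
  also have "u\<^sup>2 = (x / (1 / b))\<^sup>2" by (simp add: u_def power_mult_distrib mult.commute)
  finally show ?thesis by (simp add: cauchy_def u_def)
qed

lemma laplace_integrable:
  fixes b :: real
  assumes "b > 0" shows "integrable lborel (\<lambda>x. exp (- b * \<bar>x\<bar>))"
proof (rule Bochner_Integration.integrable_bound)
  show "integrable lborel (\<lambda>x. 2 * cauchy (1 / b) x)"
    using cauchy_integrable[of "1 / b"] assms by simp
  show "AE x in lborel. norm (exp (- b * \<bar>x\<bar>)) \<le> norm (2 * cauchy (1 / b) x)"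
    using laplace_le_cauchy[OF assms] by (intro AE_I2) (simp add: cauchy_def)
qed simp

lemma error_density_cauchy:
  assumes "\<sigma> > 0" shows "error_density (cauchy \<sigma>)"
proof
  fix x x' :: real
  show "0 < cauchy \<sigma> x" by (simp add: cauchy_def add_pos_nonneg)
  assume "\<bar>x\<bar> \<le> \<bar>x'\<bar>"
  then have "x\<^sup>2 \<le> x'\<^sup>2" using abs_le_square_iff by blast
  then have "(x / \<sigma>)\<^sup>2 \<le> (x' / \<sigma>)\<^sup>2" by (simp add: power_divide divide_right_mono)
  then show "cauchy \<sigma> x' \<le> cauchy \<sigma> x"
    unfolding cauchy_def by (intro divide_left_mono) (auto simp: add_pos_nonneg)
qed (use cauchy_integrable[OF assms] in auto)

text \<open>The factor \<open>exp 1\<close> pays for \<open>\<bar>x\<bar> \<le> \<sigma>\<close>,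
  where the power may be smaller than its base.\<close>

lemma exp_power_le_laplace:
  assumes "\<beta> \<ge> 1" "\<sigma> > 0"
  shows "exp_power \<beta> \<sigma> x \<le> exp 1 * exp (- (1 / \<sigma>) * \<bar>x\<bar>)"
proof -
  define u where "u = \<bar>x\<bar> / \<sigma>"
  have u: "0 \<le> u" using assms by (simp add: u_def)
  have "u - 1 \<le> u powr \<beta>"
  proof (cases "u \<le> 1")
    case False
    then have "u powr 1 \<le> u powr \<beta>" using assms by (intro powr_mono) auto
    then show ?thesis using False by simp
  qed (use powr_ge_zero[of u \<beta>] in linarith)
  then have "exp (- (u powr \<beta>)) \<le> exp (1 - u)" by simp
  then show ?thesis by (simp add: exp_power_def u_def exp_add[symmetric])
qed

text \<open>With exponent at least 2 the tail beats every exponential rate: completing the square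
  gives \<open>c * u - c\<^sup>2 / 4 \<le> u\<^sup>2\<close>, and the 1 in the constant covers
  \<open>u \<le> 1\<close>.\<close>

lemma exp_power_le_any_laplace:
  assumes "\<beta> \<ge> 2" "\<sigma> > 0"
  shows "exp_power \<beta> \<sigma> x \<le> exp (1 + (b * \<sigma>)\<^sup>2 / 4) * exp (- b * \<bar>x\<bar>)"
proof -
  define u where "u = \<bar>x\<bar> / \<sigma>"
  define c where "c = b * \<sigma>"
  have u: "0 \<le> u" using assms by (simp add: u_def)
  have "u\<^sup>2 - 1 \<le> u powr \<beta>"
  proof (cases "u \<le> 1")
    case False
    then have "u powr 2 \<le> u powr \<beta>" using assms by (intro powr_mono) auto
    then show ?thesis using False by simp
  next
    case True
    then have "u\<^sup>2 \<le> 1" using u by (simp add: power_le_one)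
    then show ?thesis using powr_ge_zero[of u \<beta>] by linarith
  qed
  moreover have "c * u - c\<^sup>2 / 4 \<le> u\<^sup>2"
    using zero_le_power2[of "u - c / 2"] by (simp add: power2_eq_square algebra_simps)
  ultimately have "exp (- (u powr \<beta>)) \<le> exp ((1 + c\<^sup>2 / 4) + (- (c * u)))" by simp
  also have "\<dots> = exp (1 + c\<^sup>2 / 4) * exp (- (c * u))" by (rule exp_add)
  also have "c * u = b * \<bar>x\<bar>" using assms by (simp add: c_def u_def)
  finally show ?thesis by (simp add: exp_power_def u_def c_def)
qed

lemma exp_power_measurable [measurable]: "exp_power \<beta> \<sigma> \<in> borel_measurable borel"
  unfolding exp_power_def[abs_def] by measurable

lemma error_density_exp_power:
  assumes "\<beta> \<ge> 1" "\<sigma> > 0" shows "error_density (exp_power \<beta> \<sigma>)"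
proof
  fix x x' :: real
  show "0 < exp_power \<beta> \<sigma> x" by (simp add: exp_power_def)
  assume "\<bar>x\<bar> \<le> \<bar>x'\<bar>"
  then show "exp_power \<beta> \<sigma> x' \<le> exp_power \<beta> \<sigma> x"
    using assms by (auto simp: exp_power_def intro!: powr_mono2 divide_right_mono)
next
  show "integrable lborel (exp_power \<beta> \<sigma>)"
  proof (rule Bochner_Integration.integrable_bound)
    show "integrable lborel (\<lambda>x. exp 1 * exp (- (1 / \<sigma>) * \<bar>x\<bar>))"
      using laplace_integrable[of "1 / \<sigma>"] assms by simp
    show "AE x in lborel. norm (exp_power \<beta> \<sigma> x) \<le> norm (exp 1 * exp (- (1 / \<sigma>) * \<bar>x\<bar>))"
      using exp_power_le_laplace[OF assms] by (intro AE_I2) (simp add: exp_power_def)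
  qed simp
qed simp

lemma fam_dens_C: "fam_dens FamC \<sigma> = cauchy \<sigma>"
  by (rule ext) (simp add: cauchy_def)

lemma fam_dens_E:
  assumes "\<sigma> > 0" shows "fam_dens FamE \<sigma> = exp_power 1 \<sigma>"
  using assms by (intro ext) (simp add: exp_power_def)

lemma fam_dens_G:
  assumes "\<sigma> > 0" shows "fam_dens FamG \<sigma> = exp_power 2 (sqrt 2 * \<sigma>)"
proof
  fix x
  have "(\<bar>x\<bar> / (sqrt 2 * \<sigma>)) powr 2 = (x / \<sigma>)\<^sup>2 / 2"
    using assms by (simp add: power_divide power_mult_distrib)
  then show "fam_dens FamG \<sigma> x = exp_power 2 (sqrt 2 * \<sigma>) x" by (simp add: exp_power_def)
qed

lemma fam_dens_L:
  assumes "\<sigma> > 0" shows "fam_dens (FamL \<beta>) \<sigma> = exp_power \<beta> \<sigma>"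
  using assms by (intro ext) (simp add: exp_power_def abs_divide)

lemma fam_dens_light:
  assumes "\<sigma> > 0" "fam_ok f" "f = FamG \<or> is_L f"
  obtains \<beta> \<tau> where "\<beta> \<ge> 2" "\<tau> > 0" "fam_dens f \<sigma> = exp_power \<beta> \<tau>"
proof (cases f)
  case FamG
  then show thesis using that[of 2 "sqrt 2 * \<sigma>"] assms fam_dens_G by simp
next
  case (FamL \<beta>)
  then show thesis using that[of \<beta> \<sigma>] assms fam_dens_L by simp
qed (use assms in \<open>auto simp: is_L_def\<close>)

lemma fam_dens_exp_power:
  assumes "\<sigma> > 0" "fam_ok f" "f \<noteq> FamC"
  obtains \<beta> \<tau> where "\<beta> \<ge> 1" "\<tau> > 0" "fam_dens f \<sigma> = exp_power \<beta> \<tau>"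
proof (cases "f = FamE")
  case True
  then show thesis using that[of 1 \<sigma>] assms fam_dens_E by simp
next
  case False
  then have "f = FamG \<or> is_L f" using assms(3) by (cases f) (auto simp: is_L_def)
  then show thesis using fam_dens_light[OF assms(1,2)] that by (metis order.trans one_le_numeral)
qed

lemma error_density_fam_dens:
  assumes "\<sigma> > 0" "fam_ok f" shows "error_density (fam_dens f \<sigma>)"
proof (cases "f = FamC")
  case True
  then show ?thesis using error_density_cauchy[OF assms(1)] by (simp only: fam_dens_C)
next
  case False
  then show ?thesis
    using fam_dens_exp_power[OF assms] error_density_exp_power by metis
qed

section \<open>Comparison with Cauchy densities, and uniform ergodicity\<close>

lemma cauchy_rescale:
  assumes "\<sigma> > 0" "\<tau> > 0"
  shows "cauchy \<sigma> x \<le> (1 + (\<sigma> / \<tau>)\<^sup>2) * cauchy \<tau> x"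
proof -
  have "(x / \<tau>)\<^sup>2 = (\<sigma> / \<tau>)\<^sup>2 * (x / \<sigma>)\<^sup>2" using assms by (simp add: power_divide)
  then have "1 + (x / \<tau>)\<^sup>2 \<le> (1 + (\<sigma> / \<tau>)\<^sup>2) * (1 + (x / \<sigma>)\<^sup>2)"
    by (simp add: algebra_simps)
  moreover have "0 < 1 + (x / \<tau>)\<^sup>2" "0 < 1 + (x / \<sigma>)\<^sup>2" by (auto intro: add_pos_nonneg)
  ultimately show ?thesis by (simp add: cauchy_def field_simps)
qed

lemma fam_dens_le_cauchy:
  assumes "\<sigma> > 0" "fam_ok f" "\<tau> > 0"
  obtains C where "C > 0" "\<And>x. fam_dens f \<sigma> x \<le> C * cauchy \<tau> x"
proof (cases "f = FamC")
  case True
  then show thesis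
    using that[of "1 + (\<sigma> / \<tau>)\<^sup>2"] cauchy_rescale[OF assms(1,3)]
    by (simp add: fam_dens_C add_pos_nonneg del: fam_dens.simps)
next
  case False
  then obtain \<beta> \<rho> where b: "\<beta> \<ge> 1" "\<rho> > 0" and f: "fam_dens f \<sigma> = exp_power \<beta> \<rho>"
    using fam_dens_exp_power[OF assms(1,2)] by metis
  show thesis
  proof (rule that[of "exp 1 * 2 * (1 + (\<rho> / \<tau>)\<^sup>2)"])
    show "0 < exp 1 * 2 * (1 + (\<rho> / \<tau>)\<^sup>2)" by (intro mult_pos_pos add_pos_nonneg) auto
    fix x
    have "exp_power \<beta> \<rho> x \<le> exp 1 * exp (- (1 / \<rho>) * \<bar>x\<bar>)" by (rule exp_power_le_laplace[OF b])
    also have "\<dots> \<le> exp 1 * (2 * cauchy \<rho> x)"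
      using laplace_le_cauchy[of "1 / \<rho>" x] b by (intro mult_left_mono) auto
    also have "\<dots> \<le> exp 1 * (2 * ((1 + (\<rho> / \<tau>)\<^sup>2) * cauchy \<tau> x))"
      using cauchy_rescale[OF b(2) assms(3)] by (intro mult_left_mono) auto
    finally show "fam_dens f \<sigma> x \<le> exp 1 * 2 * (1 + (\<rho> / \<tau>)\<^sup>2) * cauchy \<tau> x"
      unfolding f by (simp only: mult.assoc)
  qed
qed

text \<open>Since \<open>u\<^sup>2 \<le> 2 (u - v)\<^sup>2 + 2 v\<^sup>2\<close>.\<close>

lemma cauchy_shift:
  assumes "\<sigma> > 0" shows "cauchy \<sigma> v \<le> 2 * (1 + ((u - v) / \<sigma>)\<^sup>2) * cauchy \<sigma> u"
proof -
  define a where "a = u / \<sigma>"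
  define b where "b = v / \<sigma>"
  have "0 \<le> (a - 2 * b)\<^sup>2 + 1 + 2 * (a - b)\<^sup>2 * b\<^sup>2" by simp
  then have "1 + a\<^sup>2 \<le> 2 * (1 + (a - b)\<^sup>2) * (1 + b\<^sup>2)"
    by (simp add: power2_eq_square algebra_simps)
  moreover have "0 < 1 + a\<^sup>2" "0 < 1 + b\<^sup>2" by (auto intro: add_pos_nonneg)
  ultimately have "1 / (1 + b\<^sup>2) \<le> 2 * (1 + (a - b)\<^sup>2) * (1 / (1 + a\<^sup>2))"
    by (simp add: field_simps)
  then show ?thesis by (simp add: cauchy_def a_def b_def diff_divide_distrib)
qed

text \<open>If \<open>u + v\<close> is large, one summand is comparably large, and its factor is
  already of the size of \<open>cauchy \<sigma> (u + v)\<close>. Integrated, this bounds the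
  self-convolution by a multiple of the density.\<close>

lemma cauchy_mult_le:
  "cauchy \<sigma> u * cauchy \<sigma> v \<le> 2 * cauchy \<sigma> (u + v) * (cauchy \<sigma> u + cauchy \<sigma> v)"
proof -
  define a where "a = u / \<sigma>"
  define b where "b = v / \<sigma>"
  have "0 \<le> (a - b)\<^sup>2 + 3" by simp
  then have "1 + (a + b)\<^sup>2 \<le> 2 * ((1 + a\<^sup>2) + (1 + b\<^sup>2))"
    by (simp add: power2_eq_square algebra_simps)
  moreover have "0 < 1 + a\<^sup>2" "0 < 1 + b\<^sup>2" "0 < 1 + (a + b)\<^sup>2" by (auto intro: add_pos_nonneg)
  ultimately have "1 / (1 + a\<^sup>2) * (1 / (1 + b\<^sup>2))
      \<le> 2 * (1 / (1 + (a + b)\<^sup>2)) * (1 / (1 + a\<^sup>2) + 1 / (1 + b\<^sup>2))"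
    by (simp add: divide_simps mult.commute)
  then show ?thesis by (simp add: cauchy_def a_def b_def add_divide_distrib)
qed

lemma cauchy_uniform:
  assumes "gibbs_model H (cauchy \<sigma>)" "\<sigma> > 0" and C: "C > 0" "\<And>x. H x \<le> C * cauchy \<sigma> x"
  shows "\<exists>M. gibbs_model.gibbs_rate_bound H (cauchy \<sigma>) y (\<lambda>_. M)"
proof -
  interpret gibbs_model H "cauchy \<sigma>" y by fact
  show ?thesis
  proof (rule uniform_if_marg_le)
    \<comment> \<open>One factor 2 comes from \<open>cauchy_mult_le\<close>, the other from the two
      masses.\<close>
    show "0 < 4 * C * G.mass" using C G.mass_pos by simp
    fix \<theta>
    have "marg \<theta> \<le> (\<integral>x. C * (2 * cauchy \<sigma> (y - \<theta>)) * (cauchy \<sigma> (y - x) + cauchy \<sigma> (x - \<theta>)) \<partial>lborel)"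
      unfolding marg_def
    proof (rule integral_mono[OF joint_integrable])
      show "integrable lborel (\<lambda>x. C * (2 * cauchy \<sigma> (y - \<theta>)) * (cauchy \<sigma> (y - x) + cauchy \<sigma> (x - \<theta>)))"
        using g_integrable[of \<theta>] g_integrable[of y] G.minus_commute[of y] by simp
      fix x
      have "joint \<theta> x \<le> C * (cauchy \<sigma> (y - x) * cauchy \<sigma> (x - \<theta>))"
        unfolding joint_def mult.assoc[symmetric] using C by (intro mult_right_mono) auto
      also have "\<dots> \<le> C * (2 * cauchy \<sigma> (y - \<theta>) * (cauchy \<sigma> (y - x) + cauchy \<sigma> (x - \<theta>)))"
        using cauchy_mult_le[of \<sigma> "y - x" "x - \<theta>"] C by (intro mult_left_mono) auto
      finally show "joint \<theta> x \<le> C * (2 * cauchy \<sigma> (y - \<theta>)) * (cauchy \<sigma> (y - x) + cauchy \<sigma> (x - \<theta>))"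
        by (simp add: mult.assoc)
    qed
    also have "\<dots> = C * (2 * cauchy \<sigma> (y - \<theta>)) * (G.mass + G.mass)"
    proof -
      have "(\<integral>x. cauchy \<sigma> (y - x) + cauchy \<sigma> (x - \<theta>) \<partial>lborel) = G.mass + G.mass"
        using g_integrable[of \<theta>] g_integrable[of y] by (simp add: G.minus_commute[of y] integral_g)
      then show ?thesis by simp
    qed
    finally show "marg \<theta> \<le> 4 * C * G.mass * cauchy \<sigma> (y - \<theta>)" by (simp add: algebra_simps)
  next
    show "0 < 1 / (2 * (1 + (1 / \<sigma>)\<^sup>2))" by (simp add: add_pos_nonneg)
    fix z d :: real assume d: "\<bar>d\<bar> \<le> 1"
    have p: "0 < 2 * (1 + (1 / \<sigma>)\<^sup>2)" by (simp add: add_pos_nonneg)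
    have "(d / \<sigma>)\<^sup>2 \<le> (1 / \<sigma>)\<^sup>2"
      using d by (simp add: power_divide divide_right_mono abs_square_le_1)
    then have "2 * (1 + (d / \<sigma>)\<^sup>2) * cauchy \<sigma> (z + d) \<le> 2 * (1 + (1 / \<sigma>)\<^sup>2) * cauchy \<sigma> (z + d)"
      by (intro mult_right_mono) auto
    with cauchy_shift[OF assms(2), of z "z + d"]
    have "cauchy \<sigma> z \<le> 2 * (1 + (1 / \<sigma>)\<^sup>2) * cauchy \<sigma> (z + d)" by simp
    with p show "1 / (2 * (1 + (1 / \<sigma>)\<^sup>2)) * cauchy \<sigma> z \<le> cauchy \<sigma> (z + d)"
      by (simp add: pos_divide_le_eq mult.commute)
  qed
qed

text \<open>The triangle inequality trades \<open>g (x - \<theta>)\<close> for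
  \<open>g (y - \<theta>)\<close> at the cost of \<open>exp (\<bar>y - x\<bar> / \<sigma>)\<close>.
  The strictly faster decay of \<open>H\<close> absorbs this growth and leaves an integrable factor
  of rate \<open>b - 1 / \<sigma>\<close>; for two Laplace errors this is the strict ordering of the
  scales.\<close>

lemma laplace_uniform:
  assumes "gibbs_model H (exp_power 1 \<sigma>)" "\<sigma> > 0"
    and C: "C > 0" "b > 1 / \<sigma>" "\<And>x. H x \<le> C * exp (- b * \<bar>x\<bar>)"
  shows "\<exists>M. gibbs_model.gibbs_rate_bound H (exp_power 1 \<sigma>) y (\<lambda>_. M)"
proof -
  interpret gibbs_model H "exp_power 1 \<sigma>" y by fact
  have g: "exp_power 1 \<sigma> x = exp (- (1 / \<sigma>) * \<bar>x\<bar>)" for x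
    using assms(2) by (simp add: exp_power_def)
  define a where "a = b - 1 / \<sigma>"
  have a: "a > 0" using C by (simp add: a_def)
  define J where "J = (\<integral>x. exp (- a * \<bar>x\<bar>) \<partial>lborel)"
  have J: "J > 0" unfolding J_def using laplace_integrable[OF a] by (rule lborel_integral_pos) simp
  show ?thesis
  proof (rule uniform_if_marg_le)
    show "0 < C * J" using C J by simp
    fix \<theta>
    have "marg \<theta> \<le> (\<integral>x. C * exp_power 1 \<sigma> (y - \<theta>) * exp (- a * \<bar>y - x\<bar>) \<partial>lborel)"
      unfolding marg_def
    proof (rule integral_mono[OF joint_integrable])
      show "integrable lborel (\<lambda>x. C * exp_power 1 \<sigma> (y - \<theta>) * exp (- a * \<bar>y - x\<bar>))"
        using lborel_integrable_real_affine[OF laplace_integrable[OF a], of "-1" y] by simp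
      fix x
      have "\<bar>y - \<theta>\<bar> - \<bar>y - x\<bar> \<le> \<bar>x - \<theta>\<bar>" by arith
      then have "(1 / \<sigma>) * (\<bar>y - \<theta>\<bar> - \<bar>y - x\<bar>) \<le> (1 / \<sigma>) * \<bar>x - \<theta>\<bar>"
        using assms(2) by (intro mult_left_mono) auto
      then have "exp_power 1 \<sigma> (x - \<theta>) \<le> exp (- (1 / \<sigma>) * \<bar>y - \<theta>\<bar> + (1 / \<sigma>) * \<bar>y - x\<bar>)"
        unfolding g by (simp add: algebra_simps)
      then have "joint \<theta> x \<le> (C * exp (- b * \<bar>y - x\<bar>)) * exp (- (1 / \<sigma>) * \<bar>y - \<theta>\<bar> + (1 / \<sigma>) * \<bar>y - x\<bar>)"
        unfolding joint_def using C by (intro mult_mono) auto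
      also have "\<dots> = C * exp_power 1 \<sigma> (y - \<theta>) * exp (- a * \<bar>y - x\<bar>)"
        by (simp add: g a_def exp_add[symmetric] algebra_simps)
      finally show "joint \<theta> x \<le> C * exp_power 1 \<sigma> (y - \<theta>) * exp (- a * \<bar>y - x\<bar>)" .
    qed
    also have "\<dots> = C * exp_power 1 \<sigma> (y - \<theta>) * J"
      using integral_lborel_reflect[of "\<lambda>x. exp (- a * \<bar>x\<bar>)" y] by (simp add: J_def)
    finally show "marg \<theta> \<le> C * J * exp_power 1 \<sigma> (y - \<theta>)" by (simp add: mult_ac)
  next
    show "0 < exp (- (1 / \<sigma>))" by simp
    fix z d :: real assume "\<bar>d\<bar> \<le> 1"
    then have "\<bar>z + d\<bar> \<le> 1 + \<bar>z\<bar>" by arith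
    then have "(1 / \<sigma>) * \<bar>z + d\<bar> \<le> (1 / \<sigma>) * (1 + \<bar>z\<bar>)"
      using assms(2) by (intro mult_left_mono) auto
    then show "exp (- (1 / \<sigma>)) * exp_power 1 \<sigma> z \<le> exp_power 1 \<sigma> (z + d)"
      unfolding g exp_add[symmetric] by (simp add: algebra_simps)
  qed
qed

section \<open>Cauchy observation errors\<close>

lemma tv_dist_upper:
  assumes "prob_space M" "prob_space N" "A \<in> sets borel"
  shows "\<bar>measure M A - measure N A\<bar> \<le> tv_dist M N"
  unfolding tv_dist_def
proof (rule cSUP_upper[OF assms(3)], rule bdd_aboveI2)
  fix B
  have "0 \<le> measure M B" "measure M B \<le> 1" "0 \<le> measure N B" "measure N B \<le> 1"
    using assms by (auto simp: prob_space.prob_le_1)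
  then show "\<bar>measure M B - measure N B\<bar> \<le> 1" by linarith
qed

lemma (in gibbs_model) prob_space_post: "prob_space (density lborel (\<lambda>t. ennreal (post t)))"
  by (rule prob_spaceI) (simp add: emeasure_density post_mass)

text \<open>With non-negative integrals no integrability along the chain has to be carried through
  the induction.\<close>

lemma (in markov_density) chain_exp_moment:
  assumes [measurable]: "w \<in> borel_measurable borel"
    and w: "\<And>x. (\<integral>\<^sup>+t. ennreal (w t) * ennreal (k x t) \<partial>lborel) \<le> ennreal (C * w x)" and C: "0 \<le> C"
    and w_nonneg: "\<And>x. 0 \<le> w x"
  shows "(\<integral>\<^sup>+t. ennreal (w t) \<partial>chain_law K n \<theta>) \<le> ennreal (C ^ n * w \<theta>)"
proof (induction n)
  case 0
  show ?case by (simp add: nn_integral_return)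
next
  case (Suc n)
  have "(\<integral>\<^sup>+t. ennreal (w t) \<partial>chain_law K (Suc n) \<theta>)
      = (\<integral>\<^sup>+x. (\<integral>\<^sup>+t. ennreal (w t) \<partial>K x) \<partial>chain_law K n \<theta>)"
    unfolding chain_law.simps by (rule nn_integral_bind[where B=borel]) (auto intro: K_kernel_chain)
  also have "\<dots> = (\<integral>\<^sup>+x. (\<integral>\<^sup>+t. ennreal (w t) * ennreal (k x t) \<partial>lborel) \<partial>chain_law K n \<theta>)"
    by (simp add: K_def nn_integral_density mult.commute)
  also have "\<dots> \<le> (\<integral>\<^sup>+x. ennreal C * ennreal (w x) \<partial>chain_law K n \<theta>)"
    using w C w_nonneg by (intro nn_integral_mono) (simp add: ennreal_mult)
  also have "\<dots> = ennreal C * (\<integral>\<^sup>+x. ennreal (w x) \<partial>chain_law K n \<theta>)"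
    by (rule nn_integral_cmult) (simp cong: measurable_cong_sets)
  also have "\<dots> \<le> ennreal C * ennreal (C ^ n * w \<theta>)"
    by (intro mult_left_mono Suc) simp
  finally show ?case using C w_nonneg by (simp add: ennreal_mult[symmetric] mult.assoc)
qed

text \<open>The posterior has polynomial tails, but in \<open>n\<close> steps the chain only moves a distance of order
  \<open>n\<close>, up to exponentially small probability, because the exponential moment grows at
  most geometrically.\<close>

lemma cauchy_not_geometric:
  assumes "gibbs_model (cauchy \<sigma>) g" and \<sigma>: "\<sigma> > 0" and a: "a > 0"
    and g_le: "\<And>z. g z \<le> B * exp (- a * \<bar>z\<bar>)"
  shows "\<not> gibbs_model.gibbs_rate_bound (cauchy \<sigma>) g y M"
proof
  interpret gibbs_model "cauchy \<sigma>" g y by fact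
  assume "gibbs_rate_bound M"
  then obtain r where r: "0 \<le> r" "r < 1" and
    bound: "\<And>\<theta> n. tv_dist (chain_law K n \<theta>) (density lborel (\<lambda>t. ennreal (post t))) \<le> M \<theta> * r ^ n"
    unfolding gibbs_rate_bound_def by blast
  have B: "B > 0" using g_le[of 0] G.pos[of 0] by simp
  \<comment> \<open>A quarter of the rate: one factor \<open>exp (s * \<bar>z\<bar>)\<close> is the
    weight, a second absorbs the quadratic factor of \<open>q\<close>, and decay at rate
    \<open>a / 2\<close> remains.\<close>
  define s where "s = a / 4"
  have s: "s > 0" using a by (simp add: s_def)
  \<comment> \<open>An integrable majorant for one increment z: \<open>g\<close> times the
    exponential weight times the quadratic loss of \<open>cauchy_shift\<close>.\<close>
  define q where "q = (\<lambda>z. (1 + (z / \<sigma>)\<^sup>2) * (exp (s * \<bar>z\<bar>) * g z))"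
  have [measurable]: "q \<in> borel_measurable borel" unfolding q_def by measurable
  have q_nonneg: "0 \<le> q z" for z by (simp add: q_def)
  define D where "D = 1 + 2 / (s * \<sigma>)\<^sup>2"
  have D: "0 < D" using s \<sigma> by (simp add: D_def add_pos_nonneg)
  have q_le: "q z \<le> D * B * exp (- (a / 2) * \<bar>z\<bar>)" for z
  proof -
    have e: "1 + s * \<bar>z\<bar> + (s * \<bar>z\<bar>)\<^sup>2 / 2 \<le> exp (s * \<bar>z\<bar>)"
      using s by (intro exp_lower_Taylor_quadratic) auto
    have e1: "1 \<le> exp (s * \<bar>z\<bar>)" using s by simp
    have "(s * \<bar>z\<bar>)\<^sup>2 \<le> 2 * exp (s * \<bar>z\<bar>)" using e s mult_nonneg_nonneg[of s "\<bar>z\<bar>"] by linarith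
    then have "(s * \<bar>z\<bar>)\<^sup>2 / (s * \<sigma>)\<^sup>2 \<le> 2 * exp (s * \<bar>z\<bar>) / (s * \<sigma>)\<^sup>2"
      by (rule divide_right_mono) simp
    also have "(s * \<bar>z\<bar>)\<^sup>2 / (s * \<sigma>)\<^sup>2 = (z / \<sigma>)\<^sup>2"
      using s by (simp add: power_mult_distrib power_divide)
    finally have "1 + (z / \<sigma>)\<^sup>2 \<le> exp (s * \<bar>z\<bar>) + 2 * exp (s * \<bar>z\<bar>) / (s * \<sigma>)\<^sup>2"
      using e1 by linarith
    also have "\<dots> = D * exp (s * \<bar>z\<bar>)"
      by (simp add: D_def distrib_right)
    finally have "1 + (z / \<sigma>)\<^sup>2 \<le> D * exp (s * \<bar>z\<bar>)" .
    then have "q z \<le> (D * exp (s * \<bar>z\<bar>)) * (exp (s * \<bar>z\<bar>) * (B * exp (- a * \<bar>z\<bar>)))"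
      unfolding q_def using D by (intro mult_mono g_le) auto
    also have "\<dots> = D * B * (exp (s * \<bar>z\<bar>) * exp (s * \<bar>z\<bar>) * exp (- a * \<bar>z\<bar>))" by (simp add: mult_ac)
    also have "exp (s * \<bar>z\<bar>) * exp (s * \<bar>z\<bar>) * exp (- a * \<bar>z\<bar>) = exp (- (a / 2) * \<bar>z\<bar>)"
      unfolding exp_add[symmetric] by (simp add: s_def)
    finally show ?thesis .
  qed
  have q_int: "integrable lborel q"
  proof (rule Bochner_Integration.integrable_bound)
    show "integrable lborel (\<lambda>z. D * B * exp (- (a / 2) * \<bar>z\<bar>))"
      using laplace_integrable[of "a / 2"] a by simp
    show "AE z in lborel. norm (q z) \<le> norm (D * B * exp (- (a / 2) * \<bar>z\<bar>))"
      using q_le q_nonneg D B by (intro AE_I2) (simp add: abs_of_nonneg)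
  qed simp
  define J where "J = (\<integral>z. q z \<partial>lborel)"
  have nn_q: "(\<integral>\<^sup>+z. ennreal (q z) \<partial>lborel) = ennreal J"
    unfolding J_def using q_nonneg by (intro nn_integral_eq_integral[OF q_int]) auto
  have J: "0 < J"
    unfolding J_def using q_int G.pos by (intro lborel_integral_pos) (auto simp: q_def intro!: mult_pos_pos add_pos_nonneg)
  define c where "c = g 1 / (2 * (1 + (1 / \<sigma>)\<^sup>2))"
  have pp: "0 < 2 * (1 + (1 / \<sigma>)\<^sup>2)" by (simp add: add_pos_nonneg)
  have c: "c > 0" using pp G.pos by (simp add: c_def)
  \<comment> \<open>Draws x between \<theta> and \<theta> + 1 already give \<open>marg\<close> a
    Cauchy tail; \<open>c\<close> collects \<open>g 1\<close> and the loss of a unit shift.\<close>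
  have marg_ge: "c * cauchy \<sigma> (y - \<theta>) \<le> marg \<theta>" for \<theta>
  proof -
    have "c * cauchy \<sigma> (y - \<theta>) = (\<integral>x. c * cauchy \<sigma> (y - \<theta>) * indicator {\<theta>..\<theta>+1} x \<partial>lborel)" by simp
    also have "\<dots> \<le> marg \<theta>"
      unfolding marg_def
    proof (rule integral_mono[OF _ joint_integrable])
      fix x
      show "c * cauchy \<sigma> (y - \<theta>) * indicator {\<theta>..\<theta>+1} x \<le> joint \<theta> x"
      proof (cases "x \<in> {\<theta>..\<theta>+1}")
        case True
        then have "((x - \<theta>) / \<sigma>)\<^sup>2 \<le> (1 / \<sigma>)\<^sup>2"
          by (simp add: power_divide divide_right_mono abs_square_le_1)
        then have "2 * (1 + ((x - \<theta>) / \<sigma>)\<^sup>2) * cauchy \<sigma> (y - x) \<le> 2 * (1 + (1 / \<sigma>)\<^sup>2) * cauchy \<sigma> (y - x)"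
          by (intro mult_right_mono) auto
        moreover have "cauchy \<sigma> (y - \<theta>) \<le> 2 * (1 + ((x - \<theta>) / \<sigma>)\<^sup>2) * cauchy \<sigma> (y - x)"
          using cauchy_shift[OF \<sigma>, of "y - \<theta>" "y - x"] by (simp add: power_divide power2_commute)
        ultimately have "cauchy \<sigma> (y - \<theta>) / (2 * (1 + (1 / \<sigma>)\<^sup>2)) \<le> cauchy \<sigma> (y - x)"
          using pp by (simp add: pos_divide_le_eq mult.commute)
        moreover have "g 1 \<le> g (x - \<theta>)" using True by (intro G.antimono) auto
        ultimately have "cauchy \<sigma> (y - \<theta>) / (2 * (1 + (1 / \<sigma>)\<^sup>2)) * g 1 \<le> joint \<theta> x"
          unfolding joint_def by (intro mult_mono) auto
        then show ?thesis using True by (simp add: c_def mult.commute)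
      qed simp
    qed auto
    finally show ?thesis .
  qed
  define w where "w = (\<lambda>t::real. exp (s * \<bar>t\<bar>))"
  have w_meas [measurable]: "w \<in> borel_measurable borel" unfolding w_def by measurable
  have w_add: "w (u + v) \<le> w u * w v" for u v
  proof -
    have "s * \<bar>u + v\<bar> \<le> s * (\<bar>u\<bar> + \<bar>v\<bar>)" using s by (intro mult_left_mono) auto
    then show ?thesis by (simp add: w_def exp_add[symmetric] algebra_simps)
  qed
  have w_nonneg [simp]: "0 \<le> w t" for t by (simp add: w_def)
  have wg_le_q: "w z * g z \<le> q z" for z
    unfolding q_def w_def by (rule mult_left_le_imp_le[of 1]) (auto simp: algebra_simps)
  \<comment> \<open>\<open>J / G.mass\<close> bounds the weight gained in the draw of \<theta>,
    \<open>2 * J / c\<close> that gained in the draw of X.\<close>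
  define C where "C = (J / G.mass) * (2 * J / c)"
  have C: "0 < C" using J G.mass_pos c by (simp add: C_def)
  have inner: "(\<integral>\<^sup>+t. ennreal (w t) * ennreal (g (x - t) / G.mass) \<partial>lborel) \<le> ennreal (w x * (J / G.mass))" for x
  proof -
    have "(\<integral>\<^sup>+t. ennreal (w t) * ennreal (g (x - t) / G.mass) \<partial>lborel)
        \<le> (\<integral>\<^sup>+t. ennreal (w x / G.mass) * ennreal (q (x - t)) \<partial>lborel)"
    proof (rule nn_integral_mono)
      fix t
      have "w t * g (x - t) \<le> w x * w (x - t) * g (x - t)"
        using w_add[of x "t - x"] by (intro mult_right_mono) (auto simp: w_def abs_minus_commute)
      also have "\<dots> \<le> w x * q (x - t)"
        unfolding mult.assoc by (intro mult_left_mono wg_le_q) auto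
      finally have "w t * (g (x - t) / G.mass) \<le> w x / G.mass * q (x - t)"
        using G.mass_pos by (simp add: divide_right_mono)
      then show "ennreal (w t) * ennreal (g (x - t) / G.mass) \<le> ennreal (w x / G.mass) * ennreal (q (x - t))"
        using G.mass_pos q_nonneg by (simp add: ennreal_mult[symmetric] ennreal_leI)
    qed
    also have "\<dots> = ennreal (w x / G.mass) * (\<integral>\<^sup>+t. ennreal (q t) \<partial>lborel)"
      using nn_integral_lborel_reflect[of "\<lambda>t. ennreal (q t)" x] by (simp add: nn_integral_cmult)
    also have "\<dots> = ennreal (w x * (J / G.mass))"
      using J G.mass_pos by (simp add: nn_q ennreal_mult[symmetric])
    finally show ?thesis .
  qed
  \<comment> \<open>In the ratio of \<open>cauchy \<sigma> (y - x)\<close> to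
    \<open>marg \<theta>\<close> the Cauchy tails cancel up to a factor quadratic in
    \<open>x - \<theta>\<close>, which \<open>q\<close> absorbs; hence a bound uniform in
    \<theta>.\<close>
  have step: "(\<integral>\<^sup>+t. ennreal (w t) * ennreal (k \<theta> t) \<partial>lborel) \<le> ennreal (C * w \<theta>)" for \<theta>
  proof -
    have "(\<integral>\<^sup>+t. ennreal (w t) * ennreal (k \<theta> t) \<partial>lborel)
        \<le> (\<integral>\<^sup>+x. ennreal (joint \<theta> x / marg \<theta>) * ennreal (w x * (J / G.mass)) \<partial>lborel)"
      unfolding nn_integral_k[OF measurable_compose[OF w_meas measurable_ennreal]]
      by (intro nn_integral_mono mult_left_mono inner) simp
    also have "\<dots> \<le> (\<integral>\<^sup>+x. ennreal ((J / G.mass) * (2 / c) * w \<theta>) * ennreal (q (\<theta> - x)) \<partial>lborel)"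
    proof (rule nn_integral_mono)
      fix x
      have "cauchy \<sigma> (y - x) \<le> 2 * (1 + ((x - \<theta>) / \<sigma>)\<^sup>2) * cauchy \<sigma> (y - \<theta>)"
        using cauchy_shift[OF \<sigma>, of "y - x" "y - \<theta>"] by simp
      also have "cauchy \<sigma> (y - \<theta>) \<le> marg \<theta> / c"
        using marg_ge[of \<theta>] c by (simp add: pos_le_divide_eq mult.commute)
      finally have 1: "cauchy \<sigma> (y - x) \<le> 2 * (1 + ((x - \<theta>) / \<sigma>)\<^sup>2) * (marg \<theta> / c)"
        by (simp add: mult_left_mono)
      have 2: "w x \<le> w \<theta> * w (x - \<theta>)" using w_add[of \<theta> "x - \<theta>"] by simp
      have "joint \<theta> x * w x \<le> (2 * (1 + ((x - \<theta>) / \<sigma>)\<^sup>2) * (marg \<theta> / c)) * g (x - \<theta>) * (w \<theta> * w (x - \<theta>))"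
        unfolding joint_def using 1 2 c marg_pos[of \<theta>] by (intro mult_mono) auto
      also have "\<dots> = marg \<theta> * ((2 / c) * w \<theta> * q (\<theta> - x))"
        by (simp add: q_def w_def G.minus_commute[of x] abs_minus_commute[of x] power_divide power2_commute[of x] mult_ac)
      finally have "joint \<theta> x * w x / marg \<theta> \<le> (2 / c) * w \<theta> * q (\<theta> - x)"
        using marg_pos[of \<theta>] by (simp add: pos_divide_le_eq mult.commute)
      then have "(J / G.mass) * (joint \<theta> x * w x / marg \<theta>) \<le> (J / G.mass) * ((2 / c) * w \<theta> * q (\<theta> - x))"
        using J G.mass_pos by (intro mult_left_mono) auto
      then show "ennreal (joint \<theta> x / marg \<theta>) * ennreal (w x * (J / G.mass))
          \<le> ennreal ((J / G.mass) * (2 / c) * w \<theta>) * ennreal (q (\<theta> - x))"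
        using J G.mass_pos q_nonneg marg_pos[of \<theta>] c
        by (simp add: ennreal_mult[symmetric] less_imp_le mult_ac ennreal_leI)
    qed
    also have "\<dots> = ennreal ((J / G.mass) * (2 / c) * w \<theta>) * ennreal J"
      using nn_integral_lborel_reflect[of "\<lambda>t. ennreal (q t)" \<theta>] by (simp add: nn_integral_cmult nn_q)
    also have "\<dots> = ennreal (C * w \<theta>)"
      using J G.mass_pos c by (simp add: ennreal_mult[symmetric] C_def mult_ac)
    finally show ?thesis .
  qed
  \<comment> \<open>\<open>L\<close> is a speed: Markov's inequality at radius \<open>n * L\<close>
    gains \<open>exp (- s * L)\<close> per step, which leaves at most 1/2 of the growth factor
    \<open>C\<close>.\<close>
  define L where "L = max 1 (ln (2 * C) / s)"
  have L: "1 \<le> L" "C * exp (- s * L) \<le> 1 / 2"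
  proof -
    have "ln (2 * C) \<le> s * L" using s by (simp add: L_def max_def field_simps)
    then have "exp (ln (2 * C)) \<le> exp (s * L)" by simp
    then have "2 * C \<le> exp (s * L)" using C by simp
    then show "C * exp (- s * L) \<le> 1 / 2" by (simp add: exp_minus field_simps)
  qed (simp add: L_def)
  have chain_tail: "measure (chain_law K n 0) {t. real n * L \<le> \<bar>t\<bar>} \<le> (1 / 2) ^ n" for n
  proof -
    interpret ch: prob_space "chain_law K n 0" by (rule prob_space_chain)
    define A where "A = {t::real. real n * L \<le> \<bar>t\<bar>}"
    have A [measurable]: "A \<in> sets borel" unfolding A_def by measurable
    have "ennreal (exp (s * (n * L))) * emeasure (chain_law K n 0) A
        = (\<integral>\<^sup>+t. ennreal (exp (s * (n * L))) * indicator A t \<partial>chain_law K n 0)"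
      by (simp add: nn_integral_cmult_indicator)
    also have "\<dots> \<le> (\<integral>\<^sup>+t. ennreal (w t) \<partial>chain_law K n 0)"
      using s by (intro nn_integral_mono) (auto simp: A_def w_def indicator_def intro!: ennreal_leI)
    also have "\<dots> \<le> ennreal (C ^ n * w 0)"
      using C by (intro chain_exp_moment step) auto
    finally have "exp (s * (n * L)) * measure (chain_law K n 0) A \<le> C ^ n"
      using C by (simp add: ch.emeasure_eq_measure ennreal_mult[symmetric] w_def)
    then have "measure (chain_law K n 0) A \<le> C ^ n * exp (- (s * (n * L)))"
      by (simp add: exp_minus field_simps)
    also have "\<dots> = (C * exp (- s * L)) ^ n"
      by (simp add: power_mult_distrib exp_of_nat_mult[symmetric] mult_ac)
    also have "\<dots> \<le> (1 / 2) ^ n" using L C by (intro power_mono) auto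
    finally show ?thesis by (simp add: A_def)
  qed
  define c1 where "c1 = c / (H.mass * G.mass)"
  have c1: "c1 > 0" using c H.mass_pos G.mass_pos by (simp add: c1_def)
  \<comment> \<open>For \<open>\<bar>t\<bar> \<le> 2 * n * L\<close> the Cauchy denominator at
    \<open>y - t\<close> is at most \<open>E * n\<^sup>2\<close>, so an interval of length
    \<open>n * L\<close> carries posterior mass of order \<open>1 / n\<close>.\<close>
  define E where "E = 1 + ((\<bar>y\<bar> + 2 * L) / \<sigma>)\<^sup>2"
  have E: "E > 0" by (simp add: E_def add_pos_nonneg)
  have post_tail: "c1 * L / (E * n) \<le> measure (density lborel (\<lambda>t. ennreal (post t))) {t. real n * L \<le> \<bar>t\<bar>}"
    if n: "n \<ge> 1" for n :: nat
  proof -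
    interpret po: prob_space "density lborel (\<lambda>t. ennreal (post t))" by (rule prob_space_post)
    define A where "A = {t::real. real n * L \<le> \<bar>t\<bar>}"
    have A [measurable]: "A \<in> sets borel" unfolding A_def by measurable
    define m where "m = c1 * (1 / (E * (real n)\<^sup>2))"
    have m: "0 \<le> m" using c1 E by (simp add: m_def)
    have post_ge: "m \<le> post t" if t: "t \<in> {n * L..2 * n * L}" for t
    proof -
      have nL: "0 \<le> n * L" using L by simp
      have "\<bar>y - t\<bar> \<le> \<bar>y\<bar> + 2 * n * L" using t nL by auto
      also have "\<dots> \<le> n * (\<bar>y\<bar> + 2 * L)"
        using n mult_right_mono[of 1 "real n" "\<bar>y\<bar>"] by (simp add: algebra_simps)
      finally have "\<bar>y - t\<bar> \<le> \<bar>n * (\<bar>y\<bar> + 2 * L)\<bar>" by linarith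
      then have "cauchy \<sigma> (n * (\<bar>y\<bar> + 2 * L)) \<le> cauchy \<sigma> (y - t)" by (rule H.antimono)
      moreover have "1 / (E * (real n)\<^sup>2) \<le> cauchy \<sigma> (n * (\<bar>y\<bar> + 2 * L))"
      proof -
        have "1 \<le> (real n)\<^sup>2" using n by simp
        then have "1 + (n * (\<bar>y\<bar> + 2 * L) / \<sigma>)\<^sup>2 \<le> E * (real n)\<^sup>2"
          unfolding E_def times_divide_eq_right[symmetric] power_mult_distrib distrib_right
          by (simp add: mult.commute)
        moreover have "0 < 1 + (n * (\<bar>y\<bar> + 2 * L) / \<sigma>)\<^sup>2" by (simp add: add_pos_nonneg)
        ultimately show ?thesis using E n unfolding cauchy_def by (intro divide_left_mono) auto
      qed
      ultimately have "m \<le> c1 * cauchy \<sigma> (y - t)"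
        unfolding m_def using c1 by (intro mult_left_mono) auto
      also have "\<dots> \<le> post t"
        using marg_ge[of t] H.mass_pos G.mass_pos by (simp add: c1_def post_def divide_right_mono)
      finally show ?thesis .
    qed
    have "ennreal (m * (n * L)) = (\<integral>\<^sup>+t. ennreal m * indicator {n * L..2 * n * L} t \<partial>lborel)"
      using L m by (simp add: nn_integral_cmult_indicator ennreal_mult[symmetric] algebra_simps)
    also have "\<dots> \<le> (\<integral>\<^sup>+t. ennreal (post t) * indicator A t \<partial>lborel)"
      using post_ge L by (intro nn_integral_mono) (auto simp: A_def indicator_def ennreal_leI)
    also have "\<dots> = emeasure (density lborel (\<lambda>t. ennreal (post t))) A"
      by (simp add: emeasure_density)
    finally have "m * (n * L) \<le> measure (density lborel (\<lambda>t. ennreal (post t))) A"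
      by (simp add: po.emeasure_eq_measure)
    moreover have "m * (n * L) = c1 * L / (E * n)"
      using n E by (simp add: m_def power2_eq_square field_simps)
    ultimately show ?thesis by (simp add: A_def)
  qed
  \<comment> \<open>Multiplication by n makes the polynomial tail a positive constant, whereas both
    geometric terms still tend to 0.\<close>
  have main: "c1 * L / E \<le> real n * (1 / 2) ^ n + M 0 * (real n * r ^ n)" if n: "n \<ge> 1" for n
  proof -
    have "c1 * L / (E * n) - (1 / 2) ^ n
        \<le> measure (density lborel (\<lambda>t. ennreal (post t))) {t. real n * L \<le> \<bar>t\<bar>}
          - measure (chain_law K n 0) {t. real n * L \<le> \<bar>t\<bar>}"
      using post_tail[OF n] chain_tail[of n] by linarith
    also have "\<dots> \<le> tv_dist (chain_law K n 0) (density lborel (\<lambda>t. ennreal (post t)))"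
      using tv_dist_upper[OF prob_space_chain prob_space_post, of "{t. real n * L \<le> \<bar>t\<bar>}" n 0] by auto
    also have "\<dots> \<le> M 0 * r ^ n" by (rule bound)
    finally have "real n * (c1 * L / (E * n)) \<le> real n * ((1 / 2) ^ n + M 0 * r ^ n)"
      by (intro mult_left_mono) auto
    then show ?thesis using n E by (simp add: algebra_simps)
  qed
  have "(\<lambda>n. real n * (1 / 2) ^ n + M 0 * (real n * r ^ n)) \<longlonglongrightarrow> 0 + M 0 * 0"
    using r by (intro tendsto_intros powser_times_n_limit_0) auto
  then have "c1 * L / E \<le> 0 + M 0 * 0"
    using main by (intro LIMSEQ_le_const) auto
  moreover have "0 < c1 * L / E" using c1 L E by simp
  ultimately show False by simp
qed

section \<open>Exponential drift\<close>

text \<open>The observation is moved to the origin. In \<open>H_decay\<close> the points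
  \<open>u + v\<close> and \<open>u - v\<close> lie \<open>2 * v\<close> apart, so \<open>a\<close>
  is an exponential rate of decay; \<open>v \<le> u\<close> keeps the inner point
  non-negative.\<close>

locale drift_model = H: error_density H + G: error_density g for H g +
  fixes a b \<theta>0 :: real
  assumes a_pos: "0 < a" and b_pos: "0 < b"
    and H_decay: "\<And>u v. 0 \<le> v \<Longrightarrow> v \<le> u \<Longrightarrow> \<theta>0 \<le> u \<Longrightarrow> H (u + v) \<le> exp (- 2 * a * v) * H (u - v)"
    and H_exp: "integrable lborel (\<lambda>x. exp (b * \<bar>x\<bar>) * H x)"
begin

definition conv :: "real \<Rightarrow> real" where
  "conv \<theta> = (\<integral>x. H x * g (x - \<theta>) \<partial>lborel)"

definition tilt :: "real \<Rightarrow> real \<Rightarrow> real" where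
  "tilt s \<theta> = (\<integral>x. exp (s * x) * (H x * g (x - \<theta>)) \<partial>lborel)"

lemma H_tilt_integrable:
  assumes "\<bar>s\<bar> \<le> b"
  shows "integrable lborel (\<lambda>x. exp (s * \<bar>x\<bar>) * H x)"
proof (rule Bochner_Integration.integrable_bound[OF H_exp])
  show "AE x in lborel. norm (exp (s * \<bar>x\<bar>) * H x) \<le> norm (exp (b * \<bar>x\<bar>) * H x)"
    using assms by (intro AE_I2) (auto simp: abs_mult intro!: mult_right_mono)
qed simp

lemma tilt_integrable:
  assumes "\<bar>s\<bar> \<le> b"
  shows "integrable lborel (\<lambda>x. exp (s * x) * (H x * g (x - \<theta>)))"
proof (rule Bochner_Integration.integrable_bound)
  show "integrable lborel (\<lambda>x. g 0 * (exp (\<bar>s\<bar> * \<bar>x\<bar>) * H x))"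
    using H_tilt_integrable[of "\<bar>s\<bar>"] assms by simp
  have "exp (s * x) * (H x * g (x - \<theta>)) \<le> g 0 * (exp (\<bar>s\<bar> * \<bar>x\<bar>) * H x)" for x
  proof -
    have "s * x \<le> \<bar>s\<bar> * \<bar>x\<bar>" by (metis abs_ge_self abs_mult)
    then have "exp (s * x) * (H x * g (x - \<theta>)) \<le> exp (\<bar>s\<bar> * \<bar>x\<bar>) * (H x * g 0)"
      using G.le_max by (intro mult_mono) auto
    then show ?thesis by (simp add: mult_ac)
  qed
  then show "AE x in lborel. norm (exp (s * x) * (H x * g (x - \<theta>))) \<le> norm (g 0 * (exp (\<bar>s\<bar> * \<bar>x\<bar>) * H x))"
    by (intro AE_I2) (simp add: abs_mult)
qed simp

lemma conv_integrable: "integrable lborel (\<lambda>x. H x * g (x - \<theta>))"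
  using tilt_integrable[of 0 \<theta>] b_pos by simp

lemma conv_pos: "0 < conv \<theta>"
  unfolding conv_def using conv_integrable by (rule lborel_integral_pos) (simp add: H.pos G.pos)

definition pair :: "real \<Rightarrow> real \<Rightarrow> real" where
  "pair \<theta> z = H (\<theta> + z) + H (\<theta> - z)"

text \<open>The weights are \<open>exp (s * (x - \<theta>))\<close> at the two points, relative to
  the current value \<open>exp (s * \<theta>)\<close>: drift towards the origin means
  \<open>tpair\<close> below \<open>pair\<close>.\<close>

definition tpair :: "real \<Rightarrow> real \<Rightarrow> real \<Rightarrow> real" where
  "tpair s \<theta> z = exp (s * z) * H (\<theta> + z) + exp (- (s * z)) * H (\<theta> - z)"

lemma pair_measurable [measurable]: "pair \<theta> \<in> borel_measurable borel"
  unfolding pair_def by measurable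

lemma tpair_measurable [measurable]: "tpair s \<theta> \<in> borel_measurable borel"
  unfolding tpair_def by measurable

lemma pair_pos: "0 < pair \<theta> z"
  by (simp add: pair_def H.pos add_pos_pos)

lemma pair_abs: "pair \<theta> \<bar>z\<bar> = pair \<theta> z"
  by (auto simp: pair_def abs_if)

lemma tpair_abs: "tpair s \<theta> \<bar>z\<bar> = tpair s \<theta> z"
  by (auto simp: tpair_def abs_if)

text \<open>The factor 2 arises because each point x is met at z and at -z.\<close>

lemma g_pair_integral:
  shows "integrable lborel (\<lambda>z. g z * pair \<theta> z)"
    and "(\<integral>z. g z * pair \<theta> z \<partial>lborel) = 2 * conv \<theta>"
proof -
  have 1: "integrable lborel (\<lambda>z. H (\<theta> + z) * g z)" "(\<integral>z. H (\<theta> + z) * g z \<partial>lborel) = conv \<theta>"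
    using lborel_integrable_real_affine[OF conv_integrable[of \<theta>], of 1 \<theta>]
      lborel_integral_real_affine[of 1 "\<lambda>x. H x * g (x - \<theta>)" \<theta>] by (auto simp: conv_def)
  have 2: "integrable lborel (\<lambda>z. H (\<theta> - z) * g z)" "(\<integral>z. H (\<theta> - z) * g z \<partial>lborel) = conv \<theta>"
    using lborel_integrable_real_affine[OF conv_integrable[of \<theta>], of "-1" \<theta>]
      lborel_integral_real_affine[of "-1" "\<lambda>x. H x * g (x - \<theta>)" \<theta>] by (auto simp: conv_def G.even)
  have e: "(\<lambda>z. g z * pair \<theta> z) = (\<lambda>z. H (\<theta> + z) * g z + H (\<theta> - z) * g z)"
    by (auto simp: pair_def algebra_simps)
  show "integrable lborel (\<lambda>z. g z * pair \<theta> z)" "(\<integral>z. g z * pair \<theta> z \<partial>lborel) = 2 * conv \<theta>"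
    unfolding e using 1 2 by auto
qed

lemma g_tpair_integral:
  assumes "\<bar>s\<bar> \<le> b"
  shows "integrable lborel (\<lambda>z. g z * tpair s \<theta> z)"
    and "(\<integral>z. g z * tpair s \<theta> z \<partial>lborel) = 2 * exp (- (s * \<theta>)) * tilt s \<theta>"
proof -
  have 1: "integrable lborel (\<lambda>z. exp (s * (\<theta> + z)) * (H (\<theta> + z) * g z))"
    "(\<integral>z. exp (s * (\<theta> + z)) * (H (\<theta> + z) * g z) \<partial>lborel) = tilt s \<theta>"
    using lborel_integrable_real_affine[OF tilt_integrable[OF assms, of \<theta>], of 1 \<theta>]
      lborel_integral_real_affine[of 1 "\<lambda>x. exp (s * x) * (H x * g (x - \<theta>))" \<theta>] by (auto simp: tilt_def)
  have 2: "integrable lborel (\<lambda>z. exp (s * (\<theta> - z)) * (H (\<theta> - z) * g z))"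
    "(\<integral>z. exp (s * (\<theta> - z)) * (H (\<theta> - z) * g z) \<partial>lborel) = tilt s \<theta>"
    using lborel_integrable_real_affine[OF tilt_integrable[OF assms, of \<theta>], of "-1" \<theta>]
      lborel_integral_real_affine[of "-1" "\<lambda>x. exp (s * x) * (H x * g (x - \<theta>))" \<theta>]
    by (auto simp: tilt_def G.even)
  have "g z * tpair s \<theta> z = exp (- (s * \<theta>)) * (exp (s * (\<theta> + z)) * (H (\<theta> + z) * g z)
      + exp (s * (\<theta> - z)) * (H (\<theta> - z) * g z))" for z
  proof -
    have "exp (s * z) = exp (- (s * \<theta>)) * exp (s * (\<theta> + z))"
      "exp (- (s * z)) = exp (- (s * \<theta>)) * exp (s * (\<theta> - z))"
      by (simp_all add: exp_add[symmetric] algebra_simps)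
    then show ?thesis by (simp only: tpair_def) (simp add: algebra_simps)
  qed
  then have e: "(\<lambda>z. g z * tpair s \<theta> z) = (\<lambda>z. exp (- (s * \<theta>)) * (exp (s * (\<theta> + z)) * (H (\<theta> + z) * g z)
      + exp (s * (\<theta> - z)) * (H (\<theta> - z) * g z)))" by blast
  show "integrable lborel (\<lambda>z. g z * tpair s \<theta> z)"
    "(\<integral>z. g z * tpair s \<theta> z \<partial>lborel) = 2 * exp (- (s * \<theta>)) * tilt s \<theta>"
    unfolding e using 1 2 by auto
qed

text \<open>The factorisation shows sign and size of the gain: the first factor is of order s, the
  second compares the inner point with the tilted outer one.\<close>

lemma tpair_diff: "pair \<theta> z - tpair s \<theta> z
    = (1 - exp (- (s * z))) * (H (\<theta> - z) - exp (s * z) * H (\<theta> + z))"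
  by (simp add: pair_def tpair_def algebra_simps exp_minus_inverse exp_add[symmetric])

text \<open>Of the decay rate \<open>2 * a\<close>, one \<open>a\<close> pays for the tilt
  \<open>s \<le> a\<close>; the other remains as a gap.\<close>

lemma pair_gap:
  assumes s: "0 < s" "s \<le> a" and z: "0 \<le> z" "z \<le> \<theta>" "\<theta>0 \<le> \<theta>"
  shows "(1 - exp (- (a * z))) * H (\<theta> - z) \<le> H (\<theta> - z) - exp (s * z) * H (\<theta> + z)"
proof -
  have "exp (s * z) * H (\<theta> + z) \<le> exp (s * z) * (exp (- 2 * a * z) * H (\<theta> - z))"
    using z by (intro mult_left_mono H_decay) auto
  also have "\<dots> = exp (s * z - 2 * a * z) * H (\<theta> - z)"
    by (simp add: exp_add[symmetric])
  also have "\<dots> \<le> exp (- (a * z)) * H (\<theta> - z)"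
  proof -
    have "s * z \<le> a * z" using s z by (intro mult_right_mono) auto
    then show ?thesis by (intro mult_right_mono) auto
  qed
  finally show ?thesis by (simp add: algebra_simps)
qed

lemma tpair_le_pair:
  assumes s: "0 < s" "s \<le> a" and z: "\<bar>z\<bar> \<le> \<theta>" "\<theta>0 \<le> \<theta>"
  shows "tpair s \<theta> z \<le> pair \<theta> z"
proof -
  have "0 \<le> (1 - exp (- (a * \<bar>z\<bar>))) * H (\<theta> - \<bar>z\<bar>)" using a_pos by simp
  then have "0 \<le> H (\<theta> - \<bar>z\<bar>) - exp (s * \<bar>z\<bar>) * H (\<theta> + \<bar>z\<bar>)"
    using pair_gap[OF s, of "\<bar>z\<bar>" \<theta>] z by linarith
  then have "0 \<le> pair \<theta> \<bar>z\<bar> - tpair s \<theta> \<bar>z\<bar>"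
    unfolding tpair_diff using s by (intro mult_nonneg_nonneg) auto
  then show ?thesis by (simp add: pair_abs tpair_abs)
qed

lemma H_le_H_minus:
  assumes "0 \<le> z" "0 \<le> \<theta>" shows "H (\<theta> + z) \<le> H (\<theta> - z)"
  using assms by (intro H.antimono) auto

lemma one_minus_exp_ge: "0 \<le> s \<Longrightarrow> s \<le> 1 \<Longrightarrow> s / 2 \<le> 1 - exp (- s)" for s :: real
proof -
  assume s: "0 \<le> s" "s \<le> 1"
  have "exp (- s) \<le> 1 / (1 + s)"
    using exp_ge_add_one_self[of s] s by (simp add: exp_minus field_simps)
  moreover have "s / 2 \<le> 1 - 1 / (1 + s)"
    using s mult_left_mono[of s 1 s] by (simp add: field_simps)
  ultimately show "s / 2 \<le> 1 - exp (- s)" by linarith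
qed

text \<open>The 4 is a product of two halves: \<open>1 - exp (- s)\<close> is at least
  \<open>s / 2\<close>, and the inner point carries at least half of \<open>pair\<close>.\<close>

definition gain :: real where "gain = (1 - exp (- a)) / 4"

lemma gain: "0 < gain" "gain < 1"
proof -
  show "0 < gain" using a_pos by (simp add: gain_def)
  show "gain < 1" by (simp add: gain_def field_simps add_pos_pos)
qed

text \<open>Both factors of \<open>tpair_diff\<close> vanish at z = 0; from distance 1 on they are
  bounded below, by a multiple of s and by a multiple of \<open>pair\<close>.\<close>

lemma tpair_le_gain:
  assumes s: "0 < s" "s \<le> a" "s \<le> 1" and z: "1 \<le> \<bar>z\<bar>" "\<bar>z\<bar> \<le> \<theta>" "\<theta>0 \<le> \<theta>"
  shows "tpair s \<theta> z \<le> (1 - gain * s) * pair \<theta> z"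
proof -
  define v where "v = \<bar>z\<bar>"
  have v: "1 \<le> v" "v \<le> \<theta>" using z by (auto simp: v_def)
  have "gain * s * pair \<theta> v = (s / 2) * ((1 - exp (- a)) * (pair \<theta> v / 2))"
    by (simp add: gain_def)
  also have "\<dots> \<le> (1 - exp (- (s * v))) * ((1 - exp (- (a * v))) * H (\<theta> - v))"
  proof (intro mult_mono)
    have "s \<le> s * v" using s v by simp
    then have "1 - exp (- s) \<le> 1 - exp (- (s * v))" by simp
    then show "s / 2 \<le> 1 - exp (- (s * v))" using one_minus_exp_ge[of s] s by linarith
    show "1 - exp (- a) \<le> 1 - exp (- (a * v))" using a_pos v by simp
    show "pair \<theta> v / 2 \<le> H (\<theta> - v)" using H_le_H_minus[of v \<theta>] v by (simp add: pair_def)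
  qed (use s v a_pos pair_pos[of \<theta> v] in \<open>auto simp: less_imp_le\<close>)
  also have "\<dots> \<le> (1 - exp (- (s * v))) * (H (\<theta> - v) - exp (s * v) * H (\<theta> + v))"
    using pair_gap[OF s(1,2), of v \<theta>] s v z(3) by (intro mult_left_mono) auto
  finally have "gain * s * pair \<theta> v \<le> pair \<theta> v - tpair s \<theta> v"
    by (simp add: tpair_diff)
  then have "gain * s * pair \<theta> z \<le> pair \<theta> z - tpair s \<theta> z"
    by (simp add: v_def pair_abs tpair_abs)
  then show ?thesis by (simp add: algebra_simps)
qed

definition etail :: "real \<Rightarrow> real \<Rightarrow> real" where
  "etail s u = exp (s * \<bar>u\<bar>) * H u"

lemma etail_nonneg [simp]: "0 \<le> etail s u"
  by (simp add: etail_def)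

text \<open>Here the inner point has reached the origin, and \<open>H_decay\<close> is applied with
  the roles of \<theta> and \<open>\<bar>z\<bar>\<close> exchanged. The factor
  \<open>exp (- (s * \<theta>))\<close> later turns this region into an additive constant; adding
  both reflections covers either sign of z.\<close>

lemma tpair_le_tail:
  assumes s: "0 < s" "s \<le> a" and z: "\<theta> \<le> \<bar>z\<bar>" "\<theta>0 \<le> \<theta>" "0 \<le> \<theta>"
  shows "tpair s \<theta> z \<le> 2 * exp (- (s * \<theta>)) * (etail s (z - \<theta>) + etail s (z + \<theta>))"
proof -
  define v where "v = \<bar>z\<bar>"
  have v: "\<theta> \<le> v" using z by (simp add: v_def)
  have "exp (s * v) * H (\<theta> + v) \<le> exp (s * v) * (exp (- 2 * a * \<theta>) * H (v - \<theta>))"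
    using H_decay[of \<theta> v] v z by (intro mult_left_mono) (auto simp: add.commute)
  also have "\<dots> = exp (s * v - 2 * a * \<theta>) * H (v - \<theta>)" by (simp add: exp_add[symmetric])
  also have "\<dots> \<le> exp (s * v - 2 * s * \<theta>) * H (v - \<theta>)"
    using s z by (intro mult_right_mono) (auto intro: mult_right_mono)
  also have "\<dots> = exp (- (s * \<theta>)) * etail s (v - \<theta>)"
    using v by (simp add: etail_def exp_add[symmetric] algebra_simps)
  finally have 1: "exp (s * v) * H (\<theta> + v) \<le> exp (- (s * \<theta>)) * etail s (v - \<theta>)" .
  have "exp (- (s * v)) * H (\<theta> - v) \<le> exp (- (s * \<theta>)) * (exp (s * \<bar>v - \<theta>\<bar>) * H (v - \<theta>))"
    using s v H.minus_commute[of \<theta> v] mult_mono[of "exp (- (s * v))" "exp (- (s * \<theta>))" 1 "exp (s * \<bar>v - \<theta>\<bar>)"]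
    unfolding mult.assoc[symmetric] by (auto intro!: mult_right_mono)
  then have 2: "exp (- (s * v)) * H (\<theta> - v) \<le> exp (- (s * \<theta>)) * etail s (v - \<theta>)"
    by (simp add: etail_def)
  have "tpair s \<theta> z = tpair s \<theta> v" by (simp add: v_def tpair_abs)
  also have "\<dots> \<le> 2 * exp (- (s * \<theta>)) * etail s (v - \<theta>)"
    using 1 2 by (simp add: tpair_def)
  also have "\<dots> \<le> 2 * exp (- (s * \<theta>)) * (etail s (z - \<theta>) + etail s (z + \<theta>))"
  proof (rule mult_left_mono)
    have "etail s (- z - \<theta>) = etail s (z + \<theta>)"
      using H.even[of "z + \<theta>"] abs_minus_cancel[of "z + \<theta>"] unfolding etail_def by (simp del: abs_minus_cancel)
    then show "etail s (v - \<theta>) \<le> etail s (z - \<theta>) + etail s (z + \<theta>)"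
      by (auto simp: v_def abs_if)
  qed simp
  finally show ?thesis .
qed

definition ratio :: real where "ratio = 2 * g 0 / g 2"

lemma ratio_pos: "0 < ratio"
  by (simp add: ratio_def G.pos)

text \<open>Moving z outwards by 1 brings the inner point closer to the origin, still non-negative
  as \<theta> is at least 2, so \<open>H\<close> does not decrease there; \<open>g\<close> loses at
  most the factor \<open>g 0 / g 2\<close>.\<close>

lemma g_pair_shift:
  assumes "0 \<le> z" "z \<le> 1" "2 \<le> \<theta>"
  shows "g z * pair \<theta> z \<le> ratio * (g (z + 1) * pair \<theta> (z + 1))"
proof -
  have "g z * pair \<theta> z \<le> g 0 * (2 * H (\<theta> - z))"
    using H_le_H_minus[of z \<theta>] assms pair_pos[of \<theta> z]
    by (intro mult_mono G.le_max) (auto simp: pair_def)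
  also have "\<dots> \<le> g 0 * (2 * pair \<theta> (z + 1))"
  proof -
    have "H (\<theta> - z) \<le> H (\<theta> - (z + 1))" using assms by (intro H.antimono) auto
    also have "\<dots> \<le> pair \<theta> (z + 1)" by (simp add: pair_def)
    finally show ?thesis by (intro mult_left_mono) auto
  qed
  also have "\<dots> = ratio * (g 2 * pair \<theta> (z + 1))"
    using G.pos[of 2] by (simp add: ratio_def)
  also have "\<dots> \<le> ratio * (g (z + 1) * pair \<theta> (z + 1))"
    using ratio_pos pair_pos[of \<theta> "z + 1"] assms by (intro mult_left_mono mult_right_mono G.antimono) auto
  finally show ?thesis .
qed

text \<open>No gain linear in s is available near z = 0, so this part is separated from
  \<open>shell\<close>, where \<open>tpair_le_gain\<close> applies.\<close>

definition core :: "real \<Rightarrow> real" where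
  "core \<theta> = (\<integral>z. indicator {-1<..<1} z * (g z * pair \<theta> z) \<partial>lborel)"

definition shell :: "real \<Rightarrow> real" where
  "shell \<theta> = (\<integral>z. indicator {z. 1 \<le> \<bar>z\<bar> \<and> \<bar>z\<bar> \<le> \<theta>} z * (g z * pair \<theta> z) \<partial>lborel)"

lemma ind_integrable:
  fixes f :: "real \<Rightarrow> real"
  assumes "integrable lborel f" "A \<in> sets borel"
  shows "integrable lborel (\<lambda>z. indicator A z * f z)"
  using integrable_mult_indicator[OF _ assms(1), of A] assms(2) by simp

lemma shell_set [measurable]: "{z. 1 \<le> \<bar>z\<bar> \<and> \<bar>z\<bar> \<le> \<theta>} \<in> sets borel" for \<theta> :: real
  by measurable

lemma core_integrable: "integrable lborel (\<lambda>z. indicator {-1<..<1} z * (g z * pair \<theta> z))"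
  by (intro ind_integrable g_pair_integral) simp

lemma shell_integrable: "integrable lborel (\<lambda>z. indicator {z. 1 \<le> \<bar>z\<bar> \<and> \<bar>z\<bar> \<le> \<theta>} z * (g z * pair \<theta> z))"
  by (intro ind_integrable g_pair_integral shell_set)

lemma core_shell_le: "core \<theta> + shell \<theta> \<le> 2 * conv \<theta>"
proof -
  have "core \<theta> + shell \<theta> = (\<integral>z. indicator {-1<..<1} z * (g z * pair \<theta> z)
      + indicator {z. 1 \<le> \<bar>z\<bar> \<and> \<bar>z\<bar> \<le> \<theta>} z * (g z * pair \<theta> z) \<partial>lborel)"
    unfolding core_def shell_def using core_integrable shell_integrable by simp
  also have "\<dots> \<le> (\<integral>z. g z * pair \<theta> z \<partial>lborel)"
  proof (rule integral_mono)
    fix z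
    have "0 \<le> g z * pair \<theta> z" using pair_pos[of \<theta> z] by simp
    then show "indicator {-1<..<1} z * (g z * pair \<theta> z)
      + indicator {z. 1 \<le> \<bar>z\<bar> \<and> \<bar>z\<bar> \<le> \<theta>} z * (g z * pair \<theta> z) \<le> g z * pair \<theta> z"
      by (auto simp: indicator_def abs_if)
  qed (use core_integrable shell_integrable g_pair_integral in auto)
  finally show ?thesis by (simp add: g_pair_integral)
qed

text \<open>The right half is shifted by 1 and the left half by -1, into \<open>{1..2}\<close> and
  \<open>{-2..-1}\<close>, both in the shell as \<theta> is at least 2. The shell thus keeps a share
  of the joint mass that does not depend on \<theta>.\<close>

lemma core_le_shell:
  assumes \<theta>: "2 \<le> \<theta>"
  shows "core \<theta> \<le> ratio * shell \<theta>"
proof -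
  let ?w = "\<lambda>z. g z * pair \<theta> z"
  define p where "p = (\<lambda>z. indicator {1..2} z * ?w z)"
  define q where "q = (\<lambda>z. indicator {-2..-1} z * ?w z)"
  have pq: "integrable lborel p" "integrable lborel q"
    unfolding p_def q_def by (intro ind_integrable g_pair_integral; simp)+
  have w_even: "?w (- z) = ?w z" for z by (simp add: pair_def G.even add.commute)
  have w_nonneg: "0 \<le> ?w z" for z using pair_pos[of \<theta> z] by simp
  have p1: "integrable lborel (\<lambda>z. p (1 + z))" "(\<integral>z. p (1 + z) \<partial>lborel) = (\<integral>z. p z \<partial>lborel)"
    using lborel_integrable_real_affine[OF pq(1), of 1 1] lborel_integral_real_affine[of 1 p 1] by auto
  have q1: "integrable lborel (\<lambda>z. q (-1 + z))" "(\<integral>z. q (-1 + z) \<partial>lborel) = (\<integral>z. q z \<partial>lborel)"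
    using lborel_integrable_real_affine[OF pq(2), of 1 "-1"] lborel_integral_real_affine[of 1 q "-1"] by auto
  have "core \<theta> \<le> (\<integral>z. ratio * (p (1 + z) + q (-1 + z)) \<partial>lborel)"
    unfolding core_def
  proof (rule integral_mono[OF core_integrable])
    fix z :: real
    have nn: "0 \<le> p (1 + z)" "0 \<le> q (-1 + z)" using w_nonneg by (auto simp: p_def q_def)
    show "indicator {-1<..<1} z * ?w z \<le> ratio * (p (1 + z) + q (-1 + z))"
    proof (cases "\<bar>z\<bar> < 1")
      case True
      show ?thesis
      proof (cases "0 \<le> z")
        case z: True
        then have "?w z \<le> ratio * p (1 + z)"
          using g_pair_shift[of z \<theta>] True \<theta> by (simp add: p_def indicator_def add.commute)
        then show ?thesis using nn ratio_pos True z
          by (simp add: distrib_left indicator_def add_increasing2 abs_if split: if_splits)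
      next
        case z: False
        have "?w z = ?w (- z)" by (rule w_even[symmetric])
        also have "\<dots> \<le> ratio * ?w (- z + 1)"
          using z True \<theta> by (intro g_pair_shift) auto
        also have "?w (- z + 1) = ?w (-1 + z)" using w_even[of "-1 + z"] by (simp add: algebra_simps)
        finally have "?w z \<le> ratio * q (-1 + z)" using z True by (simp add: q_def indicator_def)
        then show ?thesis using nn ratio_pos True z
          by (simp add: distrib_left indicator_def add_increasing abs_if split: if_splits)
      qed
    next
      case False
      then show ?thesis using nn ratio_pos by (auto simp: indicator_def)
    qed
  qed (use p1 q1 in auto)
  also have "\<dots> = ratio * ((\<integral>z. p z \<partial>lborel) + (\<integral>z. q z \<partial>lborel))"
    using p1 q1 by simp
  also have "(\<integral>z. p z \<partial>lborel) + (\<integral>z. q z \<partial>lborel) = (\<integral>z. p z + q z \<partial>lborel)"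
    using pq by simp
  also have "ratio * \<dots> \<le> ratio * shell \<theta>"
    unfolding shell_def
  proof (intro mult_left_mono integral_mono)
    show "p z + q z \<le> indicator {z. 1 \<le> \<bar>z\<bar> \<and> \<bar>z\<bar> \<le> \<theta>} z * ?w z" for z
      using \<theta> w_nonneg[of z] by (auto simp: p_def q_def indicator_def)
  qed (use pq shell_integrable ratio_pos in auto)
  finally show ?thesis .
qed

definition ttail :: "real \<Rightarrow> real" where
  "ttail s = (\<integral>u. etail s u \<partial>lborel)"

lemma etail_integrable: "\<bar>s\<bar> \<le> b \<Longrightarrow> integrable lborel (etail s)"
  using H_tilt_integrable[of s] by (simp add: etail_def[abs_def])

text \<open>The shell holds at least the share \<open>1 / (1 + ratio)\<close> of core and shell
  together, so the gain on it averages to this amount.\<close>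

definition rate :: real where "rate = gain / (1 + ratio)"

lemma rate_pos: "0 < rate"
  using gain ratio_pos by (simp add: rate_def)

lemma tilt_large:
  assumes s: "0 < s" "s \<le> a" "s \<le> 1" "s \<le> b" and \<theta>: "\<theta>0 \<le> \<theta>" "2 \<le> \<theta>"
  shows "tilt s \<theta> \<le> ((1 - rate * s) * exp (s * \<theta>) + 2 * ttail s / H 1) * conv \<theta>"
proof -
  let ?w = "\<lambda>z. g z * pair \<theta> z"
  define T where "T = (\<lambda>z. 2 * exp (- (s * \<theta>)) * g \<theta> * (etail s (z - \<theta>) + etail s (z + \<theta>)))"
  define tt where "tt = ttail s / H 1 * conv \<theta>"
  have sb: "\<bar>s\<bar> \<le> b" using s by simp
  have et: "integrable lborel (\<lambda>z. etail s (z - \<theta>))" "(\<integral>z. etail s (z - \<theta>) \<partial>lborel) = ttail s"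
    "integrable lborel (\<lambda>z. etail s (z + \<theta>))" "(\<integral>z. etail s (z + \<theta>) \<partial>lborel) = ttail s"
    using lborel_integrable_real_affine[OF etail_integrable[OF sb], of 1 "-\<theta>"]
      lborel_integral_real_affine[of 1 "etail s" "-\<theta>"]
      lborel_integrable_real_affine[OF etail_integrable[OF sb], of 1 "\<theta>"]
      lborel_integral_real_affine[of 1 "etail s" "\<theta>"]
    by (auto simp: ttail_def add.commute)
  have T_int: "integrable lborel T" unfolding T_def using et by simp
  have T_I: "(\<integral>z. T z \<partial>lborel) = 4 * exp (- (s * \<theta>)) * g \<theta> * ttail s"
    unfolding T_def using et by simp
  have T_nonneg: "0 \<le> T z" for z by (simp add: T_def)
  have w_nonneg: "0 \<le> ?w z" for z using pair_pos[of \<theta> z] by simp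
  have "2 * exp (- (s * \<theta>)) * tilt s \<theta> = (\<integral>z. g z * tpair s \<theta> z \<partial>lborel)"
    using g_tpair_integral[OF sb] by simp
  \<comment> \<open>The core is bounded without gain, the shell with gain, and the rest, where
    \<open>g z \<le> g \<theta>\<close>, by \<open>T\<close>.\<close>
  also have "\<dots> \<le> (\<integral>z. indicator {-1<..<1} z * ?w z
      + (1 - gain * s) * (indicator {z. 1 \<le> \<bar>z\<bar> \<and> \<bar>z\<bar> \<le> \<theta>} z * ?w z) + T z \<partial>lborel)"
  proof (rule integral_mono)
    fix z :: real
    consider "\<bar>z\<bar> < 1" | "1 \<le> \<bar>z\<bar>" "\<bar>z\<bar> \<le> \<theta>" | "\<theta> < \<bar>z\<bar>" by linarith
    then show "g z * tpair s \<theta> z \<le> indicator {-1<..<1} z * ?w z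
      + (1 - gain * s) * (indicator {z. 1 \<le> \<bar>z\<bar> \<and> \<bar>z\<bar> \<le> \<theta>} z * ?w z) + T z"
    proof cases
      case 1
      then have "g z * tpair s \<theta> z \<le> ?w z"
        using tpair_le_pair[of s z \<theta>] s \<theta> by (intro mult_left_mono) auto
      then show ?thesis using 1 T_nonneg[of z] by (auto simp: indicator_def)
    next
      case 2
      then have "g z * tpair s \<theta> z \<le> g z * ((1 - gain * s) * pair \<theta> z)"
        using tpair_le_gain[of s z \<theta>] s \<theta> by (intro mult_left_mono) auto
      then show ?thesis using 2 T_nonneg[of z] by (auto simp: indicator_def mult_ac)
    next
      case 3
      have "g z * tpair s \<theta> z \<le> g \<theta> * (2 * exp (- (s * \<theta>)) * (etail s (z - \<theta>) + etail s (z + \<theta>)))"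
        using 3 s \<theta> tpair_le_tail[of s \<theta> z]
        by (intro mult_mono G.antimono) (auto simp: tpair_def)
      then have "g z * tpair s \<theta> z \<le> T z" by (simp add: T_def mult_ac)
      then show ?thesis using 3 \<theta> by (auto simp: indicator_def)
    qed
  qed (use g_tpair_integral[OF sb] core_integrable shell_integrable T_int in auto)
  also have "\<dots> = core \<theta> + (1 - gain * s) * shell \<theta> + 4 * exp (- (s * \<theta>)) * g \<theta> * ttail s"
    using core_integrable shell_integrable T_int by (simp add: core_def shell_def T_I)
  also have "core \<theta> + (1 - gain * s) * shell \<theta> \<le> (1 - rate * s) * (2 * conv \<theta>)"
  proof -
    have "rate * (core \<theta> + shell \<theta>) \<le> rate * ((1 + ratio) * shell \<theta>)"
      using core_le_shell[OF \<theta>(2)] rate_pos by (intro mult_left_mono) (auto simp: algebra_simps)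
    also have "\<dots> = gain * shell \<theta>" using ratio_pos by (simp add: rate_def)
    finally have "s * (rate * (core \<theta> + shell \<theta>)) \<le> s * (gain * shell \<theta>)"
      using s by (intro mult_left_mono) auto
    then have "core \<theta> + (1 - gain * s) * shell \<theta> \<le> (1 - rate * s) * (core \<theta> + shell \<theta>)"
      by (simp add: algebra_simps)
    also have "\<dots> \<le> (1 - rate * s) * (2 * conv \<theta>)"
    proof (rule mult_left_mono[OF core_shell_le])
      have "rate \<le> 1" using gain ratio_pos by (simp add: rate_def)
      then have "rate * s \<le> 1 * 1" using s rate_pos by (intro mult_mono) auto
      then show "0 \<le> 1 - rate * s" by simp
    qed
    finally show ?thesis .
  qed
  \<comment> \<open>The window \<open>{0..1}\<close> gives
    \<open>g \<theta> * H 1 \<le> conv \<theta>\<close>, so the far region is bounded relative to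
    \<open>conv\<close>, not only in absolute terms.\<close>
  also have "4 * exp (- (s * \<theta>)) * g \<theta> * ttail s \<le> 4 * (exp (- (s * \<theta>)) * tt)"
  proof -
    have "g \<theta> * H 1 = (\<integral>x. g \<theta> * H 1 * indicator {0..1::real} x \<partial>lborel)" by simp
    also have "\<dots> \<le> conv \<theta>"
      unfolding conv_def
    proof (rule integral_mono[OF _ conv_integrable])
      fix x
      show "g \<theta> * H 1 * indicator {0..1} x \<le> H x * g (x - \<theta>)"
        using \<theta> by (auto simp: indicator_def mult.commute[of "g \<theta>"] intro!: mult_mono H.antimono G.antimono)
    qed auto
    finally have "g \<theta> \<le> conv \<theta> / H 1" using H.pos[of 1] by (simp add: pos_le_divide_eq)
    then have "4 * exp (- (s * \<theta>)) * ttail s * g \<theta> \<le> 4 * exp (- (s * \<theta>)) * ttail s * (conv \<theta> / H 1)"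
      by (intro mult_left_mono) (auto simp: ttail_def)
    then show ?thesis by (simp add: tt_def mult_ac)
  qed
  finally have "exp (- (s * \<theta>)) * tilt s \<theta> \<le> (1 - rate * s) * conv \<theta> + exp (- (s * \<theta>)) * (2 * tt)"
    by (simp add: algebra_simps)
  then have "exp (s * \<theta>) * (exp (- (s * \<theta>)) * tilt s \<theta>)
      \<le> exp (s * \<theta>) * ((1 - rate * s) * conv \<theta> + exp (- (s * \<theta>)) * (2 * tt))"
    by (rule mult_left_mono) simp
  moreover have e: "exp (s * \<theta>) * (exp (- (s * \<theta>)) * c) = c" for c
    by (simp add: mult.assoc[symmetric] exp_minus)
  ultimately have "tilt s \<theta> \<le> exp (s * \<theta>) * ((1 - rate * s) * conv \<theta>) + 2 * tt"
    by (simp only: distrib_left e)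
  also have "\<dots> = ((1 - rate * s) * exp (s * \<theta>) + 2 * ttail s / H 1) * conv \<theta>"
    by (simp add: tt_def distrib_right)
  finally show ?thesis .
qed

text \<open>One constant covers arbitrarily negative \<theta>: for x beyond R,
  \<open>g (x - \<theta>)\<close> is at most \<open>g (R - \<theta>)\<close>, and the window
  \<open>{R-1..R}\<close> shows that \<open>conv \<theta>\<close> is at least
  \<open>g (R - \<theta>) * H R\<close>.\<close>

lemma tilt_small:
  assumes s: "0 < s" "s \<le> b" and \<theta>: "\<theta> \<le> R - 1" "1 \<le> R"
  shows "tilt s \<theta> \<le> (exp (s * R) + ttail s / H R) * conv \<theta>"
proof -
  have sb: "\<bar>s\<bar> \<le> b" using s by simp
  have "tilt s \<theta> \<le> (\<integral>x. exp (s * R) * (H x * g (x - \<theta>)) + g (R - \<theta>) * etail s x \<partial>lborel)"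
    unfolding tilt_def
  proof (rule integral_mono[OF tilt_integrable[OF sb]])
    fix x
    show "exp (s * x) * (H x * g (x - \<theta>)) \<le> exp (s * R) * (H x * g (x - \<theta>)) + g (R - \<theta>) * etail s x"
    proof (cases "x \<le> R")
      case True
      then have "exp (s * x) * (H x * g (x - \<theta>)) \<le> exp (s * R) * (H x * g (x - \<theta>))"
        using s by (intro mult_right_mono) auto
      moreover have "0 \<le> g (R - \<theta>) * etail s x" by simp
      ultimately show ?thesis by linarith
    next
      case False
      then have "exp (s * x) * (H x * g (x - \<theta>)) \<le> exp (s * \<bar>x\<bar>) * (H x * g (R - \<theta>))"
        using \<theta> by (intro mult_mono mult_left_mono G.antimono) (auto simp: s less_imp_le)
      also have "\<dots> = g (R - \<theta>) * etail s x" by (simp add: etail_def mult_ac)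
      finally show ?thesis by (simp add: add_increasing)
    qed
  qed (use conv_integrable etail_integrable[OF sb] in auto)
  also have "\<dots> = exp (s * R) * conv \<theta> + g (R - \<theta>) * ttail s"
    using conv_integrable etail_integrable[OF sb] by (simp add: conv_def ttail_def)
  also have "g (R - \<theta>) * ttail s \<le> conv \<theta> / H R * ttail s"
  proof (rule mult_right_mono)
    have "g (R - \<theta>) * H R = (\<integral>x. g (R - \<theta>) * H R * indicator {R-1..R} x \<partial>lborel)" by simp
    also have "\<dots> \<le> conv \<theta>"
      unfolding conv_def
    proof (rule integral_mono[OF _ conv_integrable])
      fix x
      show "g (R - \<theta>) * H R * indicator {R-1..R} x \<le> H x * g (x - \<theta>)"
        using \<theta> by (auto simp: indicator_def mult.commute[of "g (R - \<theta>)"] intro!: mult_mono H.antimono G.antimono)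
    qed auto
    finally show "g (R - \<theta>) \<le> conv \<theta> / H R" using H.pos[of R] by (simp add: pos_le_divide_eq)
  qed (simp add: ttail_def)
  finally show ?thesis by (simp add: algebra_simps)
qed

lemma tilt_bound:
  assumes s: "0 < s" "s \<le> a" "s \<le> 1" "s \<le> b" "rate * s \<le> 1"
  shows "\<exists>C\<ge>0. \<forall>\<theta>. tilt s \<theta> \<le> ((1 - rate * s) * exp (s * \<theta>) + C) * conv \<theta>"
proof -
  define R where "R = max \<theta>0 2 + 1"
  define C where "C = max (2 * ttail s / H 1) (exp (s * R) + ttail s / H R)"
  have "tilt s \<theta> \<le> ((1 - rate * s) * exp (s * \<theta>) + C) * conv \<theta>" for \<theta>
  proof (cases "\<theta> \<le> R - 1")
    case True
    have "tilt s \<theta> \<le> (exp (s * R) + ttail s / H R) * conv \<theta>"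
      using s True by (intro tilt_small) (auto simp: R_def)
    also have "\<dots> \<le> ((1 - rate * s) * exp (s * \<theta>) + C) * conv \<theta>"
      using s conv_pos[of \<theta>] by (intro mult_right_mono add_increasing) (auto simp: C_def)
    finally show ?thesis .
  next
    case False
    have "tilt s \<theta> \<le> ((1 - rate * s) * exp (s * \<theta>) + 2 * ttail s / H 1) * conv \<theta>"
      using s False by (intro tilt_large) (auto simp: R_def)
    also have "\<dots> \<le> ((1 - rate * s) * exp (s * \<theta>) + C) * conv \<theta>"
      using conv_pos[of \<theta>] by (intro mult_right_mono add_left_mono) (auto simp: C_def)
    finally show ?thesis .
  qed
  moreover have "0 \<le> C"
    by (auto simp: C_def ttail_def le_max_iff_disj)
  ultimately show ?thesis by blast
qed

end

section \<open>From the tilt estimate to a drift condition for the sampler\<close>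

lemma exp_add_exp_minus_le: "exp u + exp (- u) \<le> 2 + u\<^sup>2 * exp \<bar>u\<bar>" for u :: real
proof -
  \<comment> \<open>With v half of \<open>\<bar>u\<bar>\<close>, the left-hand side minus 2 is the
    square of \<open>exp v - exp (- v)\<close>, and that difference is at most
    \<open>2 * v * exp v\<close>.\<close>
  define v where "v = \<bar>u\<bar> / 2"
  have v: "0 \<le> v" by (simp add: v_def)
  have e: "exp v * exp v = exp \<bar>u\<bar>" "exp (- v) * exp (- v) = exp (- \<bar>u\<bar>)" "exp v * exp (- v) = 1"
    unfolding exp_add[symmetric] by (simp_all add: v_def)
  have "exp v - exp (- v) = exp v * (1 - exp (- (2 * v)))"
    by (simp add: algebra_simps exp_add[symmetric])
  also have "\<dots> \<le> exp v * (2 * v)"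
    using exp_ge_add_one_self[of "- (2 * v)"] by (intro mult_left_mono) auto
  finally have "(exp v - exp (- v))\<^sup>2 \<le> (exp v * (2 * v))\<^sup>2"
    using v by (intro power_mono) auto
  also have "\<dots> = u\<^sup>2 * exp \<bar>u\<bar>"
    by (simp add: power_mult_distrib power2_eq_square e(1)[symmetric] v_def mult_ac)
  also have "(exp v - exp (- v))\<^sup>2 = exp \<bar>u\<bar> + exp (- \<bar>u\<bar>) - 2"
    using e by (simp add: power2_eq_square algebra_simps)
  finally show ?thesis by (auto simp: abs_if split: if_splits)
qed

context gibbs_model
begin

definition mgf :: "real \<Rightarrow> real" where
  "mgf r = (\<integral>z. exp (r * z) * g z \<partial>lborel) / G.mass"

definition joint_tilt :: "real \<Rightarrow> real \<Rightarrow> real" where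
  "joint_tilt r \<theta> = (\<integral>x. exp (r * (x - y)) * joint \<theta> x \<partial>lborel)"

lemma mgf_minus: "mgf (- r) = mgf r"
  using lborel_integral_real_affine[of "-1" "\<lambda>z. exp (r * z) * g z" 0] by (simp add: mgf_def G.even)

lemma nn_exp_step:
  assumes "integrable lborel (\<lambda>z. exp (- r * z) * g z)"
  shows "(\<integral>\<^sup>+t. ennreal (exp (r * (t - y))) * ennreal (g (x - t)) \<partial>lborel)
    = ennreal (exp (r * (x - y)) * (mgf r * G.mass))"
proof -
  have "(\<integral>\<^sup>+t. ennreal (exp (r * (t - y))) * ennreal (g (x - t)) \<partial>lborel)
      = (\<integral>\<^sup>+t. ennreal (exp (r * (x - y))) * ennreal (exp (- r * (x - t)) * g (x - t)) \<partial>lborel)"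
  proof (rule nn_integral_cong)
    fix t
    have "exp (r * (t - y)) = exp (r * (x - y)) * exp (- r * (x - t))"
      unfolding exp_add[symmetric] by (simp add: algebra_simps)
    then show "ennreal (exp (r * (t - y))) * ennreal (g (x - t))
        = ennreal (exp (r * (x - y))) * ennreal (exp (- r * (x - t)) * g (x - t))"
      by (simp add: ennreal_mult[symmetric] mult.assoc)
  qed
  also have "\<dots> = ennreal (exp (r * (x - y))) * (\<integral>\<^sup>+t. ennreal (exp (- r * (x - t)) * g (x - t)) \<partial>lborel)"
    by (rule nn_integral_cmult) simp
  also have "(\<integral>\<^sup>+t. ennreal (exp (- r * (x - t)) * g (x - t)) \<partial>lborel)
      = (\<integral>\<^sup>+z. ennreal (exp (- r * z) * g z) \<partial>lborel)"
    by (rule nn_integral_lborel_reflect) simp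
  also have "\<dots> = ennreal (mgf r * G.mass)"
    using G.mass_pos nn_integral_eq_integral[OF assms]
    by (subst mgf_minus[symmetric]) (simp add: mgf_def)
  finally show ?thesis by (simp add: ennreal_mult'[symmetric])
qed

lemma mgf_nonneg: "0 \<le> mgf r"
  using G.mass_pos by (simp add: mgf_def)

text \<open>Given X, the new \<theta> is X plus independent symmetric noise, so the exponential
  moment factors into the \<open>mgf\<close> of the noise and the tilted mean of X.\<close>

lemma nn_exp_k:
  assumes g: "integrable lborel (\<lambda>z. exp (- r * z) * g z)"
    and j: "integrable lborel (\<lambda>x. exp (r * (x - y)) * joint \<theta> x)"
  shows "(\<integral>\<^sup>+t. ennreal (exp (r * (t - y))) * ennreal (k \<theta> t) \<partial>lborel)
    = ennreal (mgf r * (joint_tilt r \<theta> / marg \<theta>))"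
proof -
  have inner: "(\<integral>\<^sup>+t. ennreal (exp (r * (t - y))) * ennreal (g (x - t) / G.mass) \<partial>lborel)
      = ennreal (exp (r * (x - y)) * mgf r)" for x
  proof -
    have "(\<integral>\<^sup>+t. ennreal (exp (r * (t - y))) * ennreal (g (x - t) / G.mass) \<partial>lborel)
        = (\<integral>\<^sup>+t. ennreal (1 / G.mass) * (ennreal (exp (r * (t - y))) * ennreal (g (x - t))) \<partial>lborel)"
      using G.mass_pos by (simp add: ennreal_mult'[symmetric])
    also have "\<dots> = ennreal (1 / G.mass) * ennreal (exp (r * (x - y)) * (mgf r * G.mass))"
      by (subst nn_integral_cmult) (simp_all add: nn_exp_step[OF g])
    finally show ?thesis using G.mass_pos by (simp add: ennreal_mult'[symmetric])
  qed
  have "(\<integral>\<^sup>+t. ennreal (exp (r * (t - y))) * ennreal (k \<theta> t) \<partial>lborel)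
      = (\<integral>\<^sup>+x. ennreal (joint \<theta> x / marg \<theta>) * ennreal (exp (r * (x - y)) * mgf r) \<partial>lborel)"
    by (simp add: nn_integral_k inner)
  also have "\<dots> = (\<integral>\<^sup>+x. ennreal (mgf r / marg \<theta>) * ennreal (exp (r * (x - y)) * joint \<theta> x) \<partial>lborel)"
    using marg_pos[of \<theta>] mgf_nonneg[of r] by (simp add: ennreal_mult'[symmetric] mult_ac)
  also have "\<dots> = ennreal (mgf r / marg \<theta>) * (\<integral>\<^sup>+x. ennreal (exp (r * (x - y)) * joint \<theta> x) \<partial>lborel)"
    by (rule nn_integral_cmult) simp
  also have "(\<integral>\<^sup>+x. ennreal (exp (r * (x - y)) * joint \<theta> x) \<partial>lborel) = ennreal (joint_tilt r \<theta>)"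
    unfolding joint_tilt_def by (rule nn_integral_eq_integral[OF j]) simp
  finally show ?thesis
    using marg_pos[of \<theta>] mgf_nonneg[of r] by (simp add: ennreal_mult'[symmetric])
qed

text \<open>Under the posterior, \<theta> - y is minus the sum of two independent errors, so its
  exponential moment factors. This gives the integrability of the drift function that
  \<open>harris\<close> demands.\<close>

lemma exp_marg_finite:
  assumes g: "integrable lborel (\<lambda>z. exp (- r * z) * g z)"
    and H: "integrable lborel (\<lambda>u. exp (- r * u) * H u)"
  shows "integrable lborel (\<lambda>t. exp (r * (t - y)) * marg t)"
proof (rule integrableI_nonneg)
  have "(\<integral>\<^sup>+t. ennreal (exp (r * (t - y)) * marg t) \<partial>lborel)
      = (\<integral>\<^sup>+t. (\<integral>\<^sup>+x. ennreal (exp (r * (t - y))) * (ennreal (H (y - x)) * ennreal (g (x - t))) \<partial>lborel) \<partial>lborel)"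
    by (simp add: ennreal_mult' nn_marg[symmetric] nn_integral_cmult joint_def)
  also have "\<dots> = (\<integral>\<^sup>+x. (\<integral>\<^sup>+t. ennreal (exp (r * (t - y))) * (ennreal (H (y - x)) * ennreal (g (x - t))) \<partial>lborel) \<partial>lborel)"
    by (rule lborel_pair.Fubini') measurable
  also have "\<dots> = (\<integral>\<^sup>+x. ennreal (H (y - x)) * (\<integral>\<^sup>+t. ennreal (exp (r * (t - y))) * ennreal (g (x - t)) \<partial>lborel) \<partial>lborel)"
    by (simp add: nn_integral_cmult[symmetric] mult_ac)
  also have "\<dots> = (\<integral>\<^sup>+x. ennreal (mgf r * G.mass) * ennreal (exp (- r * (y - x)) * H (y - x)) \<partial>lborel)"
    using mgf_nonneg[of r] G.mass_pos
    by (intro nn_integral_cong, subst nn_exp_step[OF g])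
       (simp add: ennreal_mult'[symmetric] algebra_simps)
  also have "\<dots> = ennreal (mgf r * G.mass) * (\<integral>\<^sup>+x. ennreal (exp (- r * (y - x)) * H (y - x)) \<partial>lborel)"
    by (rule nn_integral_cmult) simp
  also have "(\<integral>\<^sup>+x. ennreal (exp (- r * (y - x)) * H (y - x)) \<partial>lborel) = (\<integral>\<^sup>+x. ennreal (exp (- r * x) * H x) \<partial>lborel)"
    by (rule nn_integral_lborel_reflect) simp
  also have "ennreal (mgf r * G.mass) * \<dots> < \<infinity>"
    using nn_integral_eq_integral[OF H] by (simp add: ennreal_mult_less_top)
  finally show "(\<integral>\<^sup>+t. ennreal (exp (r * (t - y)) * marg t) \<partial>lborel) < \<infinity>" .
qed (use marg_pos in \<open>auto simp: less_imp_le\<close>)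

text \<open>\<open>mgf\<close> is even, so averaging over r and -r removes the linear term; what
  remains is quadratic in r with one constant for all small r.\<close>

lemma mgf_le:
  assumes d: "0 < d" and g_le: "\<And>z. g z \<le> B * exp (- d * \<bar>z\<bar>)"
  shows "\<exists>J\<ge>0. \<forall>r. \<bar>r\<bar> \<le> d / 4 \<longrightarrow> integrable lborel (\<lambda>z. exp (r * z) * g z) \<and> mgf r \<le> 1 + J * r\<^sup>2"
proof -
  have B: "B > 0" using g_le[of 0] G.pos[of 0] by simp
  define q where "q = (\<lambda>z. z\<^sup>2 * (exp (d / 4 * \<bar>z\<bar>) * g z))"
  have q_int: "integrable lborel q"
  proof (rule Bochner_Integration.integrable_bound)
    \<comment> \<open>\<open>32 / d\<^sup>2\<close> inverts the quadratic Taylor term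
      \<open>(d / 4)\<^sup>2 / 2\<close>; two growth factors of rate \<open>d / 4\<close> leave
      decay at rate \<open>d / 2\<close>.\<close>
    show "integrable lborel (\<lambda>z. 32 / d\<^sup>2 * B * exp (- (d / 2) * \<bar>z\<bar>))"
      using laplace_integrable[of "d / 2"] d by simp
    have "q z \<le> 32 / d\<^sup>2 * B * exp (- (d / 2) * \<bar>z\<bar>)" for z
    proof -
      have "1 + d / 4 * \<bar>z\<bar> + (d / 4 * \<bar>z\<bar>)\<^sup>2 / 2 \<le> exp (d / 4 * \<bar>z\<bar>)"
        using d by (intro exp_lower_Taylor_quadratic) auto
      moreover have "0 \<le> d / 4 * \<bar>z\<bar>" using d by simp
      moreover have "(d / 4 * \<bar>z\<bar>)\<^sup>2 / 2 = d\<^sup>2 / 32 * z\<^sup>2"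
        by (simp add: power_mult_distrib power_divide)
      ultimately have "d\<^sup>2 / 32 * z\<^sup>2 \<le> exp (d / 4 * \<bar>z\<bar>)" by linarith
      then have "z\<^sup>2 \<le> 32 / d\<^sup>2 * exp (d / 4 * \<bar>z\<bar>)"
        using d by (simp add: field_simps)
      then have "q z \<le> (32 / d\<^sup>2 * exp (d / 4 * \<bar>z\<bar>)) * (exp (d / 4 * \<bar>z\<bar>) * (B * exp (- d * \<bar>z\<bar>)))"
        unfolding q_def by (intro mult_mono g_le) auto
      also have "\<dots> = 32 / d\<^sup>2 * B * (exp (d / 4 * \<bar>z\<bar>) * exp (d / 4 * \<bar>z\<bar>) * exp (- d * \<bar>z\<bar>))"
        by (simp add: mult_ac)
      also have "exp (d / 4 * \<bar>z\<bar>) * exp (d / 4 * \<bar>z\<bar>) * exp (- d * \<bar>z\<bar>) = exp (- (d / 2) * \<bar>z\<bar>)"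
        unfolding exp_add[symmetric] by simp
      finally show ?thesis .
    qed
    then show "AE z in lborel. norm (q z) \<le> norm (32 / d\<^sup>2 * B * exp (- (d / 2) * \<bar>z\<bar>))"
      using B by (intro AE_I2) (simp add: q_def abs_mult)
  qed (simp add: q_def)
  define J where "J = (\<integral>z. q z \<partial>lborel) / (2 * G.mass)"
  have "0 \<le> J" using G.mass_pos by (simp add: J_def q_def)
  moreover have "integrable lborel (\<lambda>z. exp (r * z) * g z) \<and> mgf r \<le> 1 + J * r\<^sup>2" if r: "\<bar>r\<bar> \<le> d / 4" for r
  proof -
    have int: "integrable lborel (\<lambda>z. exp (r * z) * g z)" if r: "\<bar>r\<bar> \<le> d / 4" for r
    proof (rule Bochner_Integration.integrable_bound)
      show "integrable lborel (\<lambda>z. B * exp (- (d / 2) * \<bar>z\<bar>))"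
        using laplace_integrable[of "d / 2"] d by simp
      have "exp (r * z) * g z \<le> B * exp (- (d / 2) * \<bar>z\<bar>)" for z
      proof -
        have "r * z \<le> \<bar>r\<bar> * \<bar>z\<bar>" by (metis abs_ge_self abs_mult)
        also have "\<dots> \<le> d / 2 * \<bar>z\<bar>" using r d by (intro mult_right_mono) auto
        finally have "exp (r * z) * g z \<le> exp (d / 2 * \<bar>z\<bar>) * (B * exp (- d * \<bar>z\<bar>))"
          by (intro mult_mono g_le) auto
        also have "\<dots> = B * (exp (d / 2 * \<bar>z\<bar>) * exp (- d * \<bar>z\<bar>))" by (simp add: mult_ac)
        also have "exp (d / 2 * \<bar>z\<bar>) * exp (- d * \<bar>z\<bar>) = exp (- (d / 2) * \<bar>z\<bar>)"
          unfolding exp_add[symmetric] by simp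
        finally show ?thesis .
      qed
      then show "AE z in lborel. norm (exp (r * z) * g z) \<le> norm (B * exp (- (d / 2) * \<bar>z\<bar>))"
        using B by (intro AE_I2) (simp add: abs_mult)
    qed simp
    have i1: "integrable lborel (\<lambda>z. exp (r * z) * g z)" by (rule int[OF r])
    have i2: "integrable lborel (\<lambda>z. exp (- r * z) * g z)" using int[of "- r"] r by simp
    have "(mgf r + mgf (- r)) * G.mass = (\<integral>z. exp (r * z) * g z + exp (- r * z) * g z \<partial>lborel)"
      using i1 i2 G.mass_pos by (simp add: mgf_def add_divide_distrib[symmetric])
    also have "\<dots> \<le> (\<integral>z. 2 * g z + r\<^sup>2 * q z \<partial>lborel)"
    proof (rule integral_mono)
      fix z
      have "exp (r * z) + exp (- r * z) \<le> 2 + (r * z)\<^sup>2 * exp \<bar>r * z\<bar>"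
        using exp_add_exp_minus_le[of "r * z"] by simp
      also have "\<dots> \<le> 2 + (r * z)\<^sup>2 * exp (d / 4 * \<bar>z\<bar>)"
        using r by (intro add_left_mono mult_left_mono) (auto simp: abs_mult mult_right_mono[OF r, simplified])
      finally have "(exp (r * z) + exp (- r * z)) * g z \<le> (2 + (r * z)\<^sup>2 * exp (d / 4 * \<bar>z\<bar>)) * g z"
        by (rule mult_right_mono) simp
      then show "exp (r * z) * g z + exp (- r * z) * g z \<le> 2 * g z + r\<^sup>2 * q z"
        by (simp add: q_def power_mult_distrib algebra_simps)
    qed (use i1 i2 G.integrable q_int in auto)
    also have "\<dots> = 2 * G.mass + r\<^sup>2 * (\<integral>z. q z \<partial>lborel)"
      using G.integrable q_int by (simp add: G.mass_def)
    also have "\<dots> = 2 * (1 + J * r\<^sup>2) * G.mass"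
      using G.mass_pos by (simp add: J_def field_simps)
    finally have "2 * mgf r \<le> 2 * (1 + J * r\<^sup>2)"
      using G.mass_pos by (simp add: mgf_minus)
    then show ?thesis using i1 by simp
  qed
  ultimately show ?thesis by blast
qed

end

lemma drift_geometric:
  assumes "drift_model H g a b \<theta>0" and d: "0 < d" and g_le: "\<And>z. g z \<le> B * exp (- d * \<bar>z\<bar>)"
  shows "\<exists>M. gibbs_model.gibbs_rate_bound H g y M"
proof -
  interpret D: drift_model H g a b \<theta>0 by fact
  interpret gibbs_model H g y by unfold_locales
  \<comment> \<open>Two forms, one for each exponential in \<open>V\<close>: the tilt estimate is
    one-sided, and reflection about y gives the other side.\<close>
  have marg_conv: "marg \<theta> = D.conv (\<theta> - y)" "marg \<theta> = D.conv (y - \<theta>)" for \<theta>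
  proof -
    show "marg \<theta> = D.conv (\<theta> - y)"
      using lborel_integral_real_affine[of 1 "joint \<theta>" y]
      by (simp add: marg_def joint_def D.conv_def D.H.even algebra_simps)
    have "g (y - x - \<theta>) = g (x - (y - \<theta>))" for x
      using D.G.minus_commute[of "y - \<theta>" x] by (simp add: algebra_simps)
    then show "marg \<theta> = D.conv (y - \<theta>)"
      using lborel_integral_real_affine[of "-1" "joint \<theta>" y]
      by (simp add: marg_def joint_def D.conv_def)
  qed
  have tilt: "integrable lborel (\<lambda>x. exp (r * (x - y)) * joint \<theta> x)"
    "joint_tilt r \<theta> = D.tilt r (\<theta> - y)" "joint_tilt (- r) \<theta> = D.tilt r (y - \<theta>)"
    if "\<bar>r\<bar> \<le> b" for r \<theta>
  proof -
    have e: "exp (r * (x + - y - 0)) * (H (x + - y) * g (x + - y - (\<theta> - y))) = exp (r * (x - y)) * joint \<theta> x" for x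
      using D.H.even[of "x - y"] by (simp add: joint_def)
    show "integrable lborel (\<lambda>x. exp (r * (x - y)) * joint \<theta> x)"
      using lborel_integrable_real_affine[OF D.tilt_integrable[OF that, of "\<theta> - y"], of 1 "- y"] e
      by (simp add: add.commute)
    show "joint_tilt r \<theta> = D.tilt r (\<theta> - y)"
      using lborel_integral_real_affine[of 1 "\<lambda>x. exp (r * x) * (H x * g (x - (\<theta> - y)))" "- y"] e
      by (simp add: joint_tilt_def D.tilt_def add.commute)
    have "g (y - x - \<theta>) = g (x - (y - \<theta>))" for x
      using D.G.minus_commute[of "y - \<theta>" x] by (simp add: algebra_simps)
    then show "joint_tilt (- r) \<theta> = D.tilt r (y - \<theta>)"
      using lborel_integral_real_affine[of "-1" "\<lambda>x. exp (- r * (x - y)) * joint \<theta> x" y]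
      by (simp add: joint_tilt_def joint_def D.tilt_def)
  qed
  obtain J where J: "0 \<le> J" and mgf: "\<And>r. \<bar>r\<bar> \<le> d / 4 \<Longrightarrow> integrable lborel (\<lambda>z. exp (r * z) * g z)"
    "\<And>r. \<bar>r\<bar> \<le> d / 4 \<Longrightarrow> mgf r \<le> 1 + J * r\<^sup>2"
    using mgf_le[OF d g_le] by blast
  define c where "c = D.rate"
  have c: "0 < c" using D.rate_pos by (simp add: c_def)
  \<comment> \<open>\<open>a\<close>, 1 and \<open>b\<close> serve \<open>tilt_bound\<close>,
    \<open>d / 4\<close> serves \<open>mgf_le\<close>, \<open>1 / c\<close> gives
    \<open>c * s \<le> 1\<close>, and the last entry gives
    \<open>J * s\<^sup>2 \<le> c * s / 2\<close>, so that the quadratic cost takes at most half of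
    the linear gain.\<close>
  define s where "s = Min {a, 1, b, d / 4, 1 / c, c / (2 * (J + 1))}"
  have le: "s \<le> x" if "x \<in> {a, 1, b, d / 4, 1 / c, c / (2 * (J + 1))}" for x
    unfolding s_def by (rule Min_le[OF _ that]) simp
  have s: "0 < s" "s \<le> a" "s \<le> 1" "s \<le> b" "s \<le> d / 4" "s \<le> 1 / c" "s \<le> c / (2 * (J + 1))"
  proof -
    show "0 < s" using D.a_pos D.b_pos d c J by (simp add: s_def)
  qed (rule le; simp)+
  have cs: "c * s \<le> 1" using s(6) c by (simp add: field_simps)
  have Js: "J * s \<le> c / 2"
  proof -
    have "s * (J + 1) \<le> c / 2" using s(7) J by (simp add: field_simps)
    then show ?thesis using s by (simp add: algebra_simps)
  qed
  obtain C where C: "0 \<le> C" and tb: "\<And>\<theta>. D.tilt s \<theta> \<le> ((1 - c * s) * exp (s * \<theta>) + C) * D.conv \<theta>"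
    using D.tilt_bound[OF s(1-4)] cs unfolding c_def by blast
  define V where "V = (\<lambda>\<theta>. exp (s * (\<theta> - y)) + exp (- s * (\<theta> - y)))"
  have V_meas [measurable]: "V \<in> borel_measurable borel" unfolding V_def by measurable
  have V_nonneg: "0 \<le> V \<theta>" for \<theta> by (simp add: V_def)
  define \<gamma> where "\<gamma> = 1 - c * s / 2"
  define \<beta> where "\<beta> = 2 * (1 + J * s\<^sup>2) * C"
  have \<gamma>: "0 \<le> \<gamma>" "\<gamma> < 1" using cs c s by (auto simp: \<gamma>_def)
  have \<beta>: "0 \<le> \<beta>" using J C by (simp add: \<beta>_def)
  have sd: "\<bar>s\<bar> \<le> d / 4" "\<bar>- s\<bar> \<le> d / 4" "\<bar>s\<bar> \<le> b" "\<bar>- s\<bar> \<le> b" using s by auto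
  have int_g: "integrable lborel (\<lambda>z. exp (s * z) * g z)" "integrable lborel (\<lambda>z. exp (- s * z) * g z)"
    using mgf(1)[OF sd(1)] mgf(1)[OF sd(2)] by auto
  have kV: "(\<integral>\<^sup>+t. ennreal (V t * k \<theta> t) \<partial>lborel) \<le> ennreal (\<gamma> * V \<theta> + \<beta>)" for \<theta>
  proof -
    have "(\<integral>\<^sup>+t. ennreal (V t * k \<theta> t) \<partial>lborel)
        = (\<integral>\<^sup>+t. ennreal (exp (s * (t - y))) * ennreal (k \<theta> t)
            + ennreal (exp (- s * (t - y))) * ennreal (k \<theta> t) \<partial>lborel)"
      using k_nonneg by (simp add: V_def ennreal_mult'[symmetric] distrib_right)
    also have "\<dots> = (\<integral>\<^sup>+t. ennreal (exp (s * (t - y))) * ennreal (k \<theta> t) \<partial>lborel)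
            + (\<integral>\<^sup>+t. ennreal (exp (- s * (t - y))) * ennreal (k \<theta> t) \<partial>lborel)"
      by (rule nn_integral_add) auto
    also have "\<dots> = ennreal (mgf s * (joint_tilt s \<theta> / marg \<theta>)) + ennreal (mgf (- s) * (joint_tilt (- s) \<theta> / marg \<theta>))"
      using int_g tilt(1)[OF sd(3)] tilt(1)[OF sd(4)] by (simp only: nn_exp_k minus_minus)
    also have "\<dots> = ennreal (mgf s * (joint_tilt s \<theta> / marg \<theta> + joint_tilt (- s) \<theta> / marg \<theta>))"
      using mgf_nonneg[of s] marg_pos[of \<theta>]
      by (simp add: mgf_minus joint_tilt_def distrib_left less_imp_le)
    also have "\<dots> \<le> ennreal (\<gamma> * V \<theta> + \<beta>)"
    proof (rule ennreal_leI)
      have 1: "joint_tilt s \<theta> / marg \<theta> \<le> (1 - c * s) * exp (s * (\<theta> - y)) + C"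
        unfolding tilt(2)[OF sd(3)] using tb[of "\<theta> - y"] marg_pos[of \<theta>] marg_conv(1)[of \<theta>]
        by (simp add: pos_divide_le_eq)
      have 2: "joint_tilt (- s) \<theta> / marg \<theta> \<le> (1 - c * s) * exp (- s * (\<theta> - y)) + C"
      proof -
        have e: "exp (- s * (\<theta> - y)) = exp (s * (y - \<theta>))" by (simp add: algebra_simps)
        show ?thesis
          unfolding tilt(3)[OF sd(3)] e using tb[of "y - \<theta>"] marg_pos[of \<theta>] marg_conv(2)[of \<theta>]
          by (simp add: pos_divide_le_eq)
      qed
      have "mgf s * (joint_tilt s \<theta> / marg \<theta> + joint_tilt (- s) \<theta> / marg \<theta>)
          \<le> (1 + J * s\<^sup>2) * ((1 - c * s) * V \<theta> + 2 * C)"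
      proof (rule mult_mono)
        show "mgf s \<le> 1 + J * s\<^sup>2" by (rule mgf(2)[OF sd(1)])
        show "joint_tilt s \<theta> / marg \<theta> + joint_tilt (- s) \<theta> / marg \<theta> \<le> (1 - c * s) * V \<theta> + 2 * C"
          using 1 2 by (simp add: V_def algebra_simps)
      qed (use J marg_pos[of \<theta>] in \<open>auto simp: joint_tilt_def less_imp_le\<close>)
      also have "\<dots> = ((1 + J * s\<^sup>2) * (1 - c * s)) * V \<theta> + \<beta>" by (simp add: \<beta>_def algebra_simps)
      also have "\<dots> \<le> \<gamma> * V \<theta> + \<beta>"
      proof (intro add_right_mono mult_right_mono V_nonneg)
        have "s * (J * s) \<le> s * (c / 2)" using Js s by (intro mult_left_mono) auto
        moreover have "0 \<le> J * s\<^sup>2 * (c * s)" using J c s by simp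
        ultimately show "(1 + J * s\<^sup>2) * (1 - c * s) \<le> \<gamma>"
          by (simp add: \<gamma>_def algebra_simps power2_eq_square)
      qed
      finally show "mgf s * (joint_tilt s \<theta> / marg \<theta> + joint_tilt (- s) \<theta> / marg \<theta>) \<le> \<gamma> * V \<theta> + \<beta>" .
    qed
    finally show ?thesis .
  qed
  have Vk_int: "integrable lborel (\<lambda>t. V t * k \<theta> t)" for \<theta>
    using kV[of \<theta>] V_nonneg k_nonneg
    by (intro integrableI_nonneg) (auto intro: le_less_trans)
  have drift: "(\<integral>t. V t * k \<theta> t \<partial>lborel) \<le> \<gamma> * V \<theta> + \<beta>" for \<theta>
  proof -
    have "ennreal (\<integral>t. V t * k \<theta> t \<partial>lborel) \<le> ennreal (\<gamma> * V \<theta> + \<beta>)"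
      using kV[of \<theta>] nn_integral_eq_integral[OF Vk_int[of \<theta>]] V_nonneg k_nonneg by simp
    moreover have "0 \<le> \<gamma> * V \<theta> + \<beta>" using \<gamma> \<beta> V_nonneg[of \<theta>] by simp
    ultimately show ?thesis using ennreal_le_iff by blast
  qed
  \<comment> \<open>\<open>V\<close> dominates \<open>s * \<bar>\<theta> - y\<bar>\<close>, so its
    sublevel sets are bounded and \<open>local_minorisation\<close> applies.\<close>
  have minor: "\<exists>\<epsilon>>0. \<forall>\<theta>. V \<theta> \<le> R \<longrightarrow> (\<forall>t\<in>{0..1}. \<epsilon> \<le> k \<theta> t)" for R
  proof -
    obtain \<epsilon> where \<epsilon>: "\<epsilon> > 0" "\<And>\<theta> t. \<bar>\<theta>\<bar> \<le> \<bar>y\<bar> + R / s \<Longrightarrow> t \<in> {0..1} \<Longrightarrow> \<epsilon> \<le> k \<theta> t"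
      using local_minorisation[of "\<bar>y\<bar> + R / s"] by blast
    have "\<bar>\<theta>\<bar> \<le> \<bar>y\<bar> + R / s" if "V \<theta> \<le> R" for \<theta>
    proof -
      have "s * \<bar>\<theta> - y\<bar> \<le> V \<theta>"
      proof (cases "y \<le> \<theta>")
        case True
        have "s * (\<theta> - y) \<le> exp (s * (\<theta> - y))" using exp_ge_add_one_self[of "s * (\<theta> - y)"] by linarith
        then show ?thesis using True by (simp add: V_def add_increasing2)
      next
        case False
        have "- s * (\<theta> - y) \<le> exp (- s * (\<theta> - y))" using exp_ge_add_one_self[of "- s * (\<theta> - y)"] by linarith
        moreover have "s * \<bar>\<theta> - y\<bar> = - s * (\<theta> - y)" using False by (simp add: algebra_simps)
        ultimately show ?thesis
          unfolding V_def using exp_ge_zero[of "s * (\<theta> - y)"] by linarith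
      qed
      then have "\<bar>\<theta> - y\<bar> \<le> R / s" using that s by (simp add: pos_le_divide_eq mult.commute)
      then show ?thesis by linarith
    qed
    then show ?thesis using \<epsilon> by blast
  qed
  have pV: "integrable lborel (\<lambda>t. V t * post t)"
  proof -
    have H_int: "integrable lborel (\<lambda>u. exp (r * u) * H u)" if "\<bar>r\<bar> \<le> b" for r
    proof (rule Bochner_Integration.integrable_bound[OF D.H_exp])
      have "r * u \<le> b * \<bar>u\<bar>" for u
        using that mult_right_mono[OF that, of "\<bar>u\<bar>"] abs_ge_self[of "r * u"] by (simp add: abs_mult)
      then show "AE u in lborel. norm (exp (r * u) * H u) \<le> norm (exp (b * \<bar>u\<bar>) * H u)"
        by (intro AE_I2) (auto simp: abs_mult intro!: mult_right_mono)
    qed simp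
    have "integrable lborel (\<lambda>t. exp (s * (t - y)) * marg t)"
      using int_g(2) H_int[OF sd(4)] by (rule exp_marg_finite)
    moreover have "integrable lborel (\<lambda>t. exp (- s * (t - y)) * marg t)"
      using int_g(1) H_int[OF sd(3)] exp_marg_finite[of "- s"] by simp
    ultimately have "integrable lborel (\<lambda>t. (exp (s * (t - y)) * marg t + exp (- s * (t - y)) * marg t) / (D.H.mass * D.G.mass))"
      by (intro integrable_divide Bochner_Integration.integrable_add)
    then show ?thesis by (simp add: V_def post_def distrib_right)
  qed
  obtain C' r where "0 \<le> r" "r < 1"
    "\<And>\<theta> n. tv_dist (chain_law K n \<theta>) (density lborel (\<lambda>t. ennreal (post t))) \<le> C' * (1 + V \<theta>) * r ^ n"
    using harris[OF V_meas V_nonneg Vk_int drift \<gamma> \<beta> minor post_measurable post_nonneg post_mass reversible pV]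
    by blast
  then show ?thesis
    unfolding gibbs_rate_bound_def by (intro exI[of _ "\<lambda>\<theta>. C' * (1 + V \<theta>)"] exI[of _ r]) auto
qed

text \<open>Writing \<open>x powr \<beta>\<close> as \<open>x * x powr (\<beta> - 1)\<close> gives
  \<open>p powr \<beta> - q powr \<beta> \<ge> p - q\<close> once \<open>p \<ge> 1\<close>, and
  \<open>p - q\<close> is \<open>2 * v / \<tau>\<close>. Hence \<open>1 / \<tau>\<close> is a decay
  rate for every exponent.\<close>

lemma exp_power_decay:
  assumes "\<beta> \<ge> 1" "\<tau> > 0" and uv: "0 \<le> v" "v \<le> u" "\<tau> \<le> u"
  shows "exp_power \<beta> \<tau> (u + v) \<le> exp (- 2 * (1 / \<tau>) * v) * exp_power \<beta> \<tau> (u - v)"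
proof -
  define p where "p = (u + v) / \<tau>"
  define q where "q = (u - v) / \<tau>"
  have p: "1 \<le> p" and q: "0 \<le> q" "q \<le> p" using uv assms by (auto simp: p_def q_def field_simps)
  have split: "x powr \<beta> = x * x powr (\<beta> - 1)" if "0 \<le> x" for x
    using that by (cases "x = 0") (auto simp: powr_diff)
  have "q powr \<beta> \<le> q * p powr (\<beta> - 1)"
    unfolding split[OF q(1)] using q assms by (intro mult_left_mono powr_mono2) auto
  moreover have "p powr \<beta> = p * p powr (\<beta> - 1)" using p by (intro split) auto
  moreover have "(p - q) * 1 \<le> (p - q) * p powr (\<beta> - 1)"
    using p q assms by (intro mult_left_mono ge_one_powr_ge_zero) auto
  ultimately have "p - q \<le> p powr \<beta> - q powr \<beta>" by (simp add: algebra_simps)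
  moreover have "p - q = 2 * (1 / \<tau>) * v" by (simp add: p_def q_def diff_divide_distrib[symmetric])
  ultimately have "- (p powr \<beta>) \<le> - 2 * (1 / \<tau>) * v + - (q powr \<beta>)" by simp
  then have "exp (- (p powr \<beta>)) \<le> exp (- 2 * (1 / \<tau>) * v) * exp (- (q powr \<beta>))"
    unfolding exp_add[symmetric] by simp
  then show ?thesis using uv by (simp add: exp_power_def p_def q_def)
qed

lemma exp_power_geometric:
  assumes "\<beta> \<ge> 1" "\<tau> > 0" "\<beta>' \<ge> 1" "\<tau>' > 0"
  shows "\<exists>M. gibbs_model.gibbs_rate_bound (exp_power \<beta> \<tau>) (exp_power \<beta>' \<tau>') y M"
proof (rule drift_geometric)
  interpret H: error_density "exp_power \<beta> \<tau>" by (rule error_density_exp_power[OF assms(1,2)])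
  interpret G: error_density "exp_power \<beta>' \<tau>'" by (rule error_density_exp_power[OF assms(3,4)])
  \<comment> \<open>Half of the Laplace rate \<open>1 / \<tau>\<close> is a safe exponential moment:
    the other half keeps the integral finite.\<close>
  show "drift_model (exp_power \<beta> \<tau>) (exp_power \<beta>' \<tau>') (1 / \<tau>) (1 / (2 * \<tau>)) \<tau>"
  proof
    show "integrable lborel (\<lambda>x. exp (1 / (2 * \<tau>) * \<bar>x\<bar>) * exp_power \<beta> \<tau> x)"
    proof (rule Bochner_Integration.integrable_bound)
      show "integrable lborel (\<lambda>x. exp 1 * exp (- (1 / (2 * \<tau>)) * \<bar>x\<bar>))"
        using laplace_integrable[of "1 / (2 * \<tau>)"] assms by simp
      have "exp (1 / (2 * \<tau>) * \<bar>x\<bar>) * exp_power \<beta> \<tau> x \<le> exp 1 * exp (- (1 / (2 * \<tau>)) * \<bar>x\<bar>)" for x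
      proof -
        have "exp (1 / (2 * \<tau>) * \<bar>x\<bar>) * exp_power \<beta> \<tau> x
            \<le> exp (1 / (2 * \<tau>) * \<bar>x\<bar>) * (exp 1 * exp (- (1 / \<tau>) * \<bar>x\<bar>))"
          by (intro mult_left_mono exp_power_le_laplace assms) auto
        also have "\<dots> = exp 1 * exp (- (1 / (2 * \<tau>)) * \<bar>x\<bar>)"
          using assms(2) unfolding exp_add[symmetric] by (simp add: field_simps)
        finally show ?thesis .
      qed
      then show "AE x in lborel. norm (exp (1 / (2 * \<tau>) * \<bar>x\<bar>) * exp_power \<beta> \<tau> x)
          \<le> norm (exp 1 * exp (- (1 / (2 * \<tau>)) * \<bar>x\<bar>))"
        by (intro AE_I2) (simp add: abs_mult)
    qed simp
  qed (use assms exp_power_decay[OF assms(1,2)] in auto)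
  show "0 < 1 / \<tau>'" using assms by simp
  show "exp_power \<beta>' \<tau>' z \<le> exp 1 * exp (- (1 / \<tau>') * \<bar>z\<bar>)" for z
    by (rule exp_power_le_laplace[OF assms(3,4)])
qed

section \<open>Classification\<close>

lemma gibbs_model_fam_dens:
  assumes "s1 > 0" "s2 > 0" "fam_ok f1" "fam_ok f2"
  shows "gibbs_model (fam_dens f1 s1) (fam_dens f2 s2)"
  using assms by (intro gibbs_model.intro error_density_fam_dens)

context
  fixes y s1 s2 :: real and f1 f2 :: fam
  assumes pos: "s1 > 0" "s2 > 0" and ok: "fam_ok f1" "fam_ok f2"
begin

abbreviation "rate_bound \<equiv> gibbs_model.gibbs_rate_bound (fam_dens f1 s1) (fam_dens f2 s2) y"

lemma fam_C_uniform:
  assumes "f2 = FamC" shows "\<exists>M. rate_bound (\<lambda>_. M)"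
proof -
  obtain C where "C > 0" "\<And>x. fam_dens f1 s1 x \<le> C * cauchy s2 x"
    using fam_dens_le_cauchy[OF pos(1) ok(1) pos(2)] by blast
  then show ?thesis
    using gibbs_model_fam_dens[OF pos ok] cauchy_uniform[OF _ pos(2)] assms
    by (simp add: fam_dens_C del: fam_dens.simps)
qed

lemma fam_E_uniform:
  assumes "f2 = FamE" and f1: "f1 = FamE \<and> s1 < s2 \<or> f1 = FamG \<or> is_L f1"
  shows "\<exists>M. rate_bound (\<lambda>_. M)"
proof -
  have g: "fam_dens f2 s2 = exp_power 1 s2" using assms pos fam_dens_E by simp
  obtain C b where "C > 0" "b > 1 / s2" "\<And>x. fam_dens f1 s1 x \<le> C * exp (- b * \<bar>x\<bar>)"
  proof (cases "f1 = FamE")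
    case True
    then have "s1 < s2" using f1 by (auto simp: is_L_def)
    then show thesis
      using that[of 1 "1 / s1"] pos True by (simp add: divide_strict_left_mono)
  next
    case False
    then obtain \<beta> \<tau> where "\<beta> \<ge> 2" "\<tau> > 0" "fam_dens f1 s1 = exp_power \<beta> \<tau>"
      using fam_dens_light[OF pos(1) ok(1)] f1 by blast
    \<comment> \<open>Lighter tails admit every rate; \<open>2 / s2\<close> is one above the
      required \<open>1 / s2\<close>.\<close>
    then show thesis
      using that[of "exp (1 + (2 / s2 * \<tau>)\<^sup>2 / 4)" "2 / s2"] exp_power_le_any_laplace[of \<beta> \<tau> _ "2 / s2"] pos
      by (simp add: divide_strict_right_mono)
  qed
  then show ?thesis
    using gibbs_model_fam_dens[OF pos ok] laplace_uniform[OF _ pos(2)] unfolding g by blast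
qed

lemma fam_C_not_geometric:
  assumes "f1 = FamC" "f2 \<noteq> FamC" shows "\<not> rate_bound M"
proof -
  obtain \<beta> \<tau> where b: "\<beta> \<ge> 1" "\<tau> > 0" "fam_dens f2 s2 = exp_power \<beta> \<tau>"
    using fam_dens_exp_power[OF pos(2) ok(2) assms(2)] .
  have "gibbs_model (cauchy s1) (exp_power \<beta> \<tau>)"
    using gibbs_model_fam_dens[OF pos ok] b assms fam_dens_C by simp
  then have "\<not> gibbs_model.gibbs_rate_bound (cauchy s1) (exp_power \<beta> \<tau>) y M"
    by (rule cauchy_not_geometric[OF _ pos(1), where a="1 / \<tau>"]) (use b exp_power_le_laplace in auto)
  then show ?thesis using b assms fam_dens_C by simp
qed

lemma fam_light_geometric:
  assumes "f1 \<noteq> FamC" "f2 \<noteq> FamC" shows "\<exists>M. rate_bound M"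
  using fam_dens_exp_power[OF pos(1) ok(1) assms(1)] fam_dens_exp_power[OF pos(2) ok(2) assms(2)]
    exp_power_geometric by metis

end

theorem mainTheorem7:
  fixes y s1 s2 :: real and f1 f2 :: fam
  assumes "s1 > 0" and "s2 > 0" and "fam_ok f1" and "fam_ok f2"
  shows
    "(f2 = FamC \<longrightarrow> unif_ergodic Centred f1 s1 f2 s2 y)
   \<and> (f2 = FamE \<longrightarrow>
        (f1 = FamC \<longrightarrow> \<not> geom_ergodic Centred f1 s1 f2 s2 y)
      \<and> (f1 = FamE \<longrightarrow> geom_ergodic Centred f1 s1 f2 s2 y
                       \<and> (s2 > s1 \<longrightarrow> unif_ergodic Centred f1 s1 f2 s2 y))
      \<and> (f1 = FamG \<or> is_L f1 \<longrightarrow> unif_ergodic Centred f1 s1 f2 s2 y))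
   \<and> (f2 = FamG \<or> is_L f2 \<longrightarrow>
        (f1 = FamC \<longrightarrow> \<not> geom_ergodic Centred f1 s1 f2 s2 y)
      \<and> (f1 = FamE \<or> f1 = FamG \<or> is_L f1 \<longrightarrow> geom_ergodic Centred f1 s1 f2 s2 y))
   \<and> (f2 = FamC \<longrightarrow>
        (f1 = FamC \<longrightarrow> unif_ergodic NonCentred f1 s1 f2 s2 y)
      \<and> (f1 = FamE \<or> f1 = FamG \<or> is_L f1 \<longrightarrow> \<not> geom_ergodic NonCentred f1 s1 f2 s2 y))
   \<and> (f2 = FamE \<longrightarrow>
        (f1 = FamC \<longrightarrow> unif_ergodic NonCentred f1 s1 f2 s2 y)
      \<and> (f1 = FamE \<longrightarrow> geom_ergodic NonCentred f1 s1 f2 s2 y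
                       \<and> (s1 > s2 \<longrightarrow> unif_ergodic NonCentred f1 s1 f2 s2 y))
      \<and> (f1 = FamG \<or> is_L f1 \<longrightarrow> geom_ergodic NonCentred f1 s1 f2 s2 y))
   \<and> (f2 = FamG \<or> is_L f2 \<longrightarrow>
        (f1 = FamC \<or> f1 = FamE \<longrightarrow> unif_ergodic NonCentred f1 s1 f2 s2 y)
      \<and> (f1 = FamG \<or> is_L f1 \<longrightarrow> geom_ergodic NonCentred f1 s1 f2 s2 y))"


proof -
  note fam_dens.simps [simp del]
  \<comment> \<open>Families and scales are quantified afresh, because the non-centred conclusions
    are used with the two errors exchanged.\<close>
  have uni: "unif_ergodic Centred f1 s1 f2 s2 y" "unif_ergodic NonCentred f2 s2 f1 s1 y"
    if "s1 > 0" "s2 > 0" "fam_ok f1" "fam_ok f2"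
      "f2 = FamC \<or> f2 = FamE \<and> (f1 = FamE \<and> s1 < s2 \<or> f1 = FamG \<or> is_L f1)" for f1 f2 s1 s2
  proof -
    note h = that
    obtain M where "gibbs_model.gibbs_rate_bound (fam_dens f1 s1) (fam_dens f2 s2) y (\<lambda>_. M)"
      using fam_C_uniform[OF h(1-4)] fam_E_uniform[OF h(1-4)] h(5) by blast
    moreover have "bdd_above (range (\<lambda>_::real. M))" by simp
    ultimately show "unif_ergodic Centred f1 s1 f2 s2 y" "unif_ergodic NonCentred f2 s2 f1 s1 y"
      unfolding unif_ergodic_iff[OF gibbs_model_fam_dens[OF that(1-4)]] by blast+
  qed
  have neg: "\<not> geom_ergodic Centred f1 s1 f2 s2 y" "\<not> geom_ergodic NonCentred f2 s2 f1 s1 y"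
    if "s1 > 0" "s2 > 0" "fam_ok f1" "fam_ok f2" "f1 = FamC" "f2 \<noteq> FamC" for f1 f2 s1 s2
    using fam_C_not_geometric[OF that]
    unfolding geom_ergodic_iff[OF gibbs_model_fam_dens[OF that(1-4)]] by blast+
  have geo: "geom_ergodic Centred f1 s1 f2 s2 y" "geom_ergodic NonCentred f2 s2 f1 s1 y"
    if "s1 > 0" "s2 > 0" "fam_ok f1" "fam_ok f2" "f1 \<noteq> FamC" "f2 \<noteq> FamC" for f1 f2 s1 s2
    using fam_light_geometric[OF that]
    unfolding geom_ergodic_iff[OF gibbs_model_fam_dens[OF that(1-4)]] by blast+
  have L: "is_L f \<Longrightarrow> f \<noteq> FamC" for f by (auto simp: is_L_def)
  note c = assms(1,2,3,4) and n = assms(2,1,4,3)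
  show ?thesis
    using uni(1)[OF c] uni(2)[OF n] neg(1)[OF c] neg(2)[OF n] geo(1)[OF c] geo(2)[OF n] L[of f1] L[of f2]
    by (intro conjI impI) auto
qed

end
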